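(* Let $\gamma>0$, $\rho<0$, and let $X_1,\dots,X_n$ be i.i.d. nonnegative random variables with distribution function $F$ whose quantile function $U(t)=F^{\leftarrow}(1-1/t)$, $t\ge1$, satisfies the second-order condition: there is a measurable function $A$, of constant sign near infinity, not identically zero, with $A(t)\to0$ as $t\to\infty$, such that $$\lim_{t\to\infty}\frac{U(tx)/U(t)-x^{\gamma}}{A(t)}=x^{\gamma}\frac{x^{\rho}-1}{\rho}\quad\text{for all }x>0.$$ Let $r\in\mathbb{R}$ with $\gamma r<1/2$, and let $k=k(n)$ be integers with $1\le k<n$, $k(n)\to\infty$, $n/k(n)\to\infty$, and $\lim_{n\to\infty}\sqrt{k}\,A(n/k)=\mu\in(-\infty,\infty)$. Then, as $n\to\infty$, $$\sqrt{k}\big(G_n(k,r,0)-\xi(r,0),\ G_n(k,r,1)-\xi(r,1)\big)\xrightarrow{d}\mu\big(\nu^{(1)}(r),\nu^{(2)}(r)\big)+\big(W^{(1)},W^{(2)}\big),$$ where, with $d_r(m)=1-m\gamma r$, $$\nu^{(1)}(r)=\frac{r}{d_r(1)(d_r(1)-\rho)},\qquad \nu^{(2)}(r)=\frac{1-\rho-\gamma^2r^2}{d_r(1)^2(d_r(1)-\rho)^2},$$ and $(W^{(1)},W^{(2)})$ is a zero-mean Gaussian random vector with $\mathrm{E}(W^{(1)})^2=s_1^2(r)$, $\mathrm{E}(W^{(2)})^2=s_2^2(r)$, $\mathrm{E}(W^{(1)}W^{(2)})=s_{12}(r)$, where $$s_1^2(r)=\frac{\gamma^2r^2}{d_r(2)d_r(1)^2},\quad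 s_2^2(r)=\frac{\gamma^2\big(d_r(2)+2\gamma^4r^4\big)}{d_r(2)^3d_r(1)^4},\quad s_{12}(r)=\frac{\gamma^2 r\big(d_r(1)-\gamma^2r^2\big)}{d_r(2)^2d_r(1)^3}.$$
   Context: For a monotone function $W$, $W^{\leftarrow}(t)=\sup\{x: W(x)\le t\}$. $X_{n,1}\le\dots\le X_{n,n}$ are the order statistics of $X_1,\dots,X_n$. For $x\ge1$, $g_{r,u}(x)=x^r(\ln x)^u$, and $G_n(k,r,u)=\frac1k\sum_{i=0}^{k-1} g_{r,u}\big(X_{n-i,n}/X_{n-k,n}\big)$. Also $\xi(r,u)=\gamma^u\Gamma(1+u)/(1-\gamma r)^{1+u}$, so $\xi(r,0)=1/(1-\gamma r)$ and $\xi(r,1)=\gamma/(1-\gamma r)^2$. $\xrightarrow{d}$ denotes convergence in distribution. *)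

theory Defs
  imports "HOL-Probability.Probability"
begin

definition gen_inv :: "(real \<Rightarrow> real) \<Rightarrow> real \<Rightarrow> real" where
  "gen_inv W t = Sup {x. W x \<le> t}"

text \<open>Order statistic X_{j,n} (1 <= j <= n) of the sample X 0, ..., X (n-1).\<close>
definition order_stat :: "(nat \<Rightarrow> 'a \<Rightarrow> real) \<Rightarrow> nat \<Rightarrow> nat \<Rightarrow> 'a \<Rightarrow> real" where
  "order_stat X j n \<omega> = sort (map (\<lambda>i. X i \<omega>) [0..<n]) ! (j - 1)"

definition g_fun :: "real \<Rightarrow> nat \<Rightarrow> real \<Rightarrow> real" where
  "g_fun r u x = x powr r * (ln x) ^ u"

definition G_n :: "(nat \<Rightarrow> 'a \<Rightarrow> real) \<Rightarrow> nat \<Rightarrow> nat \<Rightarrow> real \<Rightarrow> nat \<Rightarrow> 'a \<Rightarrow> real" where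
  "G_n X n k r u \<omega> =
     (1 / real k) * (\<Sum>i<k. g_fun r u (order_stat X (n - i) n \<omega> / order_stat X (n - k) n \<omega>))"

definition xi :: "real \<Rightarrow> real \<Rightarrow> nat \<Rightarrow> real" where
  "xi \<gamma> r u = \<gamma> ^ u * Gamma (1 + real u) / (1 - \<gamma> * r) ^ (1 + u)"

text \<open>Bivariate Gaussian law on R^2 with mean m, variances v1, v2 and covariance c,
  defined via its one-dimensional projections (Cramer--Wold); degenerate projections
  are point masses.\<close>
definition gaussian2 :: "(real \<times> real) measure \<Rightarrow> real \<times> real \<Rightarrow> real \<Rightarrow> real \<Rightarrow> real \<Rightarrow> bool" where
  "gaussian2 N m v1 v2 c \<longleftrightarrow> prob_space N \<and> sets N = sets borel \<and>
     (\<forall>a b. let mu = a * fst m + b * snd m; s2 = a\<^sup>2 * v1 + 2 * a * b * c + b\<^sup>2 * v2 in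
        distr N borel (\<lambda>z. a * fst z + b * snd z) =
          (if s2 = 0 then return borel mu else density lborel (normal_density mu (sqrt s2))))"

definition conv_distr2 :: "'a measure \<Rightarrow> (nat \<Rightarrow> 'a \<Rightarrow> real \<times> real) \<Rightarrow> (real \<times> real) measure \<Rightarrow> bool" where
  "conv_distr2 M Z N \<longleftrightarrow>
     (\<forall>f :: real \<times> real \<Rightarrow> real. continuous_on UNIV f \<and> bounded (range f) \<longrightarrow>
        (\<lambda>n. integral\<^sup>L M (\<lambda>\<omega>. f (Z n \<omega>))) \<longlonglongrightarrow> integral\<^sup>L N f)"

end

theory Submission
  imports Defs
begin

text \<open>
  Write the sample as \<open>X\<^sub>i = u (E\<^sub>i)\<close> with independent standard exponential \<open>E\<^sub>i\<close> and
  \<open>u t = U (exp t)\<close>. The order statistics see only which index is the \<open>(k+1)\<close>-st largest and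
  which \<open>k\<close> indices lie above it; conditionally on the value \<open>t\<close> at that pivot the
  exceedances \<open>E\<^sub>j - t\<close> are again independent standard exponential, so the statistic is a
  mixture, over a Beta-type law of \<open>exp (- t)\<close> concentrating at \<open>k/n\<close>, of normalised sums of
  \<open>k\<close> independent copies of \<open>g (u (t + E) / u t)\<close>.

  Writing \<open>u (t + x) / u t = exp (\<gamma> x + dev t x)\<close>, the second-order condition says
  \<open>dev t x / a t \<longlonglongrightarrow> (exp (\<rho> x) - 1) / \<rho>\<close> pointwise, where \<open>a t = A (exp t)\<close>; a
  Steinhaus-type measure argument upgrades this to \<open>\<bar>dev t x\<bar> \<le> C \<bar>a t\<bar>\<close> uniformly in \<open>x \<ge> 0\<close>,
  which is the domination needed for the limit of the characteristic functions of these
  triangular arrays. Convergence of the characteristic functions gives weak convergence by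
  approximating a bounded continuous function by trigonometric polynomials.
\<close>

section \<open>Second-order regular variation in additive form\<close>

lemma pointwise_null_imp_measure_null:
  fixes f :: "nat \<Rightarrow> 'a \<Rightarrow> real"
  assumes [measurable]: "\<And>n. f n \<in> borel_measurable M" and A: "A \<in> fmeasurable M"
    and lim: "\<And>x. (\<lambda>n. f n x) \<longlonglongrightarrow> 0" and "0 < e"
  shows "(\<lambda>n. measure M {x \<in> space M. x \<in> A \<and> e \<le> \<bar>f n x\<bar>}) \<longlonglongrightarrow> 0"
proof -
  let ?B = "\<lambda>n. {x \<in> space M. x \<in> A \<and> e \<le> \<bar>f n x\<bar>}"
  have [measurable]: "A \<in> sets M" using A by (rule fmeasurableD)
  have "(\<lambda>n. integral\<^sup>L M (indicat_real (?B n))) \<longlonglongrightarrow> integral\<^sup>L M (\<lambda>x. 0)"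
  proof (rule integral_dominated_convergence[where w = "indicator A"])
    show "integrable M (indicat_real A)"
      using A by (simp add: fmeasurable_def)
    show "AE x in M. (\<lambda>n. indicat_real (?B n) x) \<longlonglongrightarrow> 0"
    proof (intro AE_I2 tendsto_eventually)
      fix x
      have "\<forall>\<^sub>F n in sequentially. \<bar>f n x\<bar> < e"
        using tendsto_rabs_zero[OF lim] \<open>0 < e\<close> by (rule order_tendstoD)
      then show "\<forall>\<^sub>F n in sequentially. indicat_real (?B n) x = 0"
        by eventually_elim (simp add: indicator_def)
    qed
  qed (auto split: split_indicator)
  moreover have "integral\<^sup>L M (indicat_real (?B n)) = measure M (?B n)" for n
    by (simp add: Int_absorb2 Collect_conj_eq)
  ultimately show ?thesis by simp
qed

lemma exists_shift_avoiding:
  fixes P Q :: "real set" and s :: real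
  assumes P: "P \<in> fmeasurable lborel" and Q: "Q \<in> fmeasurable lborel"
    and small: "measure lborel P + measure lborel Q < 1"
  shows "\<exists>y\<in>{0..1}. s + y \<notin> P \<and> y \<notin> Q"
proof (rule ccontr)
  assume "\<not> ?thesis"
  then have cover: "{0..1} \<subseteq> (+) s -` P \<union> Q" by auto
  have [measurable]: "P \<in> sets borel" "Q \<in> sets borel"
    using P Q by (auto simp: fmeasurable_def)
  have shift: "emeasure lborel ((+) s -` P) = emeasure lborel P"
    using emeasure_distr[of "(+) s" lborel borel P] by (simp add: lborel_distr_plus)
  have meas: "(+) s -` P \<in> sets borel"
    using measurable_sets_borel[of "(+) s" borel P] by simp
  have P': "(+) s -` P \<in> fmeasurable lborel"
    using P meas by (simp add: fmeasurable_def shift)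
  have "1 = measure lborel {0..1::real}" by simp
  also have "\<dots> \<le> measure lborel ((+) s -` P \<union> Q)"
    by (rule measure_mono_fmeasurable[OF cover _ fmeasurable.Un[OF P' Q]]) simp
  also have "\<dots> \<le> measure lborel ((+) s -` P) + measure lborel Q"
    by (rule measure_Un_le) (use meas in auto)
  also have "\<dots> = measure lborel P + measure lborel Q" by (simp add: measure_def shift)
  finally show False using small by simp
qed

lemma eventually_exists_shift_both_small:
  fixes p q :: "nat \<Rightarrow> real \<Rightarrow> real" and s :: "nat \<Rightarrow> real"
  assumes [measurable]: "\<And>n. p n \<in> borel_measurable borel" "\<And>n. q n \<in> borel_measurable borel"
    and p: "\<And>x. (\<lambda>n. p n x) \<longlonglongrightarrow> 0" and q: "\<And>x. (\<lambda>n. q n x) \<longlonglongrightarrow> 0"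
    and s: "\<And>n. \<bar>s n\<bar> \<le> b" and e: "0 < e"
  shows "\<forall>\<^sub>F n in sequentially. \<exists>y\<in>{0..1}. \<bar>p n (s n + y)\<bar> < e \<and> \<bar>q n y\<bar> < e"
proof -
  define bad where "bad f n = {x \<in> space lborel. x \<in> {- b..b + 1} \<and> e \<le> \<bar>f n x\<bar>}"
    for f :: "nat \<Rightarrow> real \<Rightarrow> real" and n
  have I: "{- b..b + 1} \<in> fmeasurable lborel"
    by (simp add: fmeasurable_def emeasure_lborel_Icc_eq)
  have fm: "bad f n \<in> fmeasurable lborel" if [measurable]: "f n \<in> borel_measurable borel" for f n
    unfolding bad_def by (rule fmeasurableI2[OF I]) auto
  have "(\<lambda>n. measure lborel (bad p n) + measure lborel (bad q n)) \<longlonglongrightarrow> 0 + 0"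
    unfolding bad_def by (intro tendsto_add pointwise_null_imp_measure_null I p q e) simp_all
  then have "\<forall>\<^sub>F n in sequentially. measure lborel (bad p n) + measure lborel (bad q n) < 1"
    by (rule order_tendstoD) simp
  then show ?thesis
  proof eventually_elim
    case (elim n)
    then obtain y where y: "y \<in> {0..1}" "s n + y \<notin> bad p n" "y \<notin> bad q n"
      using exists_shift_avoiding[OF fm fm, of p n q n "s n"] by auto
    have "s n + y \<in> {- b..b + 1}" "y \<in> {- b..b + 1}"
      using y(1) s[of n] by auto
    with y show ?case
      unfolding bad_def by (auto simp: not_le)
  qed
qed

lemma filterlim_at_top_add_bounded:
  fixes t s :: "'a \<Rightarrow> real"
  assumes t: "filterlim t at_top F" and s: "\<And>n. \<bar>s n\<bar> \<le> b"
  shows "filterlim (\<lambda>n. t n + s n) at_top F"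
proof (rule filterlim_at_top_mono)
  show "filterlim (\<lambda>n. - b + t n) at_top F"
    by (rule filterlim_tendsto_add_at_top[OF tendsto_const t])
  show "\<forall>\<^sub>F n in F. - b + t n \<le> t n + s n"
  proof (intro always_eventually allI)
    show "- b + t n \<le> t n + s n" for n using s[of n] by linarith
  qed
qed

locale second_order_regular =
  fixes u a :: "real \<Rightarrow> real" and \<gamma> \<rho> :: real
  assumes mono_u: "mono u" and u_nonneg: "\<And>t. 0 \<le> u t"
    and a_measurable[measurable]: "a \<in> borel_measurable borel"
    and a_sign: "(\<forall>\<^sub>F t in at_top. a t > 0) \<or> (\<forall>\<^sub>F t in at_top. a t < 0)"
    and a_tendsto: "(a \<longlongrightarrow> 0) at_top"
    and \<rho>_neg: "\<rho> < 0"
    and second_order: "\<And>s. ((\<lambda>t. (u (t + s) / u t - exp (\<gamma> * s)) / a t) \<longlongrightarrow>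
          exp (\<gamma> * s) * (exp (\<rho> * s) - 1) / \<rho>) at_top"
begin

definition \<psi> :: "real \<Rightarrow> real" where
  "\<psi> s = (exp (\<rho> * s) - 1) / \<rho>"

definition dev :: "real \<Rightarrow> real \<Rightarrow> real" where
  "dev t s = ln (u (t + s)) - ln (u t) - \<gamma> * s"

lemma u_measurable[measurable]: "u \<in> borel_measurable borel"
  by (rule borel_measurable_mono[OF mono_u])

lemma dev_measurable[measurable]: "dev t \<in> borel_measurable borel"
  unfolding dev_def[abs_def] by measurable

lemma \<psi>_measurable[measurable]: "\<psi> \<in> borel_measurable borel"
  unfolding \<psi>_def[abs_def] by measurable

lemma shift_at_top: "filterlim (\<lambda>t. t + s) at_top (at_top :: real filter)" for s :: real
  by (rule filterlim_at_top_add_bounded[OF filterlim_ident order_refl])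

lemma a_nonzero: "\<forall>\<^sub>F t in at_top. a t \<noteq> 0"
  using a_sign by (auto elim: eventually_mono)

lemma ratio_tendsto: "((\<lambda>t. u (t + s) / u t) \<longlongrightarrow> exp (\<gamma> * s)) at_top"
proof -
  have "((\<lambda>t. (u (t + s) / u t - exp (\<gamma> * s)) / a t * a t + exp (\<gamma> * s)) \<longlongrightarrow>
      exp (\<gamma> * s) * (exp (\<rho> * s) - 1) / \<rho> * 0 + exp (\<gamma> * s)) at_top"
    by (intro tendsto_intros second_order a_tendsto)
  then have "((\<lambda>t. (u (t + s) / u t - exp (\<gamma> * s)) / a t * a t + exp (\<gamma> * s)) \<longlongrightarrow> exp (\<gamma> * s)) at_top"
    by simp
  moreover have "\<forall>\<^sub>F t in at_top.
      (u (t + s) / u t - exp (\<gamma> * s)) / a t * a t + exp (\<gamma> * s) = u (t + s) / u t"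
    using a_nonzero by eventually_elim simp
  ultimately show ?thesis
    by (rule Lim_transform_eventually)
qed

lemma u_pos: "\<forall>\<^sub>F t in at_top. u t > 0"
proof -
  have "\<forall>\<^sub>F t in at_top. u (t + 1) / u t > 0"
    using ratio_tendsto[of 1] by (rule order_tendstoD) simp
  then show ?thesis
  proof eventually_elim
    case (elim t)
    then show ?case using u_nonneg[of t] by (cases "u t = 0") auto
  qed
qed

lemma dev_tendsto: "((\<lambda>t. dev t s / a t) \<longlongrightarrow> \<psi> s) at_top"
proof -
  define w where "w t = u (t + s) / u t * exp (- (\<gamma> * s))" for t
  obtain g where g: "\<And>z. ln z - ln 1 = g z * (z - 1)" "isCont g 1" "g 1 = (1::real)"
    using DERIV_ln[of "1::real"] unfolding CARAT_DERIV by (metis inverse_1 zero_less_one)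
  have w: "(w \<longlongrightarrow> 1) at_top"
    using tendsto_mult[OF ratio_tendsto[of s] tendsto_const[of "exp (- (\<gamma> * s))"]]
    by (simp add: w_def[abs_def] exp_minus)
  have "((\<lambda>t. (u (t + s) / u t - exp (\<gamma> * s)) / a t * exp (- (\<gamma> * s))) \<longlongrightarrow>
      exp (\<gamma> * s) * (exp (\<rho> * s) - 1) / \<rho> * exp (- (\<gamma> * s))) at_top"
    by (intro tendsto_intros second_order)
  moreover have "(\<lambda>t. (u (t + s) / u t - exp (\<gamma> * s)) / a t * exp (- (\<gamma> * s))) =
      (\<lambda>t. (w t - 1) / a t)"
    by (simp add: w_def fun_eq_iff left_diff_distrib flip: exp_add)
  moreover have "exp (\<gamma> * s) * (exp (\<rho> * s) - 1) / \<rho> * exp (- (\<gamma> * s)) = \<psi> s"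
    by (simp add: \<psi>_def exp_minus)
  ultimately have "((\<lambda>t. (w t - 1) / a t) \<longlongrightarrow> \<psi> s) at_top" by simp
  then have lim: "((\<lambda>t. g (w t) * ((w t - 1) / a t)) \<longlongrightarrow> 1 * \<psi> s) at_top"
    using isCont_tendsto_compose[OF g(2) w] g(3) by (intro tendsto_mult) simp
  have "\<forall>\<^sub>F t in at_top. g (w t) * ((w t - 1) / a t) = dev t s / a t"
    using u_pos eventually_compose_filterlim[OF u_pos shift_at_top[of s]]
  proof eventually_elim
    case (elim t)
    then show ?case
      using g(1)[of "w t"] by (simp add: w_def dev_def ln_mult ln_div)
  qed
  then show ?thesis
    using Lim_transform_eventually[OF lim] by simp
qed

lemma dev_add: "dev t (s + s') = dev t s + dev (t + s) s'"
  by (simp add: dev_def algebra_simps)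

lemma \<psi>_add: "\<psi> (s + s') = \<psi> s + exp (\<rho> * s) * \<psi> s'"
  by (simp add: \<psi>_def algebra_simps exp_add add_divide_distrib diff_divide_distrib)

lemma \<psi>_bound:
  assumes "0 \<le> s" shows "\<bar>\<psi> s\<bar> \<le> 1 / \<bar>\<rho>\<bar>"
proof -
  have "exp (\<rho> * s) \<le> 1" using \<rho>_neg assms by (simp add: mult_nonpos_nonneg)
  then have "\<bar>exp (\<rho> * s) - 1\<bar> \<le> 1" using exp_gt_zero[of "\<rho> * s"] by linarith
  then show ?thesis
    unfolding \<psi>_def abs_divide by (rule divide_right_mono) simp
qed

lemma a_ratio_tendsto: "((\<lambda>t. a (t + s) / a t) \<longlongrightarrow> exp (\<rho> * s)) at_top"
proof -
  have \<psi>1: "\<psi> 1 \<noteq> 0" using \<rho>_neg by (simp add: \<psi>_def)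
  have shifted: "((\<lambda>t. dev (t + s) 1 / a (t + s)) \<longlongrightarrow> \<psi> 1) at_top"
    by (rule filterlim_compose[OF dev_tendsto shift_at_top])
  have "((\<lambda>t. (dev t (s + 1) / a t - dev t s / a t) / (dev (t + s) 1 / a (t + s))) \<longlongrightarrow>
      (\<psi> (s + 1) - \<psi> s) / \<psi> 1) at_top"
    by (intro tendsto_intros dev_tendsto \<psi>1 shifted)
  then have lim: "((\<lambda>t. (dev t (s + 1) / a t - dev t s / a t) / (dev (t + s) 1 / a (t + s))) \<longlongrightarrow>
      exp (\<rho> * s)) at_top"
    using \<psi>1 by (simp add: \<psi>_add)
  have "\<forall>\<^sub>F t in at_top. dev (t + s) 1 / a (t + s) \<noteq> 0"
    using shifted \<psi>1 by (rule tendsto_imp_eventually_ne)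
  then have "\<forall>\<^sub>F t in at_top. (dev t (s + 1) / a t - dev t s / a t) / (dev (t + s) 1 / a (t + s)) =
        a (t + s) / a t"
    using a_nonzero by eventually_elim (auto simp: dev_add[of _ s 1] add_divide_distrib)
  then show ?thesis
    by (rule Lim_transform_eventually[OF lim])
qed

lemma ln_a_tendsto: "((\<lambda>t. ln \<bar>a (t + s)\<bar> - ln \<bar>a t\<bar> - \<rho> * s) \<longlongrightarrow> 0) at_top"
proof -
  have "((\<lambda>t. ln \<bar>a (t + s) / a t\<bar> - \<rho> * s) \<longlongrightarrow> ln \<bar>exp (\<rho> * s)\<bar> - \<rho> * s) at_top"
    by (intro tendsto_intros a_ratio_tendsto) auto
  then have lim: "((\<lambda>t. ln \<bar>a (t + s) / a t\<bar> - \<rho> * s) \<longlongrightarrow> 0) at_top" by simp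
  have "\<forall>\<^sub>F t in at_top. ln \<bar>a (t + s) / a t\<bar> - \<rho> * s = ln \<bar>a (t + s)\<bar> - ln \<bar>a t\<bar> - \<rho> * s"
    using a_nonzero eventually_compose_filterlim[OF a_nonzero shift_at_top[of s]]
    by eventually_elim (simp add: ln_div abs_divide)
  then show ?thesis
    by (rule Lim_transform_eventually[OF lim])
qed

lemma dev_ratio_bound:
  defines "E \<equiv> \<lambda>t y. dev t y / a t - \<psi> y"
  assumes nz: "a t \<noteq> 0" "a (t + s) \<noteq> 0" and y: "0 \<le> y" "\<bar>E t (s + y)\<bar> < \<delta>" "\<bar>E (t + s) y\<bar> < \<delta>"
    and r: "\<bar>a (t + s) / a t - exp (\<rho> * s)\<bar> < \<delta>" "\<bar>a (t + s) / a t\<bar> \<le> B"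
  shows "\<bar>E t s\<bar> \<le> \<delta> * (1 + B + 1 / \<bar>\<rho>\<bar>)"
proof -
  let ?r = "a (t + s) / a t"
  have "\<bar>?r * E (t + s) y\<bar> \<le> B * \<delta>"
    unfolding abs_mult using y(3) r(2) order_trans[OF abs_ge_zero r(2)] by (intro mult_mono) auto
  moreover have "\<bar>(?r - exp (\<rho> * s)) * \<psi> y\<bar> \<le> \<delta> * (1 / \<bar>\<rho>\<bar>)"
    unfolding abs_mult using r(1) by (intro mult_mono \<psi>_bound y(1)) auto
  moreover have "E t s = E t (s + y) - ?r * E (t + s) y - (?r - exp (\<rho> * s)) * \<psi> y"
    unfolding E_def dev_add \<psi>_add using nz by (simp add: field_simps)
  ultimately have "\<bar>E t s\<bar> \<le> \<delta> + B * \<delta> + \<delta> * (1 / \<bar>\<rho>\<bar>)"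
    using y(2) by linarith
  then show ?thesis by (simp add: algebra_simps)
qed

context
  fixes t s :: "nat \<Rightarrow> real" and b :: real
  assumes t_top: "filterlim t at_top sequentially" and s_bounded: "\<And>n. \<bar>s n\<bar> \<le> b"
begin

lemma ln_a_tendsto_uniform: "(\<lambda>n. ln \<bar>a (t n + s n)\<bar> - ln \<bar>a (t n)\<bar> - \<rho> * s n) \<longlonglongrightarrow> 0"
proof (rule LIMSEQ_I)
  fix e :: real assume e: "0 < e"
  let ?p = "\<lambda>t y. ln \<bar>a (t + y)\<bar> - ln \<bar>a t\<bar> - \<rho> * y"
  have "\<forall>\<^sub>F n in sequentially. \<exists>y\<in>{0..1}. \<bar>?p (t n) (s n + y)\<bar> < e / 2 \<and> \<bar>?p (t n + s n) y\<bar> < e / 2"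
  proof (rule eventually_exists_shift_both_small[OF _ _ _ _ s_bounded])
    show "(\<lambda>n. ?p (t n) y) \<longlonglongrightarrow> 0" for y
      by (rule filterlim_compose[OF ln_a_tendsto t_top])
    show "(\<lambda>n. ?p (t n + s n) y) \<longlonglongrightarrow> 0" for y
      by (rule filterlim_compose[OF ln_a_tendsto filterlim_at_top_add_bounded[OF t_top s_bounded]])
    show "0 < e / 2" using e by simp
  qed measurable
  then have "\<forall>\<^sub>F n in sequentially. norm (?p (t n) (s n) - 0) < e"
  proof eventually_elim
    case (elim n)
    then obtain y where y: "\<bar>?p (t n) (s n + y)\<bar> < e / 2" "\<bar>?p (t n + s n) y\<bar> < e / 2" by blast
    have cocycle: "?p (t n) (s n) = ?p (t n) (s n + y) - ?p (t n + s n) y"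
      by (simp add: distrib_left add.assoc)
    have "\<bar>?p (t n) (s n)\<bar> \<le> \<bar>?p (t n) (s n + y)\<bar> + \<bar>?p (t n + s n) y\<bar>"
      unfolding cocycle by (rule abs_triangle_ineq4)
    with y show ?case by simp
  qed
  then show "\<exists>no. \<forall>n\<ge>no. norm (?p (t n) (s n) - 0) < e"
    by (simp add: eventually_sequentially)
qed

lemma a_ratio_pos: "\<forall>\<^sub>F n in sequentially. 0 < a (t n + s n) / a (t n)"
proof -
  have shifted_top: "filterlim (\<lambda>n. t n + s n) at_top sequentially"
    by (rule filterlim_at_top_add_bounded[OF t_top s_bounded])
  from a_sign show ?thesis
  proof
    assume pos: "\<forall>\<^sub>F t in at_top. a t > 0"
    show ?thesis
      using eventually_compose_filterlim[OF pos t_top]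
        eventually_compose_filterlim[OF pos shifted_top]
      by eventually_elim simp
  next
    assume neg: "\<forall>\<^sub>F t in at_top. a t < 0"
    show ?thesis
      using eventually_compose_filterlim[OF neg t_top]
        eventually_compose_filterlim[OF neg shifted_top]
      by eventually_elim (simp add: divide_neg_neg)
  qed
qed

lemma exp_\<rho>_bounded: "exp (\<rho> * s n) \<le> exp (\<bar>\<rho>\<bar> * b)"
proof -
  have "\<rho> * s n \<le> \<bar>\<rho>\<bar> * \<bar>s n\<bar>" by (metis abs_ge_self abs_mult)
  also have "\<dots> \<le> \<bar>\<rho>\<bar> * b" by (intro mult_left_mono s_bounded) simp
  finally show ?thesis by simp
qed

lemma a_ratio_tendsto_uniform: "(\<lambda>n. a (t n + s n) / a (t n) - exp (\<rho> * s n)) \<longlonglongrightarrow> 0"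
proof -
  let ?p = "\<lambda>n. ln \<bar>a (t n + s n)\<bar> - ln \<bar>a (t n)\<bar> - \<rho> * s n"
  have "(\<lambda>n. exp (?p n) - 1) \<longlonglongrightarrow> exp 0 - 1"
    by (intro tendsto_intros ln_a_tendsto_uniform)
  then have "(\<lambda>n. exp (?p n) - 1) \<longlonglongrightarrow> 0" by simp
  then have lim: "(\<lambda>n. (exp (?p n) - 1) * exp (\<rho> * s n)) \<longlonglongrightarrow> 0"
    by (rule lim_null_mult_right_bounded[where B = "exp (\<bar>\<rho>\<bar> * b)"])
       (simp add: exp_\<rho>_bounded[unfolded exp_le_cancel_iff])
  have "\<forall>\<^sub>F n in sequentially. (exp (?p n) - 1) * exp (\<rho> * s n) =
      a (t n + s n) / a (t n) - exp (\<rho> * s n)"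
    using a_ratio_pos
  proof eventually_elim
    case (elim n)
    then have "a (t n + s n) \<noteq> 0" "a (t n) \<noteq> 0" by auto
    then have "exp (?p n) * exp (\<rho> * s n) = \<bar>a (t n + s n) / a (t n)\<bar>"
      by (simp add: exp_diff abs_divide)
    also have "\<dots> = a (t n + s n) / a (t n)" by (rule abs_of_pos[OF elim])
    finally show ?case by (simp only: left_diff_distrib mult_1_left)
  qed
  then show ?thesis
    by (rule Lim_transform_eventually[OF lim])
qed

lemma dev_ratio_tendsto_uniform: "(\<lambda>n. dev (t n) (s n) / a (t n) - \<psi> (s n)) \<longlonglongrightarrow> 0"
proof (rule LIMSEQ_I)
  fix e :: real assume e: "0 < e"
  let ?E = "\<lambda>t y. dev t y / a t - \<psi> y" and ?r = "\<lambda>n. a (t n + s n) / a (t n)"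
  define B where "B = exp (\<bar>\<rho>\<bar> * b) + 1"
  define D where "D = 1 + B + 1 / \<bar>\<rho>\<bar>"
  define \<delta> where "\<delta> = min 1 (e / (2 * D))"
  have "0 < B" unfolding B_def by (simp add: add_pos_pos)
  then have D: "0 < D" unfolding D_def by (intro add_pos_nonneg) auto
  have \<delta>: "0 < \<delta>" "\<delta> \<le> 1" using e D by (auto simp: \<delta>_def)
  have "\<delta> \<le> e / (2 * D)" by (simp add: \<delta>_def)
  then have "\<delta> * D \<le> e / 2" using D by (simp add: field_simps)
  then have \<delta>_e: "\<delta> * D < e" using e by linarith
  have "\<forall>\<^sub>F n in sequentially. \<exists>y\<in>{0..1}. \<bar>?E (t n) (s n + y)\<bar> < \<delta> \<and> \<bar>?E (t n + s n) y\<bar> < \<delta>"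
  proof (rule eventually_exists_shift_both_small[OF _ _ _ _ s_bounded \<delta>(1)])
    show "(\<lambda>n. ?E (t n) y) \<longlonglongrightarrow> 0" for y
      by (rule LIM_zero[OF filterlim_compose[OF dev_tendsto t_top]])
    show "(\<lambda>n. ?E (t n + s n) y) \<longlonglongrightarrow> 0" for y
      by (rule LIM_zero[OF filterlim_compose[OF dev_tendsto
              filterlim_at_top_add_bounded[OF t_top s_bounded]]])
  qed measurable
  moreover have "\<forall>\<^sub>F n in sequentially. \<bar>?r n - exp (\<rho> * s n)\<bar> < \<delta>"
    using tendsto_rabs_zero[OF a_ratio_tendsto_uniform] \<delta>(1) by (rule order_tendstoD)
  ultimately have "\<forall>\<^sub>F n in sequentially. norm (?E (t n) (s n) - 0) < e"
    using a_ratio_pos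
  proof eventually_elim
    case (elim n)
    then obtain y where y: "0 \<le> y" "\<bar>?E (t n) (s n + y)\<bar> < \<delta>" "\<bar>?E (t n + s n) y\<bar> < \<delta>" by auto
    have nz: "a (t n) \<noteq> 0" "a (t n + s n) \<noteq> 0" using elim(3) by auto
    have "\<bar>?r n\<bar> \<le> B"
      using elim(2,3) \<delta>(2) exp_\<rho>_bounded[of n] unfolding B_def by linarith
    then have "\<bar>?E (t n) (s n)\<bar> \<le> \<delta> * D"
      unfolding D_def by (rule dev_ratio_bound[OF nz y elim(2)])
    with \<delta>_e show ?case by simp
  qed
  then show "\<exists>no. \<forall>n\<ge>no. norm (?E (t n) (s n) - 0) < e"
    by (simp add: eventually_sequentially)
qed

end

lemma a_ratio_tendsto_of_near:
  fixes t t' :: "nat \<Rightarrow> real"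
  assumes t_top: "filterlim t at_top sequentially" and near: "(\<lambda>n. t' n - t n) \<longlonglongrightarrow> 0"
  shows "(\<lambda>n. a (t' n) / a (t n)) \<longlonglongrightarrow> 1"
proof -
  define s where "s n = t' n - t n" for n
  obtain b where "\<And>n. \<bar>s n\<bar> \<le> b"
    using convergent_imp_Bseq[OF convergentI[OF near]] by (auto simp: Bseq_def s_def)
  then have "(\<lambda>n. (a (t n + s n) / a (t n) - exp (\<rho> * s n)) + exp (\<rho> * s n)) \<longlonglongrightarrow> 0 + exp (\<rho> * 0)"
    using near unfolding s_def[symmetric]
    by (intro tendsto_intros a_ratio_tendsto_uniform[OF t_top])
  then show ?thesis by (simp add: s_def)
qed

lemma dev_bounded_unit:
  "\<exists>C t0. \<forall>t\<ge>t0. \<forall>s\<in>{0..1}. \<bar>dev t s\<bar> \<le> C * \<bar>a t\<bar>"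
proof (rule ccontr)
  assume "\<not> ?thesis"
  then have "\<forall>n. \<exists>t s. real n \<le> t \<and> s \<in> {0..1} \<and> real n * \<bar>a t\<bar> < \<bar>dev t s\<bar>"
    by (metis not_less)
  then obtain t s where t: "\<And>n. real n \<le> t n" and s: "\<And>n. s n \<in> {0..1}"
    and large: "\<And>n. real n * \<bar>a (t n)\<bar> < \<bar>dev (t n) (s n)\<bar>"
    by metis
  have t_top: "filterlim t at_top sequentially"
    by (rule filterlim_at_top_mono[OF filterlim_real_sequentially]) (use t in auto)
  have "(\<lambda>n. dev (t n) (s n) / a (t n) - \<psi> (s n)) \<longlonglongrightarrow> 0"
    by (rule dev_ratio_tendsto_uniform[OF t_top, of s 1]) (use s in auto)
  then have "\<forall>\<^sub>F n in sequentially. \<bar>dev (t n) (s n) / a (t n) - \<psi> (s n)\<bar> < 1"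
    using order_tendstoD(2)[OF tendsto_rabs_zero] by fastforce
  moreover have "\<forall>\<^sub>F n in sequentially. 1 + 1 / \<bar>\<rho>\<bar> \<le> real n"
    using filterlim_real_sequentially by (simp only: filterlim_at_top)
  ultimately have "\<forall>\<^sub>F n::nat in sequentially. False"
    using eventually_compose_filterlim[OF a_nonzero t_top]
  proof eventually_elim
    case (elim n)
    have "\<bar>dev (t n) (s n) / a (t n)\<bar> \<le> real n"
      using elim(1,2) \<psi>_bound[of "s n"] s[of n] by (simp del: abs_divide)
    then show False
      using large[of n] elim(3) by (simp add: abs_divide pos_divide_le_eq)
  qed
  then show False by simp
qed

lemma dev_bounded_iterate:
  assumes unit: "\<And>t s. t0 \<le> t \<Longrightarrow> s \<in> {0..1} \<Longrightarrow> \<bar>dev t s\<bar> \<le> (1 - \<theta>) * K * \<bar>a t\<bar>"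
    and contract: "\<And>t. t0 \<le> t \<Longrightarrow> \<bar>a (t + 1)\<bar> \<le> \<theta> * \<bar>a t\<bar>"
    and \<theta>: "0 \<le> \<theta>" and K: "0 \<le> K"
    and t: "t0 \<le> t" and s: "0 \<le> s" "s \<le> real m"
  shows "\<bar>dev t s\<bar> \<le> K * \<bar>a t\<bar>"
  using t s
proof (induction m arbitrary: t s)
  case 0
  then show ?case using K by (simp add: dev_def)
next
  case (Suc m)
  show ?case
  proof (cases "s \<le> 1")
    case True
    then have "\<bar>dev t s\<bar> \<le> (1 - \<theta>) * K * \<bar>a t\<bar>" using Suc.prems by (intro unit) auto
    also have "\<dots> \<le> K * \<bar>a t\<bar>"
      using \<theta> K by (intro mult_right_mono) (auto simp: algebra_simps)
    finally show ?thesis .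
  next
    case False
    have "\<bar>dev (t + 1) (s - 1)\<bar> \<le> K * \<bar>a (t + 1)\<bar>"
      using Suc.prems False by (intro Suc.IH) auto
    also have "\<dots> \<le> K * (\<theta> * \<bar>a t\<bar>)"
      using K Suc.prems by (intro mult_left_mono contract)
    finally have "\<bar>dev t 1\<bar> + \<bar>dev (t + 1) (s - 1)\<bar> \<le> (1 - \<theta>) * K * \<bar>a t\<bar> + K * (\<theta> * \<bar>a t\<bar>)"
      using Suc.prems by (intro add_mono unit) auto
    also have "\<dots> = K * \<bar>a t\<bar>" by (simp add: algebra_simps)
    finally show ?thesis
      using dev_add[of t 1 "s - 1"] abs_triangle_ineq[of "dev t 1" "dev (t + 1) (s - 1)"] by simp
  qed
qed

lemma dev_bounded:
  "\<exists>C t0. 0 \<le> C \<and> (\<forall>t\<ge>t0. \<forall>s\<ge>0. \<bar>dev t s\<bar> \<le> C * \<bar>a t\<bar>)"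
proof -
  define \<theta> where "\<theta> = (1 + exp \<rho>) / 2"
  have \<theta>: "exp \<rho> < \<theta>" "0 \<le> \<theta>" "\<theta> < 1"
    using \<rho>_neg by (auto simp: \<theta>_def add_nonneg_nonneg)
  obtain C t0 where C: "\<And>t s. t \<ge> t0 \<Longrightarrow> s \<in> {0..1} \<Longrightarrow> \<bar>dev t s\<bar> \<le> C * \<bar>a t\<bar>"
    using dev_bounded_unit by blast
  have "((\<lambda>t. \<bar>a (t + 1) / a t\<bar>) \<longlongrightarrow> \<bar>exp (\<rho> * 1)\<bar>) at_top"
    by (intro tendsto_intros a_ratio_tendsto)
  then have "\<forall>\<^sub>F t in at_top. \<bar>a (t + 1) / a t\<bar> < \<theta>"
    by (rule order_tendstoD) (use \<theta> in simp)
  then have "\<forall>\<^sub>F t in at_top. \<bar>a (t + 1)\<bar> \<le> \<theta> * \<bar>a t\<bar>"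
    using a_nonzero by eventually_elim (simp add: abs_divide field_simps)
  then obtain t1 where t1: "\<And>t. t \<ge> t1 \<Longrightarrow> \<bar>a (t + 1)\<bar> \<le> \<theta> * \<bar>a t\<bar>"
    by (auto simp: eventually_at_top_linorder)
  define K where "K = max C 0 / (1 - \<theta>)"
  have K: "0 \<le> K" "(1 - \<theta>) * K = max C 0" using \<theta> by (auto simp: K_def)
  have unit: "\<bar>dev t s\<bar> \<le> (1 - \<theta>) * K * \<bar>a t\<bar>" if "max t0 t1 \<le> t" "s \<in> {0..1}" for t s
  proof -
    have "\<bar>dev t s\<bar> \<le> C * \<bar>a t\<bar>" using that by (intro C) auto
    also have "\<dots> \<le> max C 0 * \<bar>a t\<bar>" by (intro mult_right_mono) auto
    finally show ?thesis unfolding K(2) .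
  qed
  have "\<bar>dev t s\<bar> \<le> K * \<bar>a t\<bar>" if "max t0 t1 \<le> t" "0 \<le> s" for t s
  proof -
    obtain m where m: "s \<le> real m" using real_arch_simple by blast
    show ?thesis
      by (rule dev_bounded_iterate[OF unit _ \<theta>(2) K(1) that m]) (use t1 in auto)
  qed
  with K(1) show ?thesis by blast
qed

end

section \<open>The continuity theorem for characteristic functions on Euclidean space\<close>

locale euclidean_distribution = prob_space M for M :: "'a::euclidean_space measure" +
  assumes events_eq_borel[simp, measurable_cong]: "sets M = sets borel"
begin

lemma measurable_eq_borel: "measurable M N = measurable borel N"
  by (rule measurable_cong_sets) simp_all

lemma integrable_bounded_continuous:
  fixes f :: "'a \<Rightarrow> 'b::{banach, second_countable_topology}"
  assumes "continuous_on UNIV f" "\<And>z. norm (f z) \<le> B"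
  shows "integrable M f"
  using assms
  by (intro integrable_const_bound[of _ B])
     (auto simp: measurable_eq_borel borel_measurable_continuous_onI)

end

definition char_vec :: "'a::euclidean_space measure \<Rightarrow> 'a \<Rightarrow> complex" where
  "char_vec M v = (CLINT z|M. iexp (v \<bullet> z))"

inductive exp_poly :: "('a::euclidean_space \<Rightarrow> complex) \<Rightarrow> bool" where
  exp_poly_iexp: "exp_poly (\<lambda>z. iexp (v \<bullet> z))"
| exp_poly_add: "exp_poly f \<Longrightarrow> exp_poly g \<Longrightarrow> exp_poly (\<lambda>z. f z + g z)"
| exp_poly_scale: "exp_poly f \<Longrightarrow> exp_poly (\<lambda>z. c * f z)"

lemma exp_poly_const: "exp_poly (\<lambda>z. c)"
  using exp_poly_scale[OF exp_poly_iexp[of 0], of c] by simp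

lemma exp_poly_mult_iexp:
  assumes "exp_poly f"
  shows "exp_poly (\<lambda>z. f z * iexp (v \<bullet> z))"
  using assms
proof induction
  case (exp_poly_iexp w)
  have "(\<lambda>z. iexp (w \<bullet> z) * iexp (v \<bullet> z)) = (\<lambda>z. iexp ((w + v) \<bullet> z))"
    by (simp add: fun_eq_iff inner_add_left distrib_left exp_add)
  then show ?case by (simp only: exp_poly.intros)
next
  case (exp_poly_add f g)
  then show ?case by (simp only: distrib_right exp_poly.intros)
next
  case (exp_poly_scale f c)
  then show ?case by (simp only: mult.assoc exp_poly.intros)
qed

lemma exp_poly_mult:
  assumes "exp_poly g" "exp_poly f"
  shows "exp_poly (\<lambda>z. f z * g z)"
  using assms(1)
proof induction
  case (exp_poly_iexp v)
  show ?case by (rule exp_poly_mult_iexp[OF assms(2)])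
next
  case (exp_poly_add g h)
  then show ?case by (simp only: distrib_left exp_poly.intros)
next
  case (exp_poly_scale g c)
  then show ?case by (simp only: mult.left_commute exp_poly.intros)
qed

lemma exp_poly_sum: "(\<And>i. i \<in> I \<Longrightarrow> exp_poly (f i)) \<Longrightarrow> exp_poly (\<lambda>z. \<Sum>i\<in>I. f i z)"
  by (induction I rule: infinite_finite_induct) (simp_all add: exp_poly_const exp_poly_add)

lemma exp_poly_sin: "exp_poly (\<lambda>z. complex_of_real (sin (v \<bullet> z)))"
proof -
  have "(\<lambda>z. complex_of_real (sin (v \<bullet> z))) =
      (\<lambda>z. 1 / (2 * \<i>) * iexp (v \<bullet> z) + (- 1 / (2 * \<i>)) * iexp ((- v) \<bullet> z))"
    by (simp add: fun_eq_iff sin_exp_eq right_diff_distrib diff_divide_distrib flip: sin_of_real)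
  then show ?thesis by (simp only: exp_poly.intros)
qed

lemma exp_poly_continuous: "exp_poly f \<Longrightarrow> continuous_on UNIV f"
  by (induction rule: exp_poly.induct) (auto intro!: continuous_intros)

lemma exp_poly_bounded: "exp_poly f \<Longrightarrow> \<exists>B. \<forall>z. norm (f z) \<le> B"
proof (induction rule: exp_poly.induct)
  case (exp_poly_add f g)
  then obtain B C where "\<And>z. norm (f z) \<le> B" "\<And>z. norm (g z) \<le> C" by blast
  then have "norm (f z + g z) \<le> B + C" for z
    by (meson norm_triangle_mono)
  then show ?case by blast
next
  case (exp_poly_scale f c)
  then obtain B where "\<And>z. norm (f z) \<le> B" by blast
  then have "norm (c * f z) \<le> norm c * B" for z
    unfolding norm_mult by (intro mult_left_mono) simp_all
  then show ?case by blast
qed (auto intro!: exI[of _ 1])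

definition sin_coords :: "real \<Rightarrow> 'a::euclidean_space \<Rightarrow> 'a" where
  "sin_coords c z = (\<Sum>b\<in>Basis. sin (c * (z \<bullet> b)) *\<^sub>R b)"

lemma sin_coords_in_cbox: "sin_coords c z \<in> cbox (- One) One"
  by (simp add: sin_coords_def mem_box)

lemma exp_poly_compose_sin_coords:
  fixes q :: "'a::euclidean_space \<Rightarrow> real"
  assumes "real_polynomial_function q"
  shows "exp_poly (\<lambda>z. complex_of_real (q (sin_coords c z)))"
  using assms
proof induction
  case (linear f)
  interpret bounded_linear f by fact
  have "complex_of_real (f (sin_coords c z)) =
      (\<Sum>b\<in>Basis. complex_of_real (f b) * complex_of_real (sin ((c *\<^sub>R b) \<bullet> z)))" for z
    by (simp add: sin_coords_def sum scaleR inner_commute mult.commute)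
  then show ?case
    by (simp only: exp_poly_sum exp_poly_scale exp_poly_sin)
qed (simp_all add: exp_poly_const exp_poly.intros exp_poly_mult)

definition cutoff :: "real \<Rightarrow> 'a::euclidean_space \<Rightarrow> real" where
  "cutoff T z = (\<Sum>b\<in>Basis. min 1 (max 0 (\<bar>b \<bullet> z\<bar> - T)))"

lemma cutoff_nonneg: "0 \<le> cutoff T z"
  unfolding cutoff_def by (intro sum_nonneg) simp

lemma cutoff_le_DIM:
  fixes z :: "'a::euclidean_space"
  shows "cutoff T z \<le> real DIM('a)"
  using sum_mono[of Basis "\<lambda>b. min 1 (max 0 (\<bar>b \<bullet> z\<bar> - T))" "\<lambda>_. 1"] by (simp add: cutoff_def)

lemma one_le_cutoff:
  assumes "b \<in> Basis" "T + 1 < \<bar>b \<bullet> z\<bar>"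
  shows "1 \<le> cutoff T z"
proof -
  have "min 1 (max 0 (\<bar>b \<bullet> z\<bar> - T)) = 1" using assms(2) by simp
  then show ?thesis
    unfolding cutoff_def
    using member_le_sum[of b Basis "\<lambda>b. min 1 (max 0 (\<bar>b \<bullet> z\<bar> - T))"] assms(1) by simp
qed

lemma continuous_on_cutoff: "continuous_on S (cutoff T)"
  unfolding cutoff_def by (intro continuous_intros)

lemma cutoff_tendsto: "(\<lambda>n. cutoff (real n) z) \<longlonglongrightarrow> 0"
  unfolding cutoff_def
proof (rule tendsto_null_sum)
  fix b :: 'a
  have "\<forall>\<^sub>F n in sequentially. \<bar>b \<bullet> z\<bar> \<le> real n"
    using filterlim_real_sequentially by (simp add: filterlim_at_top)
  then show "(\<lambda>n. min 1 (max 0 (\<bar>b \<bullet> z\<bar> - real n))) \<longlonglongrightarrow> 0"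
    by (intro tendsto_eventually) (auto elim!: eventually_mono)
qed

lemma arcsin_sin_rescaled:
  assumes "\<bar>x\<bar> \<le> T"
  shows "arcsin (sin (pi / (2 * T) * x)) = pi / (2 * T) * x"
proof (rule arcsin_sin)
  have "\<bar>pi / (2 * T) * x\<bar> \<le> pi / 2"
    using assms abs_ge_zero[of x] by (cases "T = 0") (auto simp: abs_mult field_simps)
  then show "- (pi / 2) \<le> pi / (2 * T) * x" "pi / (2 * T) * x \<le> pi / 2" by linarith+
qed

text \<open>Substituting \<open>sin (c x)\<close> in each coordinate turns the approximating polynomial into a
  trigonometric one, which is bounded on the whole space and not only on the cube.\<close>

lemma exp_poly_approx:
  fixes f :: "'a::euclidean_space \<Rightarrow> real"
  assumes f: "continuous_on UNIV f" "\<And>z. \<bar>f z\<bar> \<le> B" and T: "0 \<le> T" and e: "0 < e"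
  obtains p where "exp_poly (\<lambda>z. complex_of_real (p z))" "\<And>z. \<bar>f z - p z\<bar> \<le> e + 2 * B * cutoff T z"
proof -
  define c where "c = pi / (2 * (T + 1))"
  have c: "c > 0" using T by (simp add: c_def)
  define F where "F w = f (\<Sum>b\<in>Basis. (arcsin (w \<bullet> b) / c) *\<^sub>R b)" for w
  have "continuous_on (cbox (- One) One) F"
    unfolding F_def using c
    by (intro continuous_on_compose2[OF f(1)] continuous_intros) (auto simp: mem_box)
  then obtain q where q: "real_polynomial_function q"
      and qF: "\<And>w. w \<in> cbox (- One) One \<Longrightarrow> \<bar>F w - q w\<bar> < e"
    by (rule Stone_Weierstrass_real_polynomial_function[OF compact_cbox _ e]) blast
  have F_sin: "\<bar>f z - F (sin_coords c z)\<bar> \<le> 2 * B * cutoff T z" for z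
  proof (cases "\<forall>b\<in>Basis. \<bar>b \<bullet> z\<bar> \<le> T + 1")
    case True
    then have "arcsin (sin (c * (z \<bullet> b))) = c * (z \<bullet> b)" if "b \<in> Basis" for b
      unfolding c_def using that by (intro arcsin_sin_rescaled) (simp add: inner_commute)
    then have "F (sin_coords c z) = f (\<Sum>b\<in>Basis. (z \<bullet> b) *\<^sub>R b)"
      using c by (simp add: F_def sin_coords_def)
    then show ?thesis
      using f(2)[of z] cutoff_nonneg[of T z] by (simp add: euclidean_representation)
  next
    case False
    then have "1 \<le> cutoff T z" using one_le_cutoff by (metis not_le)
    then have "2 * B * 1 \<le> 2 * B * cutoff T z"
      using f(2)[of z] by (intro mult_left_mono) auto
    moreover have "\<bar>f z - F (sin_coords c z)\<bar> \<le> B + B"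
      unfolding F_def by (rule order_trans[OF abs_triangle_ineq4 add_mono[OF f(2) f(2)]])
    ultimately show ?thesis by linarith
  qed
  show thesis
  proof (rule that)
    show "exp_poly (\<lambda>z. complex_of_real (q (sin_coords c z)))"
      by (rule exp_poly_compose_sin_coords[OF q])
    show "\<bar>f z - q (sin_coords c z)\<bar> \<le> e + 2 * B * cutoff T z" for z
      using F_sin[of z] qF[OF sin_coords_in_cbox[of c z]] by linarith
  qed
qed

lemma (in euclidean_distribution) integral_exp_poly_approx:
  fixes f p :: "'a \<Rightarrow> real"
  assumes f: "continuous_on UNIV f" "\<And>z. \<bar>f z\<bar> \<le> B"
    and p: "exp_poly (\<lambda>z. complex_of_real (p z))" "\<And>z. \<bar>f z - p z\<bar> \<le> e + 2 * B * cutoff T z"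
  shows "\<bar>expectation f - expectation p\<bar> \<le> e + 2 * B * expectation (cutoff T)"
proof -
  have int_f: "integrable M f"
    by (rule integrable_bounded_continuous[OF f(1)]) (use f(2) in simp)
  have "integrable M (\<lambda>z. complex_of_real (p z))"
    using exp_poly_continuous[OF p(1)] exp_poly_bounded[OF p(1)]
      integrable_bounded_continuous by blast
  then have int_p: "integrable M p" by (simp add: complex_of_real_integrable_eq)
  have int_cut: "integrable M (cutoff T)"
    by (rule integrable_bounded_continuous[OF continuous_on_cutoff, of _ "DIM('a)"])
       (simp add: cutoff_nonneg cutoff_le_DIM)
  have "\<bar>expectation f - expectation p\<bar> = \<bar>\<integral>z. f z - p z \<partial>M\<bar>"
    using int_f int_p by simp
  also have "\<dots> \<le> (\<integral>z. \<bar>f z - p z\<bar> \<partial>M)" by (rule integral_abs_bound)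
  also have "\<dots> \<le> (\<integral>z. e + 2 * B * cutoff T z \<partial>M)"
    using int_f int_p int_cut p(2) by (intro integral_mono) auto
  also have "\<dots> = e + 2 * B * expectation (cutoff T)"
    using int_cut by (simp add: prob_space)
  finally show ?thesis .
qed

lemma (in euclidean_distribution) exists_expectation_cutoff_less:
  assumes "0 < e"
  obtains T where "0 \<le> T" "expectation (cutoff T) < e"
proof -
  have "(\<lambda>n. expectation (cutoff (real n))) \<longlonglongrightarrow> expectation (\<lambda>_. 0)"
  proof (rule integral_dominated_convergence[where w = "\<lambda>_. DIM('a)"])
    show "cutoff (real n) \<in> borel_measurable M" for n
      by (simp add: measurable_eq_borel borel_measurable_continuous_onI continuous_on_cutoff)
    show "AE z in M. (\<lambda>n. cutoff (real n) z) \<longlonglongrightarrow> 0"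
      by (simp add: cutoff_tendsto)
  qed (simp_all add: cutoff_nonneg cutoff_le_DIM)
  then have "\<forall>\<^sub>F n in sequentially. expectation (cutoff (real n)) < e"
    by (rule order_tendstoD) (use assms in simp)
  then obtain n where "expectation (cutoff (real n)) < e"
    by (auto simp: eventually_sequentially)
  then show thesis by (rule that[OF of_nat_0_le_iff])
qed

locale char_vec_convergence =
  fixes \<mu> :: "nat \<Rightarrow> 'a::euclidean_space measure" and N :: "'a measure"
  assumes distribution_\<mu>: "\<And>m. euclidean_distribution (\<mu> m)"
    and distribution_N: "euclidean_distribution N"
    and char_tendsto: "\<And>v. (\<lambda>m. char_vec (\<mu> m) v) \<longlonglongrightarrow> char_vec N v"
begin

sublocale \<mu>: euclidean_distribution "\<mu> m" for m by (rule distribution_\<mu>)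
sublocale N: euclidean_distribution N by (rule distribution_N)

lemma integral_exp_poly_tendsto:
  "exp_poly h \<Longrightarrow> (\<lambda>m. integral\<^sup>L (\<mu> m) h) \<longlonglongrightarrow> integral\<^sup>L N h"
proof (induction rule: exp_poly.induct)
  case (exp_poly_iexp v)
  then show ?case using char_tendsto[of v] by (simp add: char_vec_def)
next
  case (exp_poly_add f g)
  have int: "integrable K f" "integrable K g" if "euclidean_distribution K" for K
    using exp_poly_continuous exp_poly_bounded exp_poly_add.hyps
      euclidean_distribution.integrable_bounded_continuous[OF that] by blast+
  show ?case
    using tendsto_add[OF exp_poly_add.IH]
    by (simp add: int[OF distribution_\<mu>] int[OF distribution_N])
next
  case (exp_poly_scale f c)
  then show ?case by (simp add: tendsto_mult_left)
qed

lemma projection_tendsto: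
  fixes h :: "real \<Rightarrow> real"
  assumes h: "continuous_on UNIV h" "\<And>x. \<bar>h x\<bar> \<le> B"
  shows "(\<lambda>m. \<integral>z. h (v \<bullet> z) \<partial>\<mu> m) \<longlonglongrightarrow> (\<integral>z. h (v \<bullet> z) \<partial>N)"
proof -
  have [measurable]: "h \<in> borel_measurable borel"
    by (rule borel_measurable_continuous_onI[OF h(1)])
  have char_eq: "char (distr K borel ((\<bullet>) v)) t = char_vec K (t *\<^sub>R v)"
    if "euclidean_distribution K" for K t
  proof -
    interpret K: euclidean_distribution K by fact
    show ?thesis unfolding char_def char_vec_def by (simp add: integral_distr)
  qed
  have rd: "real_distribution (distr (\<mu> m) borel ((\<bullet>) v))"
      "real_distribution (distr N borel ((\<bullet>) v))" for m
    by (rule \<mu>.real_distribution_distr, simp) (rule N.real_distribution_distr, simp)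
  have "weak_conv_m (\<lambda>m. distr (\<mu> m) borel ((\<bullet>) v)) (distr N borel ((\<bullet>) v))"
    using rd char_tendsto by (intro levy_continuity)
       (simp_all add: char_eq distribution_\<mu> distribution_N)
  then have "(\<lambda>m. integral\<^sup>L (distr (\<mu> m) borel ((\<bullet>) v)) h) \<longlonglongrightarrow> integral\<^sup>L (distr N borel ((\<bullet>) v)) h"
    using h rd by (intro weak_conv_imp_integral_bdd_continuous_conv[where B = B])
      (auto simp: continuous_on_eq_continuous_at)
  then show ?thesis by (simp add: integral_distr)
qed

lemma expectation_cutoff_tendsto: "(\<lambda>m. integral\<^sup>L (\<mu> m) (cutoff T)) \<longlonglongrightarrow> integral\<^sup>L N (cutoff T)"
proof -
  let ?h = "\<lambda>x::real. min 1 (max 0 (\<bar>x\<bar> - T))"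
  have int: "integrable K (\<lambda>z. ?h (b \<bullet> z))"
    if "euclidean_distribution K" for K :: "'a measure" and b
    by (rule euclidean_distribution.integrable_bounded_continuous[OF that, of _ 1])
       (auto intro!: continuous_intros)
  have "(\<lambda>m. \<Sum>b\<in>Basis. \<integral>z. ?h (b \<bullet> z) \<partial>\<mu> m) \<longlonglongrightarrow> (\<Sum>b\<in>Basis. \<integral>z. ?h (b \<bullet> z) \<partial>N)"
    by (intro tendsto_sum projection_tendsto[where B = 1] continuous_intros) auto
  then show ?thesis
    by (simp add: cutoff_def[abs_def] int[OF distribution_\<mu>] int[OF distribution_N])
qed

theorem bounded_continuous_tendsto:
  fixes f :: "'a \<Rightarrow> real"
  assumes f: "continuous_on UNIV f" "\<And>z. \<bar>f z\<bar> \<le> B"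
  shows "(\<lambda>m. integral\<^sup>L (\<mu> m) f) \<longlonglongrightarrow> integral\<^sup>L N f"
proof (rule LIMSEQ_I)
  fix e :: real assume e: "0 < e"
  have B: "0 \<le> B" using f(2)[of 0] by linarith
  define q where "q = e / 6 / (2 * B + 1)"
  have q: "0 < q" "2 * B * q \<le> e / 6" using e B by (simp_all add: q_def field_simps)
  obtain T where T: "0 \<le> T" "integral\<^sup>L N (cutoff T) < q"
    using N.exists_expectation_cutoff_less[OF q(1)] by blast
  have "0 < e / 6" using e by simp
  from exp_poly_approx[OF f T(1) this] obtain p where
    p: "exp_poly (\<lambda>z. complex_of_real (p z))" "\<And>z. \<bar>f z - p z\<bar> \<le> e / 6 + 2 * B * cutoff T z"
    by blast
  have approx: "\<bar>integral\<^sup>L K f - integral\<^sup>L K p\<bar> \<le> e / 3"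
    if K: "euclidean_distribution K" and small: "integral\<^sup>L K (cutoff T) < q" for K
  proof -
    have "2 * B * integral\<^sup>L K (cutoff T) \<le> 2 * B * q"
      using small B by (intro mult_left_mono) auto
    then show ?thesis
      using euclidean_distribution.integral_exp_poly_approx[OF K f p] q(2) by linarith
  qed
  have "(\<lambda>m. complex_of_real (integral\<^sup>L (\<mu> m) p)) \<longlonglongrightarrow> complex_of_real (integral\<^sup>L N p)"
    using integral_exp_poly_tendsto[OF p(1)] by simp
  then have "(\<lambda>m. integral\<^sup>L (\<mu> m) p) \<longlonglongrightarrow> integral\<^sup>L N p" by (simp only: tendsto_of_real_iff)
  from tendstoD[OF this, of "e / 3"]
  have "\<forall>\<^sub>F m in sequentially. \<bar>integral\<^sup>L (\<mu> m) p - integral\<^sup>L N p\<bar> < e / 3"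
    using e by (simp add: dist_real_def)
  moreover have "\<forall>\<^sub>F m in sequentially. integral\<^sup>L (\<mu> m) (cutoff T) < q"
    using expectation_cutoff_tendsto T(2) by (rule order_tendstoD)
  ultimately have "\<forall>\<^sub>F m in sequentially. norm (integral\<^sup>L (\<mu> m) f - integral\<^sup>L N f) < e"
  proof eventually_elim
    case (elim m)
    show ?case
      using elim(1) approx[OF distribution_\<mu> elim(2)] approx[OF distribution_N T(2)]
      unfolding real_norm_def by linarith
  qed
  then show "\<exists>no. \<forall>m\<ge>no. norm (integral\<^sup>L (\<mu> m) f - integral\<^sup>L N f) < e"
    by (simp add: eventually_sequentially)
qed

end

section \<open>Bivariate Gaussian laws\<close>

lemma exp_diff_of_real: "exp (z - complex_of_real y) = exp z * of_real (exp (- y))"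
  by (simp add: exp_diff exp_minus divide_inverse flip: exp_of_real)

lemma char_normal_density:
  assumes "0 < \<sigma>"
  shows "char (density lborel (normal_density m \<sigma>)) t =
    exp (\<i> * of_real (t * m) - of_real (\<sigma>\<^sup>2 * t\<^sup>2 / 2))"
proof -
  interpret S: prob_space std_normal_distribution
    using prob_space_normal_density[of 1 0] by simp
  have "distributed std_normal_distribution lborel (\<lambda>x. x) std_normal_density"
    by (simp add: distributed_def distr_id2)
  then have "distributed std_normal_distribution lborel (\<lambda>x. m + \<sigma> * x)
      (normal_density (m + \<sigma> * 0) (\<bar>\<sigma>\<bar> * 1))"
    by (rule S.normal_density_affine) (use assms in auto)
  then have affine: "density lborel (normal_density m \<sigma>) =
      distr std_normal_distribution lborel (\<lambda>x. m + \<sigma> * x)"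
    using assms distributed_distr_eq_density by fastforce
  have "char (density lborel (normal_density m \<sigma>)) t =
      (\<integral>x. iexp (t * (m + \<sigma> * x)) \<partial>std_normal_distribution)"
    unfolding char_def affine by (subst integral_distr) auto
  also have "\<dots> = (\<integral>x. iexp (t * m) * iexp ((t * \<sigma>) * x) \<partial>std_normal_distribution)"
    by (simp add: algebra_simps flip: exp_add)
  also have "\<dots> = iexp (t * m) * char std_normal_distribution (t * \<sigma>)"
    unfolding char_def by (rule integral_mult_right_zero)
  also have "\<dots> = exp (\<i> * of_real (t * m) - of_real (\<sigma>\<^sup>2 * t\<^sup>2 / 2))"
    unfolding char_std_normal_distribution exp_diff_of_real
    by (simp add: power_mult_distrib mult.commute)
  finally show ?thesis .
qed

lemma char_return: "char (return borel m) t = iexp (t * m)"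
  unfolding char_def by (subst integral_return) auto

definition quad_form :: "real \<Rightarrow> real \<Rightarrow> real \<Rightarrow> real \<times> real \<Rightarrow> real" where
  "quad_form v1 v2 c z = (fst z)\<^sup>2 * v1 + 2 * fst z * snd z * c + (snd z)\<^sup>2 * v2"

definition gauss_char :: "real \<times> real \<Rightarrow> real \<Rightarrow> real \<Rightarrow> real \<Rightarrow> real \<times> real \<Rightarrow> complex" where
  "gauss_char m v1 v2 c z = exp (\<i> * of_real (z \<bullet> m) - of_real (quad_form v1 v2 c z / 2))"

lemma quad_form_scaleR: "quad_form v1 v2 c (t *\<^sub>R z) = quad_form v1 v2 c z * t\<^sup>2"
  by (simp add: quad_form_def power2_eq_square algebra_simps)

lemma quad_form_nonneg_imp_discriminant:
  assumes psd: "\<And>z. 0 \<le> quad_form v1 v2 c z"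
  shows "0 \<le> v1" "0 \<le> v2" "c\<^sup>2 \<le> v1 * v2"
proof -
  show v1: "0 \<le> v1" using psd[of "(1, 0)"] by (simp add: quad_form_def)
  show "0 \<le> v2" using psd[of "(0, 1)"] by (simp add: quad_form_def)
  show "c\<^sup>2 \<le> v1 * v2"
  proof (cases "v1 = 0")
    case True
    have "c = 0"
    proof (rule ccontr)
      assume "c \<noteq> 0"
      then show False
        using psd[of "(- (v2 + 1) / (2 * c), 1)"] True by (simp add: quad_form_def field_simps)
    qed
    then show ?thesis using True by simp
  next
    case False
    have "quad_form v1 v2 c (- c, v1) = v1 * (v1 * v2 - c\<^sup>2)"
      by (simp add: quad_form_def power2_eq_square algebra_simps)
    then have "0 \<le> v1 * (v1 * v2 - c\<^sup>2)" using psd[of "(- c, v1)"] by simp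
    then show ?thesis using v1 False by (simp add: zero_le_mult_iff)
  qed
qed

lemma quad_form_eq_sum_squares:
  assumes psd: "\<And>z. 0 \<le> quad_form v1 v2 c z"
  obtains p q :: "real \<times> real" where "\<And>z. quad_form v1 v2 c z = (z \<bullet> p)\<^sup>2 + (z \<bullet> q)\<^sup>2"
proof
  note disc = quad_form_nonneg_imp_discriminant[OF psd]
  define \<alpha> where "\<alpha> = sqrt v1"
  define \<beta> where "\<beta> = c / sqrt v1"
  define \<delta> where "\<delta> = sqrt (v2 - \<beta>\<^sup>2)"
  have "\<beta>\<^sup>2 \<le> v2"
    using disc by (cases "v1 = 0") (auto simp: \<beta>_def power_divide field_simps)
  then have coeffs: "\<alpha>\<^sup>2 = v1" "\<alpha> * \<beta> = c" "\<beta>\<^sup>2 + \<delta>\<^sup>2 = v2"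
    using disc by (cases "v1 = 0"; auto simp: \<alpha>_def \<beta>_def \<delta>_def)+
  show "quad_form v1 v2 c z = (z \<bullet> (\<alpha>, \<beta>))\<^sup>2 + (z \<bullet> (0, \<delta>))\<^sup>2" for z
    unfolding quad_form_def coeffs[symmetric]
    by (simp add: inner_prod_def power2_eq_square algebra_simps)
qed

lemma exists_gauss_char:
  assumes psd: "\<And>z. 0 \<le> quad_form v1 v2 c z"
  obtains N where "euclidean_distribution N" "\<And>v. char_vec N v = gauss_char m v1 v2 c v"
proof -
  obtain p q where squares: "\<And>v. quad_form v1 v2 c v = (v \<bullet> p)\<^sup>2 + (v \<bullet> q)\<^sup>2"
    using quad_form_eq_sum_squares[OF psd] by blast
  let ?S = std_normal_distribution
  interpret S: prob_space ?S
    using prob_space_normal_density[of 1 0] by simp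
  interpret SS: pair_prob_space ?S ?S ..
  define g where "g = (\<lambda>(x, y). m + x *\<^sub>R p + y *\<^sub>R q)"
  have g[measurable]: "g \<in> borel_measurable (?S \<Otimes>\<^sub>M ?S)"
    unfolding g_def by measurable
  define N where "N = distr (?S \<Otimes>\<^sub>M ?S) borel g"
  have "char_vec N v = gauss_char m v1 v2 c v" for v
  proof -
    let ?f = "\<lambda>x. iexp ((v \<bullet> p) * x)" and ?h = "\<lambda>y. iexp ((v \<bullet> q) * y)"
    have int: "integrable (?S \<Otimes>\<^sub>M ?S) (\<lambda>(x, y). ?f x * ?h y)"
      by (rule SS.integrable_const_bound[of _ 1]) (auto simp: norm_mult split_beta)
    have "char_vec N v = (\<integral>w. iexp (v \<bullet> g w) \<partial>(?S \<Otimes>\<^sub>M ?S))"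
      unfolding N_def char_vec_def by (subst integral_distr[OF g]) simp_all
    also have "\<dots> = (\<integral>w. iexp (v \<bullet> m) * (case w of (x, y) \<Rightarrow> ?f x * ?h y) \<partial>(?S \<Otimes>\<^sub>M ?S))"
      by (rule Bochner_Integration.integral_cong)
         (auto simp: g_def inner_add_right algebra_simps simp flip: exp_add)
    also have "\<dots> = iexp (v \<bullet> m) * (\<integral>w. (case w of (x, y) \<Rightarrow> ?f x * ?h y) \<partial>(?S \<Otimes>\<^sub>M ?S))"
      by (rule integral_mult_right_zero)
    also have "(\<integral>w. (case w of (x, y) \<Rightarrow> ?f x * ?h y) \<partial>(?S \<Otimes>\<^sub>M ?S)) = (\<integral>x. (\<integral>y. ?f x * ?h y \<partial>?S) \<partial>?S)"
      by (rule SS.integral_fst[OF int, symmetric])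
    also have "\<dots> = char ?S (v \<bullet> p) * char ?S (v \<bullet> q)"
      by (simp add: char_def)
    also have "\<dots> = of_real (exp (- (quad_form v1 v2 c v / 2)))"
      unfolding char_std_normal_distribution squares of_real_mult[symmetric] exp_add[symmetric]
      by (simp add: add_divide_distrib diff_divide_distrib)
    finally show ?thesis
      by (simp only: gauss_char_def exp_diff_of_real)
  qed
  moreover have "euclidean_distribution N"
    unfolding N_def by (intro euclidean_distribution.intro SS.prob_space_distr g)
       (unfold_locales; simp)
  ultimately show thesis using that by blast
qed

lemma gaussian2_if_char_vec:
  assumes "euclidean_distribution N" and char_N: "\<And>v. char_vec N v = gauss_char m v1 v2 c v"
    and psd: "\<And>z. 0 \<le> quad_form v1 v2 c z"
  shows "gaussian2 N m v1 v2 c"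
proof -
  interpret N: euclidean_distribution N by fact
  have "distr N borel ((\<bullet>) v) =
      (if s = 0 then return borel M else density lborel (normal_density M (sqrt s)))" (is "_ = ?R")
    if M: "M = v \<bullet> m" and s: "s = quad_form v1 v2 c v" for v M s
  proof (rule Levy_uniqueness)
    have "0 \<le> s" unfolding s by (rule psd)
    then show "real_distribution ?R"
      by (auto simp: real_distribution_def real_distribution_axioms_def
          intro!: prob_space_return prob_space_normal_density)
    show "real_distribution (distr N borel ((\<bullet>) v))"
      by (rule N.real_distribution_distr) simp
    show "char (distr N borel ((\<bullet>) v)) = char ?R"
    proof
      fix t
      have "char (distr N borel ((\<bullet>) v)) t = char_vec N (t *\<^sub>R v)"
        unfolding char_def char_vec_def by (simp add: integral_distr)
      also have "\<dots> = exp (\<i> * of_real (t * M) - of_real (s * t\<^sup>2 / 2))"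
        by (simp add: char_N gauss_char_def quad_form_scaleR M s)
      also have "\<dots> = char ?R t"
        using \<open>0 \<le> s\<close> char_normal_density[of "sqrt s" M t] by (simp add: char_return)
      finally show "char (distr N borel ((\<bullet>) v)) t = char ?R t" .
    qed
  qed
  note projection = this[OF refl refl]
  have "(\<bullet>) (a, b) = (\<lambda>z. a * fst z + b * snd z)" for a b :: real
    by (simp add: fun_eq_iff inner_prod_def)
  then show ?thesis
    using projection[of "(a, b)" for a b] N.prob_space_axioms
    by (simp add: gaussian2_def Let_def inner_prod_def quad_form_def)
qed

section \<open>Moments of the exponential distribution\<close>

abbreviation expo :: "real measure" where
  "expo \<equiv> density lborel (exponential_density 1)"

interpretation expo: prob_space expo
  by (rule prob_space_exponential_density) simp

lemma expo_UNIV[simp]: "measure expo UNIV = 1"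
  using expo.prob_space by simp

lemma measurable_expo: "measurable expo K = measurable borel K"
  by (rule measurable_cong_sets) simp_all

lemma AE_expo_nonneg: "AE t in expo. 0 \<le> t"
  by (subst AE_density) (auto simp: exponential_density_def)

lemma AE_expo_neq: "AE t in expo. t \<noteq> s"
  using AE_lborel_singleton[of s] by (auto simp: AE_density)

lemma emeasure_expo_lessThan:
  assumes "0 \<le> t"
  shows "emeasure expo {..<t} = ennreal (1 - exp (- t))"
proof -
  have "emeasure expo {..t} = emeasure expo {..<t}"
    by (rule emeasure_eq_AE) (use AE_expo_neq[of t] in \<open>auto elim!: eventually_mono\<close>)
  then show ?thesis
    using emeasure_erlang_density[of 1 0 t] assms by (simp add: erlang_CDF_0)
qed

lemma has_bochner_integral_expo_moment:
  assumes "l < 1"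
  shows "has_bochner_integral expo (\<lambda>x. exp (l * x) * x ^ m) (fact m / (1 - l) ^ (m + 1))"
proof (rule has_bochner_integral_nn_integral)
  have l: "0 < 1 - l" using assms by simp
  show "AE x in expo. 0 \<le> exp (l * x) * x ^ m"
    using AE_expo_nonneg by eventually_elim simp
  have "(\<integral>\<^sup>+x. ennreal (exp (l * x) * x ^ m) \<partial>expo) =
      (\<integral>\<^sup>+x. ennreal (exponential_density 1 x) * ennreal (exp (l * x) * x ^ m) \<partial>lborel)"
    by (rule nn_integral_density) auto
  also have "\<dots> = (\<integral>\<^sup>+x. ennreal (fact m / (1 - l) ^ (m + 1)) *
      ennreal (erlang_density m (1 - l) x * x ^ 0) \<partial>lborel)"
  proof (rule nn_integral_cong)
    fix x :: real
    have "exponential_density 1 x * (exp (l * x) * x ^ m) =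
        fact m / (1 - l) ^ (m + 1) * (erlang_density m (1 - l) x * x ^ 0)"
      using l by (auto simp: exponential_density_def erlang_density_def exp_diff exp_minus
          field_simps)
    then show "ennreal (exponential_density 1 x) * ennreal (exp (l * x) * x ^ m) =
        ennreal (fact m / (1 - l) ^ (m + 1)) * ennreal (erlang_density m (1 - l) x * x ^ 0)"
      using l by (simp add: ennreal_mult'[symmetric] exponential_density_nonneg)
  qed
  also have "\<dots> = ennreal (fact m / (1 - l) ^ (m + 1))"
    using l by (subst nn_integral_cmult)
       (auto simp: nn_integral_erlang_ith_moment[OF l, of m 0, simplified])
  finally show "(\<integral>\<^sup>+x. ennreal (exp (l * x) * x ^ m) \<partial>expo) = ennreal (fact m / (1 - l) ^ (m + 1))" .
  show "0 \<le> fact m / (1 - l) ^ (m + 1)" using l by simp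
qed simp

lemma beta_fact_recurrence:
  "fact q * fact k / fact (k + q + 1) - fact q * fact (Suc k) / fact (Suc k + q + 1) =
    (fact (Suc q) * fact k / fact (k + Suc q + 1) :: real)"
proof -
  define c where "c = (fact (k + q + 1) :: real)"
  have "0 < c" "0 < real k + real q + 2" by (simp_all add: c_def)
  moreover have "fact (Suc k + q + 1) = (real k + real q + 2) * c"
      "fact (k + Suc q + 1) = (real k + real q + 2) * c"
    by (simp_all add: c_def algebra_simps)
  ultimately show ?thesis
    unfolding c_def[symmetric] fact_Suc by (simp add: divide_simps) (simp add: algebra_simps)
qed

lemma has_bochner_integral_expo_beta:
  "has_bochner_integral expo (\<lambda>t. exp (- t) ^ k * (1 - exp (- t)) ^ q)
    (fact q * fact k / fact (k + q + 1))"
proof (induction q arbitrary: k)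
  case 0
  have "(\<lambda>x. exp (- real k * x) * x ^ 0) = (\<lambda>t. exp (- t) ^ k * (1 - exp (- t)) ^ 0)"
    by (simp add: fun_eq_iff exp_of_nat_mult[symmetric])
  then show ?case
    using has_bochner_integral_expo_moment[of "- real k" 0] by (simp add: add.commute)
next
  case (Suc q)
  have "has_bochner_integral expo
      (\<lambda>t. exp (- t) ^ k * (1 - exp (- t)) ^ q - exp (- t) ^ Suc k * (1 - exp (- t)) ^ q)
      (fact q * fact k / fact (k + q + 1) - fact q * fact (Suc k) / fact (Suc k + q + 1))"
    by (intro has_bochner_integral_diff Suc.IH)
  moreover have "(\<lambda>t::real. exp (- t) ^ k * (1 - exp (- t)) ^ q -
      exp (- t) ^ Suc k * (1 - exp (- t)) ^ q) =
      (\<lambda>t. exp (- t) ^ k * (1 - exp (- t)) ^ Suc q)"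
    by (simp add: fun_eq_iff algebra_simps)
  ultimately show ?case by (simp only: beta_fact_recurrence)
qed

section \<open>The law of an upper order statistic of an exponential sample\<close>

definition order_stat_density :: "nat \<Rightarrow> nat \<Rightarrow> real \<Rightarrow> real" where
  "order_stat_density n k t =
    fact n / (fact (n - 1 - k) * fact k) * (exp (- t) ^ k * (1 - exp (- t)) ^ (n - 1 - k))"

definition order_stat_law :: "nat \<Rightarrow> nat \<Rightarrow> real measure" where
  "order_stat_law n k = density expo (order_stat_density n k)"

lemma order_stat_density_measurable[measurable]: "order_stat_density n k \<in> borel_measurable borel"
  unfolding order_stat_density_def[abs_def] by measurable

lemma AE_order_stat_density_nonneg: "AE t in expo. 0 \<le> order_stat_density n k t"
  using AE_expo_nonneg
  by eventually_elim (simp add: order_stat_density_def)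

lemma sets_order_stat_law[simp, measurable_cong]: "sets (order_stat_law n k) = sets borel"
  by (simp add: order_stat_law_def)

lemma space_order_stat_law[simp]: "space (order_stat_law n k) = UNIV"
  by (simp add: order_stat_law_def)

lemma order_stat_law_moment:
  assumes "k < n"
  shows "has_bochner_integral (order_stat_law n k) (\<lambda>t. exp (- t) ^ m)
    (fact n * fact (k + m) / (fact k * fact (n + m)))"
  unfolding order_stat_law_def
proof (rule has_bochner_integral_density[OF _ _ AE_order_stat_density_nonneg])
  have degree: "k + m + (n - 1 - k) + 1 = n + m" using assms by simp
  have "has_bochner_integral expo
      (\<lambda>t. fact n / (fact (n - 1 - k) * fact k) *
        (exp (- t) ^ (k + m) * (1 - exp (- t)) ^ (n - 1 - k)))
      (fact n / (fact (n - 1 - k) * fact k) * (fact (n - 1 - k) * fact (k + m) / fact (n + m)))"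
    using has_bochner_integral_expo_beta[of "k + m" "n - 1 - k"] unfolding degree
    by (intro has_bochner_integral_mult_right)
  then show "has_bochner_integral expo (\<lambda>t. order_stat_density n k t *\<^sub>R exp (- t) ^ m)
      (fact n * fact (k + m) / (fact k * fact (n + m)))"
    by (simp add: order_stat_density_def power_add mult_ac)
qed simp_all

lemma prob_space_order_stat_law:
  assumes "k < n"
  shows "prob_space (order_stat_law n k)"
proof -
  have "measure (order_stat_law n k) UNIV = 1"
    using order_stat_law_moment[OF assms, of 0] by (simp add: has_bochner_integral_iff)
  then show ?thesis
    by (intro prob_spaceI) (cases "emeasure (order_stat_law n k) UNIV"; simp add: measure_def)
qed

lemma order_stat_law_second_moment:
  assumes "k < n" "1 \<le> k"
  defines "r \<equiv> \<lambda>j. (1 + j / real k) / (1 + j / real n)"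
  shows "has_bochner_integral (order_stat_law n k) (\<lambda>t. (exp (- t) * (real n / real k) - 1)\<^sup>2)
    (r 1 * r 2 - 2 * r 1 + 1)"
proof -
  let ?c = "real n / real k"
  have r: "r j = ?c * ((real k + j) / (real n + j))" if "0 \<le> j" for j
    using assms that by (simp add: r_def divide_simps add_nonneg_eq_0_iff)
  have fact_add: "fact (m + 1) = (real m + 1) * fact m"
      "fact (m + 2) = (real m + 1) * (real m + 2) * fact m"
    for m
    by (simp_all add: numeral_2_eq_2 algebra_simps)
  have moment1: "fact n * fact (k + 1) / (fact k * fact (n + 1)) = (real k + 1) / (real n + 1)"
    by (simp only: fact_add) simp
  have moment2: "fact n * fact (k + 2) / (fact k * fact (n + 2)) =
      (real k + 1) / (real n + 1) * ((real k + 2) / (real n + 2))"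
    by (simp only: fact_add) simp
  have "has_bochner_integral (order_stat_law n k)
     (\<lambda>t. ?c\<^sup>2 * exp (- t) ^ 2 - 2 * ?c * exp (- t) ^ 1 + exp (- t) ^ 0)
     (?c\<^sup>2 * (fact n * fact (k + 2) / (fact k * fact (n + 2))) -
      2 * ?c * (fact n * fact (k + 1) / (fact k * fact (n + 1))) +
      fact n * fact (k + 0) / (fact k * fact (n + 0)))"
    by (intro has_bochner_integral_add has_bochner_integral_diff has_bochner_integral_mult_right
          order_stat_law_moment assms(1))
  moreover have "(\<lambda>t. ?c\<^sup>2 * exp (- t) ^ 2 - 2 * ?c * exp (- t) ^ 1 + exp (- t) ^ 0) =
      (\<lambda>t. (exp (- t) * ?c - 1)\<^sup>2)"
    by (simp add: fun_eq_iff power2_eq_square algebra_simps)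
  moreover have "?c\<^sup>2 * (fact n * fact (k + 2) / (fact k * fact (n + 2))) -
      2 * ?c * (fact n * fact (k + 1) / (fact k * fact (n + 1))) +
      fact n * fact (k + 0) / (fact k * fact (n + 0)) = r 1 * r 2 - 2 * r 1 + 1"
    unfolding moment1 moment2 by (simp add: r power2_eq_square mult_ac)
  ultimately show ?thesis by simp
qed

lemma order_stat_law_concentration:
  fixes k :: "nat \<Rightarrow> nat"
  assumes k: "\<forall>\<^sub>F n in sequentially. 1 \<le> k n \<and> k n < n" and k_top: "filterlim k at_top sequentially"
    and \<delta>: "0 < \<delta>"
  shows "(\<lambda>n. measure (order_stat_law n (k n)) {t. \<delta> \<le> \<bar>exp (- t) * (real n / real (k n)) - 1\<bar>})
    \<longlonglongrightarrow> 0"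
proof (rule tendsto_sandwich[where f = "\<lambda>_. 0"])
  define r where "r j n = (1 + j / real (k n)) / (1 + j / real n)" for j n
  have "filterlim (\<lambda>n. real (k n)) at_top sequentially"
    by (rule filterlim_compose[OF filterlim_real_sequentially k_top])
  then have null: "(\<lambda>n. j / real (k n)) \<longlonglongrightarrow> 0" "(\<lambda>n. j / real n) \<longlonglongrightarrow> 0" for j
    by (auto intro: real_tendsto_divide_at_top[OF tendsto_const] filterlim_real_sequentially)
  have r: "r j \<longlonglongrightarrow> 1" for j
    unfolding r_def by (rule tendsto_eq_intros null refl | simp)+
  show "(\<lambda>n. (r 1 n * r 2 n - 2 * r 1 n + 1) / \<delta>\<^sup>2) \<longlonglongrightarrow> 0"
    by (rule tendsto_eq_intros r refl | use \<delta> in simp)+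
  show "\<forall>\<^sub>F n in sequentially. measure (order_stat_law n (k n))
      {t. \<delta> \<le> \<bar>exp (- t) * (real n / real (k n)) - 1\<bar>} \<le> (r 1 n * r 2 n - 2 * r 1 n + 1) / \<delta>\<^sup>2"
    using k
  proof eventually_elim
    case (elim n)
    interpret prob_space "order_stat_law n (k n)"
      using elim by (simp add: prob_space_order_stat_law)
    have "has_bochner_integral (order_stat_law n (k n))
        (\<lambda>t. (exp (- t) * (real n / real (k n)) - 1)\<^sup>2)
        (r 1 n * r 2 n - 2 * r 1 n + 1)"
      unfolding r_def using elim by (intro order_stat_law_second_moment) auto
    then show ?case
      using second_moment_method[of "\<lambda>t. exp (- t) * (real n / real (k n)) - 1" \<delta>] \<delta>
      by (simp add: has_bochner_integral_iff)
  qed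
qed simp_all

lemma uniformly_near_if_sequentially:
  fixes \<phi> Y :: "nat \<Rightarrow> 'a \<Rightarrow> real"
  assumes lim: "\<And>N x. filterlim N at_top sequentially \<Longrightarrow> (\<lambda>m. Y (N m) (x m)) \<longlonglongrightarrow> c \<Longrightarrow>
      (\<lambda>m. \<phi> (N m) (x m)) \<longlonglongrightarrow> L"
    and e: "0 < e"
  shows "\<exists>\<delta>>0. \<forall>\<^sub>F n in sequentially. \<forall>x. \<bar>Y n x - c\<bar> < \<delta> \<longrightarrow> \<bar>\<phi> n x - L\<bar> < e"
proof (rule ccontr)
  assume neg: "\<not> ?thesis"
  have "\<exists>n\<ge>m. \<exists>x. \<bar>Y n x - c\<bar> < 1 / real (Suc m) \<and> e \<le> \<bar>\<phi> n x - L\<bar>" for m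
  proof -
    have "0 < 1 / real (Suc m)" by simp
    with neg have "\<not> (\<forall>\<^sub>F n in sequentially. \<forall>x. \<bar>Y n x - c\<bar> < 1 / real (Suc m) \<longrightarrow> \<bar>\<phi> n x - L\<bar> < e)"
      by blast
    then show ?thesis unfolding eventually_sequentially by (metis not_less)
  qed
  then obtain N x where N: "\<And>m. m \<le> N m" and near: "\<And>m. \<bar>Y (N m) (x m) - c\<bar> < 1 / real (Suc m)"
    and far: "\<And>m. e \<le> \<bar>\<phi> (N m) (x m) - L\<bar>"
    by metis
  have "filterlim N at_top sequentially"
    by (rule filterlim_at_top_mono[OF filterlim_ident]) (use N in simp)
  moreover have "(\<lambda>m. Y (N m) (x m) - c) \<longlonglongrightarrow> 0"
  proof (rule Lim_null_comparison)
    show "(\<lambda>m. 1 / real (Suc m)) \<longlonglongrightarrow> 0"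
      using LIMSEQ_inverse_real_of_nat by (simp add: inverse_eq_divide)
  qed (use near in \<open>auto intro!: always_eventually less_imp_le\<close>)
  ultimately have "(\<lambda>m. \<phi> (N m) (x m)) \<longlonglongrightarrow> L"
    by (rule lim[OF _ LIM_zero_cancel])
  then have "\<forall>\<^sub>F m in sequentially. \<bar>\<phi> (N m) (x m) - L\<bar> < e"
    using tendstoD[OF _ e] by (fastforce simp: dist_real_def)
  then show False
    using far by (auto simp: eventually_sequentially not_less[symmetric])
qed

lemma expectation_tendsto_if_concentrated:
  fixes P :: "nat \<Rightarrow> 'a measure" and \<phi> Y :: "nat \<Rightarrow> 'a \<Rightarrow> real"
  assumes P: "\<forall>\<^sub>F n in sequentially. prob_space (P n)"
    and [measurable]: "\<And>n. \<phi> n \<in> borel_measurable (P n)" "\<And>n. Y n \<in> borel_measurable (P n)"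
    and conc: "\<And>\<delta>. 0 < \<delta> \<Longrightarrow> (\<lambda>n. measure (P n) {x \<in> space (P n). \<delta> \<le> \<bar>Y n x - c\<bar>}) \<longlonglongrightarrow> 0"
    and bound: "\<And>n x. \<bar>\<phi> n x\<bar> \<le> B"
    and lim: "\<And>N x. filterlim N at_top sequentially \<Longrightarrow> (\<lambda>m. Y (N m) (x m)) \<longlonglongrightarrow> c \<Longrightarrow>
      (\<lambda>m. \<phi> (N m) (x m)) \<longlonglongrightarrow> L"
  shows "(\<lambda>n. integral\<^sup>L (P n) (\<phi> n)) \<longlonglongrightarrow> L"
proof (rule LIMSEQ_I)
  fix e :: real assume e: "0 < e"
  then have "0 < e / 2" by simp
  from uniformly_near_if_sequentially[of Y c \<phi> L, OF lim this] obtain \<delta> where \<delta>: "0 < \<delta>"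
    and near: "\<forall>\<^sub>F n in sequentially. \<forall>x. \<bar>Y n x - c\<bar> < \<delta> \<longrightarrow> \<bar>\<phi> n x - L\<bar> < e / 2"
    by blast
  define far where "far n = {x \<in> space (P n). \<delta> \<le> \<bar>Y n x - c\<bar>}" for n
  have [measurable]: "far n \<in> sets (P n)" for n unfolding far_def by measurable
  have "(\<lambda>n. (B + \<bar>L\<bar>) * measure (P n) (far n)) \<longlonglongrightarrow> (B + \<bar>L\<bar>) * 0"
    unfolding far_def by (intro tendsto_mult tendsto_const conc \<delta>)
  then have "\<forall>\<^sub>F n in sequentially. (B + \<bar>L\<bar>) * measure (P n) (far n) < e / 2"
    by (rule order_tendstoD) (use e in simp)
  then have "\<forall>\<^sub>F n in sequentially. norm (integral\<^sup>L (P n) (\<phi> n) - L) < e"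
    using near P
  proof eventually_elim
    case (elim n)
    interpret prob_space "P n" by fact
    have int: "integrable (P n) (\<phi> n)"
      using bound by (intro integrable_const_bound[of _ B]) auto
    have int_far: "integrable (P n) (indicat_real (far n))"
      by (rule integrable_real_indicator) (simp_all add: emeasure_eq_measure)
    have "\<bar>expectation (\<phi> n) - L\<bar> = \<bar>\<integral>x. \<phi> n x - L \<partial>P n\<bar>"
      using int by (simp add: prob_space)
    also have "\<dots> \<le> (\<integral>x. \<bar>\<phi> n x - L\<bar> \<partial>P n)" by (rule integral_abs_bound)
    also have "\<dots> \<le> (\<integral>x. e / 2 + (B + \<bar>L\<bar>) * indicator (far n) x \<partial>P n)"
    proof (rule integral_mono)
      fix x assume "x \<in> space (P n)"
      moreover have "\<bar>\<phi> n x - L\<bar> \<le> B + \<bar>L\<bar>" using bound[of n x] by linarith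
      ultimately show "\<bar>\<phi> n x - L\<bar> \<le> e / 2 + (B + \<bar>L\<bar>) * indicator (far n) x"
        using elim(2)[rule_format, of x] e by (cases "x \<in> far n") (auto simp: far_def)
    qed (use int int_far in auto)
    also have "\<dots> = e / 2 + (B + \<bar>L\<bar>) * measure (P n) (far n)"
      using int_far by (simp add: prob_space)
    finally show ?case using elim(1) by simp
  qed
  then show "\<exists>no. \<forall>n\<ge>no. norm (integral\<^sup>L (P n) (\<phi> n) - L) < e"
    by (simp add: eventually_sequentially)
qed

section \<open>Order statistics\<close>

definition upper_stat :: "nat \<Rightarrow> nat \<Rightarrow> (nat \<Rightarrow> real) \<Rightarrow> real" where
  "upper_stat n l x = sort (map x [0..<n]) ! (n - l - 1)"

lemma order_stat_eq_upper_stat: "order_stat X (n - l) n \<omega> = upper_stat n l (\<lambda>i. X i \<omega>)"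
  by (simp add: order_stat_def upper_stat_def)

lemma upper_stat_cong: "(\<And>i. i < n \<Longrightarrow> x i = y i) \<Longrightarrow> upper_stat n l x = upper_stat n l y"
  unfolding upper_stat_def by (intro arg_cong2[where f = nth] arg_cong[where f = sort]
      map_cong) auto

lemma upper_stat_restrict: "upper_stat n l (restrict x {..<n}) = upper_stat n l x"
  by (rule upper_stat_cong) simp

lemma upper_stat_mono:
  assumes "mono u" "l < n"
  shows "upper_stat n l (\<lambda>i. u (x i)) = u (upper_stat n l x)"
proof -
  have "sort (map (\<lambda>i. u (x i)) [0..<n]) = map u (sort (map x [0..<n]))"
  proof (rule properties_for_sort)
    have "sorted (sort (map x [0..<n]))" by simp
    then show "sorted (map u (sort (map x [0..<n])))"
      unfolding sorted_map by (rule sorted_wrt_mono_rel[rotated]) (simp add: monoD[OF assms(1)])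
    show "mset (map u (sort (map x [0..<n]))) = mset (map (\<lambda>i. u (x i)) [0..<n])"
      by (simp add: multiset.map_comp comp_def)
  qed
  then show ?thesis using assms(2) by (simp add: upper_stat_def)
qed

lemma sorted_nth_le_iff:
  fixes c :: "'a::linorder"
  assumes "sorted xs" "j < length xs"
  shows "xs ! j \<le> c \<longleftrightarrow> j < length (filter (\<lambda>x. x \<le> c) xs)"
  using assms
proof (induction xs arbitrary: j)
  case (Cons y ys)
  show ?case
  proof (cases "y \<le> c")
    case True
    then show ?thesis using Cons by (cases j) auto
  next
    case False
    then have "filter (\<lambda>x. x \<le> c) (y # ys) = []"
      using Cons.prems by (auto simp: filter_empty_conv)
    moreover have "y \<le> (y # ys) ! j"
      using Cons.prems by (cases j) auto
    ultimately show ?thesis using False by simp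
  qed
qed simp

lemma upper_stat_le_iff:
  assumes "l < n"
  shows "upper_stat n l x \<le> c \<longleftrightarrow> n - l \<le> card {i\<in>{..<n}. x i \<le> c}"
proof -
  have "length (filter (\<lambda>y. y \<le> c) (sort (map x [0..<n]))) =
      length (filter (\<lambda>y. y \<le> c) (map x [0..<n]))"
    by (metis mset_filter mset_sort size_mset)
  also have "\<dots> = length (filter (\<lambda>i. x i \<le> c) [0..<n])"
    by (simp add: filter_map comp_def)
  also have "\<dots> = card {i\<in>{..<n}. x i \<le> c}"
    by (subst length_filter_conv_card) (auto intro!: arg_cong[where f = card])
  finally have "upper_stat n l x \<le> c \<longleftrightarrow> n - l - 1 < card {i\<in>{..<n}. x i \<le> c}"
    using sorted_nth_le_iff[of "sort (map x [0..<n])" "n - l - 1" c] assms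
    by (simp add: upper_stat_def)
  then show ?thesis using assms by auto
qed

lemma measurable_upper_stat:
  assumes [measurable]: "\<And>i. i < n \<Longrightarrow> (\<lambda>\<omega>. Y \<omega> i) \<in> borel_measurable M" and "l < n"
  shows "(\<lambda>\<omega>. upper_stat n l (Y \<omega>)) \<in> borel_measurable M"
proof (rule borel_measurableI_le)
  fix c
  have count: "real (card {i\<in>{..<n}. Y \<omega> i \<le> c}) = (\<Sum>i<n. if Y \<omega> i \<le> c then 1 else 0)" for \<omega>
    by (subst sum.If_cases) (auto intro!: arg_cong[where f = card])
  have "upper_stat n l (Y \<omega>) \<le> c \<longleftrightarrow> real (n - l) \<le> (\<Sum>i<n. if Y \<omega> i \<le> c then 1 else 0)" for \<omega>
    unfolding upper_stat_le_iff[OF \<open>l < n\<close>] count[symmetric] by simp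
  then show "{\<omega> \<in> space M. upper_stat n l (Y \<omega>) \<le> c} \<in> sets M"
    by simp
qed

lemma sort_map_split:
  fixes y :: "nat \<Rightarrow> 'a::linorder"
  assumes i: "i < n" "i \<notin> S" and S: "S \<subseteq> {..<n}"
    and above: "\<And>j. j \<in> S \<Longrightarrow> y i \<le> y j"
    and below: "\<And>j. j \<in> {..<n} - insert i S \<Longrightarrow> y j \<le> y i"
  shows "sort (map y [0..<n]) =
    sort (map y (sorted_list_of_set ({..<n} - insert i S))) @ [y i] @
      sort (map y (sorted_list_of_set S))"
proof (rule properties_for_sort)
  have fin: "finite S" using S finite_subset by blast
  have mset_list: "mset (sorted_list_of_set A) = mset_set A" for A :: "nat set"
    by (metis mset_sorted_list_of_multiset sorted_list_of_mset_set)
  have "mset_set {0..<n} = mset_set (({..<n} - insert i S) \<union> ({i} \<union> S))"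
    using i S by (intro arg_cong[where f = mset_set]) auto
  also have "\<dots> = mset_set ({..<n} - insert i S) + (mset_set {i} + mset_set S)"
    using fin i by (subst mset_set_Union; auto simp: mset_set_Union)
  finally show "mset (sort (map y (sorted_list_of_set ({..<n} - insert i S))) @ [y i] @
      sort (map y (sorted_list_of_set S))) = mset (map y [0..<n])"
    using fin by (simp add: mset_list)
  show "sorted (sort (map y (sorted_list_of_set ({..<n} - insert i S))) @ [y i] @
      sort (map y (sorted_list_of_set S)))"
    using fin above below by (fastforce simp: sorted_append intro: order_trans)
qed

lemma upper_stat_pivot:
  fixes h :: "real \<Rightarrow> 'b::comm_monoid_add"
  assumes i: "i < n" "i \<notin> S" and S: "S \<subseteq> {..<n}" "card S = k"
    and above: "\<And>j. j \<in> S \<Longrightarrow> x i \<le> x j"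
    and below: "\<And>j. j \<in> {..<n} - insert i S \<Longrightarrow> x j \<le> x i"
  shows "upper_stat n k x = x i"
    and "(\<Sum>l<k. h (upper_stat n l x)) = (\<Sum>j\<in>S. h (x j))"
proof -
  define lo where "lo = sort (map x (sorted_list_of_set ({..<n} - insert i S)))"
  define hi where "hi = sort (map x (sorted_list_of_set S))"
  have split: "sort (map x [0..<n]) = lo @ [x i] @ hi"
    unfolding lo_def hi_def by (rule sort_map_split) (use assms in auto)
  have hi: "length hi = k" using S by (simp add: hi_def)
  have "length (sort (map x [0..<n])) = n" by simp
  then have n: "n = length lo + 1 + k" unfolding split using hi by simp
  show "upper_stat n k x = x i"
    unfolding upper_stat_def split using n by (simp add: nth_append)
  have "(\<Sum>l<k. h (upper_stat n l x)) = (\<Sum>l<k. h (hi ! (k - Suc l)))"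
  proof (rule sum.cong[OF refl])
    fix l assume "l \<in> {..<k}"
    then have "n - l - 1 = Suc (length lo + (k - Suc l))" using n by auto
    then show "h (upper_stat n l x) = h (hi ! (k - Suc l))"
      unfolding upper_stat_def split by (simp add: nth_append)
  qed
  also have "\<dots> = (\<Sum>l<k. h (hi ! l))"
    by (rule sum.nat_diff_reindex)
  also have "\<dots> = sum_list (map h hi)"
    using hi by (simp add: sum_list_sum_nth atLeast0LessThan)
  also have "\<dots> = sum_mset (image_mset h (mset hi))"
    by (simp flip: sum_mset_sum_list)
  also have "mset hi = image_mset x (mset_set S)"
    unfolding hi_def
    by (metis mset_map mset_sort mset_sorted_list_of_multiset sorted_list_of_mset_set)
  also have "sum_mset (image_mset h (image_mset x (mset_set S))) = (\<Sum>j\<in>S. h (x j))"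
    by (simp add: sum_unfold_sum_mset multiset.map_comp comp_def)
  finally show "(\<Sum>l<k. h (upper_stat n l x)) = (\<Sum>j\<in>S. h (x j))" .
qed

section \<open>Conditioning an exponential sample on an upper order statistic\<close>

abbreviation expos :: "'i set \<Rightarrow> ('i \<Rightarrow> real) measure" where
  "expos I \<equiv> PiM I (\<lambda>_. expo)"

interpretation expos: product_sigma_finite "\<lambda>_ :: nat. expo"
  by standard

lemma measurable_expos_component: "j \<in> I \<Longrightarrow> (\<lambda>x. x j) \<in> borel_measurable (expos I)"
  by measurable

lemma prob_space_expos: "prob_space (expos I)"
  by (intro prob_space_PiM expo.prob_space_axioms)

lemma nn_integral_expo_shift:
  assumes [measurable]: "f \<in> borel_measurable borel" and t: "0 \<le> t"
  shows "(\<integral>\<^sup>+x. indicator {t<..} x * f x \<partial>expo) = ennreal (exp (- t)) * (\<integral>\<^sup>+x. f (t + x) \<partial>expo)"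
proof -
  have expo: "(\<integral>\<^sup>+x. h x \<partial>expo) = (\<integral>\<^sup>+x. ennreal (exp (- x)) * h x * indicator {0..} x \<partial>lborel)"
    if [measurable]: "h \<in> borel_measurable borel" for h :: "real \<Rightarrow> ennreal"
    by (subst nn_integral_density)
       (auto simp: exponential_density_def intro!: nn_integral_cong split: split_indicator)
  have "(\<integral>\<^sup>+x. indicator {t<..} x * f x \<partial>expo) =
      (\<integral>\<^sup>+x. ennreal (exp (- x)) * f x * indicator {t<..} x \<partial>lborel)"
    using t by (subst expo) (auto intro!: nn_integral_cong split: split_indicator)
  also have "\<dots> = (\<integral>\<^sup>+x. ennreal (exp (- (t + x))) * f (t + x) * indicator {t<..} (t + x) \<partial>lborel)"
    by (subst nn_integral_real_affine[where c = 1 and t = t]) auto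
  also have "\<dots> = (\<integral>\<^sup>+x. ennreal (exp (- t)) *
      (ennreal (exp (- x)) * f (t + x) * indicator {0..} x) \<partial>lborel)"
  proof (rule nn_integral_cong_AE)
    have "AE x in lborel. x \<noteq> (0::real)" by (rule AE_lborel_singleton)
    then show "AE x in lborel. ennreal (exp (- (t + x))) * f (t + x) * indicator {t<..} (t + x) =
        ennreal (exp (- t)) * (ennreal (exp (- x)) * f (t + x) * indicator {0..} x)"
      by eventually_elim
         (auto simp: exp_diff ennreal_mult mult_ac divide_inverse exp_minus split: split_indicator)
  qed
  also have "\<dots> = ennreal (exp (- t)) * (\<integral>\<^sup>+x. f (t + x) \<partial>expo)"
    by (subst nn_integral_cmult) (auto simp: expo)
  finally show ?thesis .
qed

lemma measurable_nn_integral_expos_fun_upd: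
  fixes H :: "('i \<Rightarrow> real) \<Rightarrow> ennreal" and t :: real
  assumes [measurable]: "H \<in> borel_measurable (PiM (insert i S) (\<lambda>_. borel))"
  shows "(\<lambda>y. \<integral>\<^sup>+x. H ((\<lambda>j\<in>S. t + x j)(i := y)) \<partial>expos S) \<in> borel_measurable borel"
proof -
  interpret S: prob_space "expos S" by (rule prob_space_expos)
  have "(\<lambda>(y, x). (\<lambda>j\<in>S. t + x j)(i := y))
      \<in> measurable (borel \<Otimes>\<^sub>M expos S) (PiM (insert i S) (\<lambda>_. borel))"
    unfolding split_beta by (rule measurable_fun_upd[where J = S]) auto
  then show ?thesis by measurable
qed

lemma nn_integral_expos_shift:
  fixes H :: "(nat \<Rightarrow> real) \<Rightarrow> ennreal"
  assumes "finite S" and H: "H \<in> borel_measurable (PiM S (\<lambda>_. borel))" and t: "0 \<le> t"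
  shows "(\<integral>\<^sup>+x. (\<Prod>j\<in>S. indicator {t<..} (x j)) * H x \<partial>expos S) =
    ennreal (exp (- t)) ^ card S * (\<integral>\<^sup>+x. H (\<lambda>j\<in>S. t + x j) \<partial>expos S)"
  using assms(1) H
proof (induction S arbitrary: H rule: finite_induct)
  case empty
  then show ?case by (simp add: PiM_empty nn_integral_count_space_finite restrict_def)
next
  case (insert i S)
  note [measurable] = insert.prems
  let ?P = "\<lambda>S x. \<Prod>j\<in>S. indicator {t<..} (x j) :: ennreal"
  define \<Phi> where "\<Phi> y = (\<integral>\<^sup>+x. H ((\<lambda>j\<in>S. t + x j)(i := y)) \<partial>expos S)" for y
  have [measurable]: "(\<lambda>x. x(i := y))
      \<in> measurable (PiM S (\<lambda>_. borel)) (PiM (insert i S) (\<lambda>_. borel))"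
    for y :: real
    by (rule measurable_fun_upd) auto
  have [measurable]: "\<Phi> \<in> borel_measurable borel"
    unfolding \<Phi>_def by (rule measurable_nn_integral_expos_fun_upd) measurable
  have "(\<integral>\<^sup>+x. ?P (insert i S) x * H x \<partial>expos (insert i S)) =
      (\<integral>\<^sup>+y. (\<integral>\<^sup>+x. ?P (insert i S) (x(i := y)) * H (x(i := y)) \<partial>expos S) \<partial>expo)"
    by (rule expos.product_nn_integral_insert_rev[OF insert.hyps]) measurable
  also have "\<dots> = (\<integral>\<^sup>+y. indicator {t<..} y * (ennreal (exp (- t)) ^ card S * \<Phi> y) \<partial>expo)"
  proof (rule nn_integral_cong)
    fix y
    have "?P S (x(i := y)) = ?P S x" for x
      using insert.hyps by (intro prod.cong) auto
    then have "(\<integral>\<^sup>+x. ?P (insert i S) (x(i := y)) * H (x(i := y)) \<partial>expos S) =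
        indicator {t<..} y * (\<integral>\<^sup>+x. ?P S x * H (x(i := y)) \<partial>expos S)"
      using insert.hyps by (simp add: mult.assoc nn_integral_cmult)
    also have "(\<integral>\<^sup>+x. ?P S x * H (x(i := y)) \<partial>expos S) = ennreal (exp (- t)) ^ card S * \<Phi> y"
      unfolding \<Phi>_def by (rule insert.IH) measurable
    finally show "(\<integral>\<^sup>+x. ?P (insert i S) (x(i := y)) * H (x(i := y)) \<partial>expos S) =
        indicator {t<..} y * (ennreal (exp (- t)) ^ card S * \<Phi> y)" .
  qed
  also have "\<dots> = ennreal (exp (- t)) * (\<integral>\<^sup>+y. ennreal (exp (- t)) ^ card S * \<Phi> (t + y) \<partial>expo)"
    by (rule nn_integral_expo_shift[OF _ t]) measurable
  also have "\<dots> = ennreal (exp (- t)) ^ card (insert i S) * (\<integral>\<^sup>+y. \<Phi> (t + y) \<partial>expo)"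
    using insert.hyps by (simp add: nn_integral_cmult measurable_expo mult.assoc)
  also have "(\<integral>\<^sup>+y. \<Phi> (t + y) \<partial>expo) =
      (\<integral>\<^sup>+y. (\<integral>\<^sup>+x. H (\<lambda>j\<in>insert i S. t + (x(i := y)) j) \<partial>expos S) \<partial>expo)"
    unfolding \<Phi>_def using insert.hyps
    by (intro nn_integral_cong arg_cong[where f = H]) (auto simp: restrict_def fun_eq_iff)
  also have "\<dots> = (\<integral>\<^sup>+x. H (\<lambda>j\<in>insert i S. t + x j) \<partial>expos (insert i S))"
    by (rule expos.product_nn_integral_insert_rev[OF insert.hyps, symmetric]) measurable
  finally show ?case .
qed

lemma nn_integral_expos_sum_reindex:
  fixes v :: "real \<Rightarrow> 'b::{second_countable_topology, topological_comm_monoid_add}"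
  assumes "finite S" and [measurable]: "v \<in> borel_measurable borel" "h \<in> borel_measurable borel"
  shows "(\<integral>\<^sup>+x. h (\<Sum>j\<in>S. v (x j)) \<partial>expos S) = (\<integral>\<^sup>+x. h (\<Sum>j<card S. v (x j)) \<partial>expos {..<card S})"
proof -
  let ?I = "{..<card S}"
  obtain f where f: "bij_betw f ?I S"
    using ex_bij_betw_nat_finite[OF assms(1)] by (auto simp: atLeast0LessThan)
  have [measurable]: "(\<lambda>\<omega>. \<lambda>n\<in>?I. \<omega> (f n)) \<in> measurable (expos S) (expos ?I)"
    using bij_betwE[OF f] by (intro measurable_restrict measurable_component_singleton) auto
  have "distr (expos S) (expos ?I) (\<lambda>\<omega>. \<lambda>n\<in>?I. \<omega> (f n)) = expos ?I"
    by (rule distr_PiM_reindex[where M = "\<lambda>_. expo"])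
       (use f in \<open>auto simp: bij_betw_def expo.prob_space_axioms\<close>)
  then have "(\<integral>\<^sup>+x. h (\<Sum>j\<in>?I. v (x j)) \<partial>expos ?I) =
      (\<integral>\<^sup>+x. h (\<Sum>j\<in>?I. v (x j)) \<partial>distr (expos S) (expos ?I) (\<lambda>\<omega>. \<lambda>n\<in>?I. \<omega> (f n)))"
    by simp
  also have "\<dots> = (\<integral>\<^sup>+x. h (\<Sum>j\<in>?I. v (x (f j))) \<partial>expos S)"
    by (subst nn_integral_distr) simp_all
  also have "\<dots> = (\<integral>\<^sup>+x. h (\<Sum>j\<in>S. v (x j)) \<partial>expos S)"
    by (intro nn_integral_cong arg_cong[where f = h]
       sum.reindex_bij_betw[OF f, of "\<lambda>j. v (x j)" for x])
  finally show ?thesis by simp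
qed

lemma (in product_sigma_finite) product_nn_integral_times:
  assumes IJ: "I \<inter> J = {}" "finite I" "finite J"
    and [measurable]: "f \<in> borel_measurable (PiM I M)" "g \<in> borel_measurable (PiM J M)"
  shows "(\<integral>\<^sup>+x. f (restrict x I) * g (restrict x J) \<partial>PiM (I \<union> J) M) =
    (\<integral>\<^sup>+x. f x \<partial>PiM I M) * (\<integral>\<^sup>+y. g y \<partial>PiM J M)"
proof -
  have [measurable]: "(\<lambda>x. restrict x I) \<in> measurable (PiM (I \<union> J) M) (PiM I M)"
      "(\<lambda>x. restrict x J) \<in> measurable (PiM (I \<union> J) M) (PiM J M)"
    by (auto intro: measurable_restrict_subset)
  have "(\<integral>\<^sup>+x. f (restrict x I) * g (restrict x J) \<partial>PiM (I \<union> J) M) =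
      (\<integral>\<^sup>+x. (\<integral>\<^sup>+y. f (restrict (merge I J (x, y)) I) * g (restrict (merge I J (x, y)) J)
        \<partial>PiM J M) \<partial>PiM I M)"
    by (rule product_nn_integral_fold[OF IJ]) measurable
  also have "\<dots> = (\<integral>\<^sup>+x. (\<integral>\<^sup>+y. f x * g y \<partial>PiM J M) \<partial>PiM I M)"
    using IJ(1) by (intro nn_integral_cong) (simp add: restrict_merge space_PiM PiE_restrict)
  also have "\<dots> = (\<integral>\<^sup>+x. f x \<partial>PiM I M) * (\<integral>\<^sup>+y. g y \<partial>PiM J M)"
    by (simp add: nn_integral_cmult nn_integral_multc)
  finally show ?thesis .
qed

definition pivots :: "nat \<Rightarrow> nat \<Rightarrow> (nat \<times> nat set) set" where
  "pivots n k = (SIGMA i:{..<n}. {S. S \<subseteq> {..<n} - {i} \<and> card S = k})"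

definition pivot_event :: "nat \<Rightarrow> nat \<times> nat set \<Rightarrow> (nat \<Rightarrow> real) set" where
  "pivot_event n = (\<lambda>(i, S). {x. (\<forall>j\<in>S. x i < x j) \<and> (\<forall>j\<in>{..<n} - insert i S. x j < x i)})"

lemma finite_pivots: "finite (pivots n k)"
  unfolding pivots_def by (intro finite_SigmaI) (auto intro: finite_subset[of _ "Pow {..<n}"])

lemma card_pivots:
  assumes "k < n"
  shows "real (card (pivots n k)) = fact n / (fact (n - 1 - k) * fact k)"
proof -
  have "card (pivots n k) = (\<Sum>i<n. card {S. S \<subseteq> {..<n} - {i} \<and> card S = k})"
    unfolding pivots_def by (rule card_SigmaI) (auto intro: finite_subset[of _ "Pow {..<n}"])
  also have "\<dots> = (\<Sum>i<n. (n - 1) choose k)"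
    by (rule sum.cong) (auto simp: n_subsets)
  finally have "real (card (pivots n k)) = real n * real ((n - 1) choose k)" by simp
  also have "\<dots> = fact n / (fact (n - 1 - k) * fact k)"
    using assms by (subst binomial_fact) (auto simp: fact_reduce[of n] mult_ac)
  finally show ?thesis .
qed

lemma pivot_set_eq:
  assumes "(i, S) \<in> pivots n k" "x \<in> pivot_event n (i, S)"
  shows "S = {j. j < n \<and> x i < x j}"
proof (rule set_eqI, rule iffI)
  fix j assume "j \<in> S"
  then show "j \<in> {j. j < n \<and> x i < x j}"
    using assms by (auto simp: pivots_def pivot_event_def)
next
  fix j assume j: "j \<in> {j. j < n \<and> x i < x j}"
  show "j \<in> S"
  proof (rule ccontr)
    assume "j \<notin> S"
    then have "j \<in> {..<n} - insert i S" using j by auto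
    then have "x j < x i" using assms(2) by (simp add: pivot_event_def)
    then show False using j by simp
  qed
qed

lemma pivot_value_le:
  assumes p: "(i, S) \<in> pivots n k" "x \<in> pivot_event n (i, S)"
    and q: "(i', S') \<in> pivots n k" "x \<in> pivot_event n (i', S')"
  shows "x i' \<le> x i"
proof (rule ccontr)
  assume "\<not> x i' \<le> x i"
  then have "S' \<subset> S"
    unfolding pivot_set_eq[OF p] pivot_set_eq[OF q] using q(1) by (force simp: pivots_def)
  moreover have "finite S" unfolding pivot_set_eq[OF p] by simp
  ultimately have "card S' < card S" by (intro psubset_card_mono)
  then show False using p(1) q(1) by (auto simp: pivots_def)
qed

lemma disjoint_pivot_events: "disjoint_family_on (pivot_event n) (pivots n k)"
  unfolding disjoint_family_on_def
proof (intro ballI impI, rule ccontr)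
  fix p q assume pq: "p \<in> pivots n k" "q \<in> pivots n k"
      "p \<noteq> q" "pivot_event n p \<inter> pivot_event n q \<noteq> {}"
  obtain i S i' S' where [simp]: "p = (i, S)" "q = (i', S')" by fastforce
  from pq obtain x where x: "x \<in> pivot_event n (i, S)" "x \<in> pivot_event n (i', S')" by auto
  then have eq: "x i = x i'"
    using pq pivot_value_le[of i S n k x i' S'] pivot_value_le[of i' S' n k x i S] by simp
  have "i = i'"
  proof (rule ccontr)
    assume "i \<noteq> i'"
    then have "i' \<in> S \<or> i' \<in> {..<n} - insert i S" using pq(2) by (auto simp: pivots_def)
    then show False using x(1) eq by (auto simp: pivot_event_def)
  qed
  then show False
    using pq x pivot_set_eq[of i S n k x] pivot_set_eq[of i' S' n k x] by simp
qed

lemma upper_stat_pivot_event: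
  assumes "(i, S) \<in> pivots n k" "x \<in> pivot_event n (i, S)"
  shows "upper_stat n k x = x i" "(\<Sum>l<k. h (upper_stat n l x)) = (\<Sum>j\<in>S. h (x j))"
  using assms upper_stat_pivot[of i n S k x]
  by (auto simp: pivots_def pivot_event_def less_imp_le)

lemma nn_integral_expos_split_at:
  fixes v :: "real \<Rightarrow> 'b::{second_countable_topology, topological_comm_monoid_add}"
    and S R :: "nat set"
  assumes S: "finite S" and R: "finite R" and SR: "S \<inter> R = {}"
    and [measurable]: "v \<in> borel_measurable borel" "h \<in> borel_measurable borel" and t: "0 \<le> t"
  shows "(\<integral>\<^sup>+x. ((\<Prod>j\<in>S. indicator {t<..} (x j)) * h (\<Sum>j\<in>S. v (x j))) *
        (\<Prod>j\<in>R. indicator {..<t} (x j)) \<partial>expos (S \<union> R)) =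
    ennreal (exp (- t) ^ card S * (1 - exp (- t)) ^ card R) *
      (\<integral>\<^sup>+x. h (\<Sum>j<card S. v (t + x j)) \<partial>expos {..<card S})"
proof -
  let ?f = "\<lambda>x. (\<Prod>j\<in>S. indicator {t<..} (x j) :: ennreal) * h (\<Sum>j\<in>S. v (x j))"
    and ?g = "\<lambda>x. \<Prod>j\<in>R. indicator {..<t} (x j) :: ennreal"
  have "(\<integral>\<^sup>+x. ?f x * ?g x \<partial>expos (S \<union> R)) =
      (\<integral>\<^sup>+x. ?f (restrict x S) * ?g (restrict x R) \<partial>expos (S \<union> R))"
    by simp
  also have "\<dots> = (\<integral>\<^sup>+x. ?f x \<partial>expos S) * (\<integral>\<^sup>+x. ?g x \<partial>expos R)"
    by (rule expos.product_nn_integral_times[OF SR S R]) measurable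
  also have "(\<integral>\<^sup>+x. ?g x \<partial>expos R) = (\<Prod>j\<in>R. integral\<^sup>N expo (indicator {..<t}))"
    by (rule expos.product_nn_integral_prod[OF R]) simp
  also have "\<dots> = ennreal (1 - exp (- t)) ^ card R"
    by (simp add: emeasure_expo_lessThan[OF t])
  also have "(\<integral>\<^sup>+x. ?f x \<partial>expos S) =
      ennreal (exp (- t)) ^ card S * (\<integral>\<^sup>+x. h (\<Sum>j\<in>S. v ((\<lambda>j\<in>S. t + x j) j)) \<partial>expos S)"
    by (rule nn_integral_expos_shift[OF S _ t]) measurable
  also have "(\<integral>\<^sup>+x. h (\<Sum>j\<in>S. v ((\<lambda>j\<in>S. t + x j) j)) \<partial>expos S) =
      (\<integral>\<^sup>+x. h (\<Sum>j<card S. v (t + x j)) \<partial>expos {..<card S})"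
    using nn_integral_expos_sum_reindex[OF S, of "\<lambda>y. v (t + y)" h] by simp
  finally show ?thesis
    using t by (simp add: ennreal_mult ennreal_power mult_ac)
qed

lemma sets_pivot_event:
  assumes "p \<in> pivots n k"
  shows "pivot_event n p \<inter> space (expos {..<n}) \<in> sets (expos {..<n})"
proof -
  obtain i S where p: "p = (i, S)" by fastforce
  have S: "i < n" "S \<subseteq> {..<n}" "finite S"
    using assms finite_subset[of S "{..<n}"] by (auto simp: p pivots_def)
  have lt: "Measurable.pred (expos {..<n}) (\<lambda>x. x j < x l)" if "j < n" "l < n" for j l
    using that by (intro borel_measurable_pred_less) (auto simp: measurable_expos_component)
  have "Measurable.pred (expos {..<n})
      (\<lambda>x. (\<forall>j\<in>S. x i < x j) \<and> (\<forall>j\<in>{..<n} - insert i S. x j < x i))"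
    using S by (intro pred_intros_logic pred_intros_finite lt) auto
  then show ?thesis
    by (simp add: pred_def p pivot_event_def Int_def conj_commute)
qed

lemma prod_indicator_eq_of_bool:
  assumes "finite S"
  shows "(\<Prod>j\<in>S. indicator (A j) (x j) :: 'b::comm_semiring_1) = of_bool (\<forall>j\<in>S. x j \<in> A j)"
  using assms by (induction S rule: finite_induct) (auto simp: indicator_def)

lemma indicator_pivot_event:
  assumes "finite S"
  shows "indicator (pivot_event n (i, S)) x =
    (\<Prod>j\<in>S. indicator {x i<..} (x j)) *
      (\<Prod>j\<in>{..<n} - insert i S. indicator {..<x i} (x j) :: ennreal)"
  using assms by (auto simp: prod_indicator_eq_of_bool pivot_event_def indicator_def)

lemma measurable_on_pivot_event:
  fixes w :: "real \<Rightarrow> real \<Rightarrow> 'b::{second_countable_topology, topological_comm_monoid_add}"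
    and h :: "'b \<Rightarrow> ennreal"
  assumes p: "(i, S) \<in> pivots n k"
    and [measurable]: "case_prod w \<in> borel_measurable (borel \<Otimes>\<^sub>M borel)" "h \<in> borel_measurable borel"
  shows "(\<lambda>x. indicator (pivot_event n (i, S)) x * h (\<Sum>j\<in>S. w (x i) (x j)))
    \<in> borel_measurable (expos {..<n})"
proof -
  have "(indicator (pivot_event n (i, S)) :: _ \<Rightarrow> ennreal) \<in> borel_measurable (expos {..<n})"
    unfolding borel_measurable_indicator_iff by (rule sets_pivot_event[OF p])
  moreover have "(\<lambda>x. w (x i) (x j)) \<in> borel_measurable (expos {..<n})" if "j \<in> S" for j
  proof -
    have [measurable]: "(\<lambda>x. x i) \<in> borel_measurable (expos {..<n})"
        "(\<lambda>x. x j) \<in> borel_measurable (expos {..<n})"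
      using that p by (auto simp: pivots_def intro!: measurable_expos_component)
    show ?thesis by measurable
  qed
  ultimately show ?thesis by measurable
qed

lemma nn_integral_pivot_event:
  fixes w :: "real \<Rightarrow> real \<Rightarrow> 'b::{second_countable_topology, topological_comm_monoid_add}"
  assumes p: "(i, S) \<in> pivots n k"
    and w[measurable]: "case_prod w \<in> borel_measurable (borel \<Otimes>\<^sub>M borel)"
    and [measurable]: "h \<in> borel_measurable borel"
  shows "(\<integral>\<^sup>+x. indicator (pivot_event n (i, S)) x * h (\<Sum>j\<in>S. w (x i) (x j)) \<partial>expos {..<n}) =
    (\<integral>\<^sup>+t. ennreal (exp (- t) ^ k * (1 - exp (- t)) ^ (n - 1 - k)) *
        (\<integral>\<^sup>+x. h (\<Sum>j<k. w t (t + x j)) \<partial>expos {..<k}) \<partial>expo)"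
proof -
  define R where "R = {..<n} - insert i S"
  have i: "i < n" "i \<notin> S" and S: "S \<subseteq> {..<n}" "card S = k" and fin: "finite S"
    using p finite_subset[of S "{..<n}"] by (auto simp: pivots_def)
  have R: "finite R" "S \<inter> R = {}" "i \<notin> S \<union> R" "insert i (S \<union> R) = {..<n}" "card R = n - 1 - k"
    using i S fin by (auto simp: R_def card_Diff_subset)
  note meas = measurable_on_pivot_event[OF p w \<open>h \<in> borel_measurable borel\<close>]
  have fixed_pivot: "indicator (pivot_event n (i, S)) (x(i := t)) *
        h (\<Sum>j\<in>S. w ((x(i := t)) i) ((x(i := t)) j)) =
      ((\<Prod>j\<in>S. indicator {t<..} (x j)) * h (\<Sum>j\<in>S. w t (x j))) *
        (\<Prod>j\<in>R. indicator {..<t} (x j))" for x t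
  proof -
    have "(\<Sum>j\<in>S. w ((x(i := t)) i) ((x(i := t)) j)) = (\<Sum>j\<in>S. w t (x j))"
      using i by (intro sum.cong) auto
    moreover have "(\<Prod>j\<in>S. indicator {t<..} ((x(i := t)) j)) =
        (\<Prod>j\<in>S. indicator {t<..} (x j) :: ennreal)"
        "(\<Prod>j\<in>R. indicator {..<t} ((x(i := t)) j)) = (\<Prod>j\<in>R. indicator {..<t} (x j) :: ennreal)"
      using R(3) by (auto intro!: prod.cong)
    ultimately show ?thesis
      by (simp add: indicator_pivot_event[OF fin] R_def[symmetric] mult_ac)
  qed
  have "(\<integral>\<^sup>+x. indicator (pivot_event n (i, S)) x * h (\<Sum>j\<in>S. w (x i) (x j)) \<partial>expos {..<n}) =
      (\<integral>\<^sup>+t. (\<integral>\<^sup>+x. indicator (pivot_event n (i, S)) (x(i := t)) *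
        h (\<Sum>j\<in>S. w ((x(i := t)) i) ((x(i := t)) j)) \<partial>expos (S \<union> R)) \<partial>expo)"
    using R(1,3) fin meas unfolding R(4)[symmetric]
    by (intro expos.product_nn_integral_insert_rev) simp_all
  also have "\<dots> = (\<integral>\<^sup>+t. ennreal (exp (- t) ^ k * (1 - exp (- t)) ^ (n - 1 - k)) *
        (\<integral>\<^sup>+x. h (\<Sum>j<k. w t (t + x j)) \<partial>expos {..<k}) \<partial>expo)"
  proof (rule nn_integral_cong_AE, use AE_expo_nonneg in eventually_elim)
    fix t :: real assume "0 \<le> t"
    then show "(\<integral>\<^sup>+x. indicator (pivot_event n (i, S)) (x(i := t)) *
          h (\<Sum>j\<in>S. w ((x(i := t)) i) ((x(i := t)) j)) \<partial>expos (S \<union> R)) =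
        ennreal (exp (- t) ^ k * (1 - exp (- t)) ^ (n - 1 - k)) *
        (\<integral>\<^sup>+x. h (\<Sum>j<k. w t (t + x j)) \<partial>expos {..<k})"
      unfolding fixed_pivot
      using nn_integral_expos_split_at[OF fin R(1,2), of "w t" h t] R(5) S(2) by simp
  qed
  finally show ?thesis .
qed

lemma emeasure_pivot_event:
  assumes p: "p \<in> pivots n k" and k: "k < n"
  shows "emeasure (expos {..<n}) (pivot_event n p \<inter> space (expos {..<n})) =
    ennreal (1 / real (card (pivots n k)))"
proof -
  interpret K: prob_space "expos {..<k}" by (rule prob_space_expos)
  obtain i S where p_eq: "p = (i, S)" by fastforce
  let ?b = "\<lambda>t::real. exp (- t) ^ k * (1 - exp (- t)) ^ (n - 1 - k)"
  have beta: "has_bochner_integral expo ?b (fact (n - 1 - k) * fact k / fact n)"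
    using has_bochner_integral_expo_beta[of k "n - 1 - k"] k by simp
  have "emeasure (expos {..<n}) (pivot_event n p \<inter> space (expos {..<n})) =
      (\<integral>\<^sup>+x. indicator (pivot_event n (i, S)) x * 1 \<partial>expos {..<n})"
    using sets_pivot_event[OF p] by (simp add: p_eq nn_integral_indicator' Int_commute)
  also have "\<dots> = (\<integral>\<^sup>+t. ennreal (?b t) \<partial>expo)"
    using nn_integral_pivot_event[of i S n k "\<lambda>_ _. 0::real" "\<lambda>_. 1"] p
    by (simp add: p_eq K.emeasure_space_1 split_beta')
  also have "\<dots> = ennreal (integral\<^sup>L expo ?b)"
  proof (rule nn_integral_eq_integral)
    show "integrable expo ?b" using beta by (simp add: has_bochner_integral_iff)
    show "AE t in expo. 0 \<le> ?b t" using AE_expo_nonneg by eventually_elim simp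
  qed
  also have "integral\<^sup>L expo ?b = 1 / real (card (pivots n k))"
    using beta by (simp add: has_bochner_integral_iff card_pivots[OF k])
  finally show ?thesis .
qed

lemma AE_sum_indicator_pivot_event:
  assumes "k < n"
  shows "AE x in expos {..<n}. (\<Sum>p\<in>pivots n k. indicator (pivot_event n p) x) = (1 :: ennreal)"
proof -
  interpret P: prob_space "expos {..<n}" by (rule prob_space_expos)
  let ?E = "\<lambda>p. pivot_event n p \<inter> space (expos {..<n})"
  have "real (card (pivots n k)) > 0" using assms by (simp add: card_pivots)
  moreover have "P.prob (\<Union>p\<in>pivots n k. ?E p) = (\<Sum>p\<in>pivots n k. P.prob (?E p))"
  proof (intro P.finite_measure_finite_Union finite_pivots)
    show "?E ` pivots n k \<subseteq> P.events" using sets_pivot_event by auto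
    show "disjoint_family_on ?E (pivots n k)"
      using disjoint_pivot_events[of n k] unfolding disjoint_family_on_def by blast
  qed
  moreover have "P.prob (?E p) = 1 / real (card (pivots n k))" if "p \<in> pivots n k" for p
    using emeasure_pivot_event[OF that assms] by (simp add: measure_def)
  ultimately have "P.prob (\<Union>p\<in>pivots n k. ?E p) = 1" by simp
  from P.AE_prob_1[OF this] show ?thesis
  proof eventually_elim
    case (elim x)
    then have "indicator (\<Union>p\<in>pivots n k. pivot_event n p) x = (1 :: ennreal)"
      by (auto simp: indicator_def)
    then show ?case
      by (simp only: indicator_UN_disjoint[OF finite_pivots disjoint_pivot_events])
  qed
qed

lemma measurable_upper_stat_sum:
  fixes w :: "real \<Rightarrow> real \<Rightarrow> 'b::{second_countable_topology, topological_comm_monoid_add}"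
  assumes k: "k < n" and Y: "\<And>i. i < n \<Longrightarrow> (\<lambda>\<omega>. Y \<omega> i) \<in> borel_measurable M"
    and [measurable]: "case_prod w \<in> borel_measurable (borel \<Otimes>\<^sub>M borel)"
  shows "(\<lambda>\<omega>. \<Sum>l<k. w (upper_stat n k (Y \<omega>)) (upper_stat n l (Y \<omega>))) \<in> borel_measurable M"
proof (rule borel_measurable_sum)
  fix l assume "l \<in> {..<k}"
  then have [measurable]: "(\<lambda>\<omega>. upper_stat n k (Y \<omega>)) \<in> borel_measurable M"
      "(\<lambda>\<omega>. upper_stat n l (Y \<omega>)) \<in> borel_measurable M"
    using k by (auto intro: measurable_upper_stat Y)
  show "(\<lambda>\<omega>. w (upper_stat n k (Y \<omega>)) (upper_stat n l (Y \<omega>))) \<in> borel_measurable M"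
    by measurable
qed

lemma nn_integral_upper_stat_sum:
  fixes w :: "real \<Rightarrow> real \<Rightarrow> 'b::{second_countable_topology, topological_comm_monoid_add}"
  assumes k: "k < n" and w[measurable]: "case_prod w \<in> borel_measurable (borel \<Otimes>\<^sub>M borel)"
    and h[measurable]: "h \<in> borel_measurable borel"
  shows "(\<integral>\<^sup>+x. h (\<Sum>l<k. w (upper_stat n k x) (upper_stat n l x)) \<partial>expos {..<n}) =
    (\<integral>\<^sup>+t. (\<integral>\<^sup>+x. h (\<Sum>j<k. w t (t + x j)) \<partial>expos {..<k}) \<partial>order_stat_law n k)"
proof -
  interpret K: prob_space "expos {..<k}" by (rule prob_space_expos)
  let ?top = "\<lambda>x. \<Sum>l<k. w (upper_stat n k x) (upper_stat n l x)"
  let ?on = "\<lambda>p x. indicator (pivot_event n p) x * h (\<Sum>j\<in>snd p. w (x (fst p)) (x j))"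
  let ?b = "\<lambda>t::real. exp (- t) ^ k * (1 - exp (- t)) ^ (n - 1 - k)"
  let ?\<Psi> = "\<lambda>t. \<integral>\<^sup>+x. h (\<Sum>j<k. w t (t + x j)) \<partial>expos {..<k}"
  have on_pivot: "indicator (pivot_event n p) x * h (?top x) = ?on p x" if "p \<in> pivots n k" for p x
    using upper_stat_pivot_event(1)[of "fst p" "snd p" n k x]
      upper_stat_pivot_event(2)[of "fst p" "snd p" n k x "w (x (fst p))"] that
    by (cases "x \<in> pivot_event n p") simp_all
  have "(\<integral>\<^sup>+x. h (?top x) \<partial>expos {..<n}) =
      (\<integral>\<^sup>+x. (\<Sum>p\<in>pivots n k. indicator (pivot_event n p) x * h (?top x)) \<partial>expos {..<n})"
    unfolding sum_distrib_right[symmetric]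
    by (rule nn_integral_cong_AE, use AE_sum_indicator_pivot_event[OF k] in eventually_elim) simp
  also have "\<dots> = (\<integral>\<^sup>+x. (\<Sum>p\<in>pivots n k. ?on p x) \<partial>expos {..<n})"
    by (intro nn_integral_cong sum.cong refl on_pivot)
  also have "\<dots> = (\<Sum>p\<in>pivots n k. \<integral>\<^sup>+x. ?on p x \<partial>expos {..<n})"
    by (intro nn_integral_sum) (auto intro!: measurable_on_pivot_event)
  also have "\<dots> = (\<Sum>p\<in>pivots n k. \<integral>\<^sup>+t. ennreal (?b t) * ?\<Psi> t \<partial>expo)"
    by (rule sum.cong[OF refl]) (auto simp: nn_integral_pivot_event[OF _ w h])
  also have "\<dots> = (\<integral>\<^sup>+t. ennreal (real (card (pivots n k))) * (ennreal (?b t) * ?\<Psi> t) \<partial>expo)"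
    by (simp add: nn_integral_cmult measurable_expo ennreal_of_nat_eq_real_of_nat)
  also have "\<dots> = (\<integral>\<^sup>+t. ennreal (order_stat_density n k t) * ?\<Psi> t \<partial>expo)"
    unfolding order_stat_density_def card_pivots[OF k]
    by (rule nn_integral_cong, subst ennreal_mult', simp, rule mult.assoc[symmetric])
  also have "\<dots> = (\<integral>\<^sup>+t. ?\<Psi> t \<partial>order_stat_law n k)"
    unfolding order_stat_law_def by (rule nn_integral_density[symmetric])
       (simp_all add: measurable_expo)
  finally show ?thesis .
qed

theorem distr_upper_stat_sum:
  fixes w :: "real \<Rightarrow> real \<Rightarrow> 'b::{second_countable_topology, topological_comm_monoid_add}"
  assumes k: "k < n" and w[measurable]: "case_prod w \<in> borel_measurable (borel \<Otimes>\<^sub>M borel)"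
  shows "distr (expos {..<n}) borel (\<lambda>x. \<Sum>l<k. w (upper_stat n k x) (upper_stat n l x)) =
    distr (order_stat_law n k \<Otimes>\<^sub>M expos {..<k}) borel (\<lambda>(t, x). \<Sum>j<k. w t (t + x j))"
    (is "?L = ?R")
proof (rule measure_eqI)
  fix A assume "A \<in> sets ?L"
  then have [measurable]: "A \<in> sets borel" by simp
  interpret K: prob_space "expos {..<k}" by (rule prob_space_expos)
  have [measurable]: "(\<lambda>x. \<Sum>l<k. w (upper_stat n k x) (upper_stat n l x))
      \<in> borel_measurable (expos {..<n})"
    by (rule measurable_upper_stat_sum[OF k _ w]) (simp add: measurable_expos_component)
  have "emeasure ?L A =
      (\<integral>\<^sup>+x. indicator A (\<Sum>l<k. w (upper_stat n k x) (upper_stat n l x)) \<partial>expos {..<n})"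
    by (simp add: nn_integral_distr flip: nn_integral_indicator)
  also have "\<dots> = (\<integral>\<^sup>+t. (\<integral>\<^sup>+x. indicator A (\<Sum>j<k. w t (t + x j)) \<partial>expos {..<k}) \<partial>order_stat_law n k)"
    by (rule nn_integral_upper_stat_sum[OF k w]) simp
  also have "\<dots> = (\<integral>\<^sup>+(t, x). indicator A (\<Sum>j<k. w t (t + x j))
      \<partial>(order_stat_law n k \<Otimes>\<^sub>M expos {..<k}))"
    by (subst K.nn_integral_fst[symmetric]) (simp_all add: split_beta')
  also have "\<dots> = emeasure ?R A"
    by (simp add: nn_integral_distr split_beta' flip: nn_integral_indicator)
  finally show "emeasure ?L A = emeasure ?R A" .
qed simp

section \<open>Quantile transform\<close>

text \<open>The maximum makes the function monotone on the whole line; only \<open>t \<ge> 0\<close> matters.\<close>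

definition exp_quantile :: "(real \<Rightarrow> real) \<Rightarrow> real \<Rightarrow> real" where
  "exp_quantile F t = gen_inv F (1 - 1 / exp (max 0 t))"

context real_distribution
begin

lemma bdd_above_cdf_le:
  assumes "q < 1" shows "bdd_above {x. cdf M x \<le> q}"
proof -
  have "\<forall>\<^sub>F x in at_top. q < cdf M x"
    using cdf_lim_at_top_prob assms by (rule order_tendstoD)
  then obtain b where b: "q < cdf M b" by (auto simp: eventually_at_top_linorder)
  show ?thesis
  proof (rule bdd_aboveI[of _ b])
    fix x assume "x \<in> {x. cdf M x \<le> q}"
    then have "cdf M x < cdf M b" using b by simp
    then show "x \<le> b" using cdf_nondecreasing[of b x] by linarith
  qed
qed

lemma le_gen_inv_cdf:
  assumes "cdf M x \<le> q" "q < 1" shows "x \<le> gen_inv (cdf M) q"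
  unfolding gen_inv_def using assms by (intro cSup_upper bdd_above_cdf_le) auto

lemma gen_inv_cdf_le:
  assumes "cdf M y \<le> q" "q < cdf M x" shows "gen_inv (cdf M) q \<le> x"
  unfolding gen_inv_def
proof (rule cSup_least)
  fix z assume "z \<in> {z. cdf M z \<le> q}"
  then have "cdf M z < cdf M x" using assms(2) by simp
  then show "z \<le> x" using cdf_nondecreasing[of x z] by linarith
qed (use assms(1) in blast)

lemma gen_inv_cdf_mono:
  assumes "cdf M y \<le> p" "p \<le> q" "q < 1" shows "gen_inv (cdf M) p \<le> gen_inv (cdf M) q"
  unfolding gen_inv_def using assms by (intro cSup_subset_mono bdd_above_cdf_le) auto

lemma le_cdf_if_gen_inv_le:
  assumes "gen_inv (cdf M) q \<le> x" "q < 1" shows "q \<le> cdf M x"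
proof (rule ccontr)
  assume "\<not> ?thesis"
  then have lt: "cdf M x < q" by simp
  have "(cdf M \<longlongrightarrow> cdf M x) (at_right x)"
    using cdf_is_right_cont[of x] by (simp add: continuous_within)
  then have "\<forall>\<^sub>F y in at_right x. cdf M y < q" using lt by (rule order_tendstoD)
  then obtain b where b: "b > x" "\<And>y. y > x \<Longrightarrow> y < b \<Longrightarrow> cdf M y < q"
    unfolding eventually_at_right_field by blast
  obtain y where y: "x < y" "y < b" using dense[OF b(1)] by blast
  then have "y \<le> gen_inv (cdf M) q" using b(2) assms(2) by (intro le_gen_inv_cdf less_imp_le) auto
  then show False using assms(1) y by simp
qed

end

lemma measure_expo_cdf_less:
  assumes "0 \<le> q" "q \<le> 1"
  shows "measure expo {t. 1 - exp (- t) < q} = q"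
proof (cases "q < 1")
  case False
  then have "{t::real. 1 - exp (- t) < q} = UNIV" using assms by auto
  then show ?thesis using False assms by simp
next
  case True
  have "1 - exp (- t) < q \<longleftrightarrow> t < - ln (1 - q)" for t
    using True exp_less_cancel_iff[of "ln (1 - q)" "- t"] by auto
  then have "{t. 1 - exp (- t) < q} = {..<- ln (1 - q)}" by auto
  then show ?thesis
    using emeasure_expo_lessThan[of "- ln (1 - q)"] assms True by (simp add: measure_def)
qed

locale nonneg_distribution = real_distribution M for M +
  assumes cdf_neg: "x < 0 \<Longrightarrow> cdf M x = 0"
begin

lemma exp_quantile_mono: "mono (exp_quantile (cdf M))"
proof (rule monoI)
  fix s t :: real assume "s \<le> t"
  then have "1 - 1 / exp (max 0 s) \<le> 1 - 1 / exp (max 0 t)" by (simp add: frac_le)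
  moreover have "cdf M (-1) \<le> 1 - 1 / exp (max 0 s)" using cdf_neg[of "-1"] by simp
  ultimately show "exp_quantile (cdf M) s \<le> exp_quantile (cdf M) t"
    unfolding exp_quantile_def by (intro gen_inv_cdf_mono[of "-1"]) auto
qed

lemma exp_quantile_nonneg: "0 \<le> exp_quantile (cdf M) t"
proof (rule dense_le)
  fix x :: real assume "x < 0"
  then show "x \<le> exp_quantile (cdf M) t"
    unfolding exp_quantile_def by (intro le_gen_inv_cdf) (simp_all add: cdf_neg)
qed

lemma exp_quantile_le_iff:
  assumes "0 \<le> t" "1 - exp (- t) \<noteq> cdf M x"
  shows "exp_quantile (cdf M) t \<le> x \<longleftrightarrow> 1 - exp (- t) < cdf M x"
proof -
  have "1 - 1 / exp (max 0 t) = 1 - exp (- t)"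
    using assms(1) by (simp add: exp_minus inverse_eq_divide)
  moreover have "cdf M (-1) \<le> 1 - exp (- t)" using assms(1) cdf_neg[of "-1"] by simp
  ultimately show ?thesis
    using gen_inv_cdf_le le_cdf_if_gen_inv_le[of "1 - exp (- t)" x] assms(2)
    by (auto simp: exp_quantile_def)
qed

theorem distr_exp_quantile: "distr expo borel (exp_quantile (cdf M)) = M"
proof (rule cdf_unique)
  have [measurable]: "exp_quantile (cdf M) \<in> borel_measurable borel"
    by (rule borel_measurable_mono[OF exp_quantile_mono])
  show "real_distribution (distr expo borel (exp_quantile (cdf M)))"
    by (rule expo.real_distribution_distr) measurable
  show "real_distribution M" by (rule real_distribution_axioms)
  show "cdf (distr expo borel (exp_quantile (cdf M))) = cdf M"
  proof
    fix x
    have "AE t in expo. 1 - exp (- t) \<noteq> cdf M x"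
      using AE_expo_neq[of "- ln (1 - cdf M x)"] by eventually_elim (auto dest: sym)
    then have ae: "AE t in expo. t \<in> {t. exp_quantile (cdf M) t \<le> x} \<longleftrightarrow>
        t \<in> {t. 1 - exp (- t) < cdf M x}"
      using AE_expo_nonneg by eventually_elim (simp add: exp_quantile_le_iff)
    have "cdf (distr expo borel (exp_quantile (cdf M))) x =
        measure expo {t. exp_quantile (cdf M) t \<le> x}"
      by (subst cdf_def, subst measure_distr) (auto simp: measurable_expo vimage_def)
    also have "\<dots> = measure expo {t. 1 - exp (- t) < cdf M x}"
      by (rule expo.finite_measure_eq_AE[OF ae]) auto
    also have "\<dots> = cdf M x"
      by (rule measure_expo_cdf_less) (simp_all add: cdf_nonneg cdf_bounded_prob)
    finally show "cdf (distr expo borel (exp_quantile (cdf M))) x = cdf M x" .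
  qed
qed

end

lemma (in prob_space) distr_iid_eq_distr_PiM:
  fixes X :: "'i \<Rightarrow> 'a \<Rightarrow> 'c::topological_space"
  assumes I: "finite I" "I \<noteq> {}" and X: "\<And>i. i \<in> I \<Longrightarrow> X i \<in> borel_measurable M"
    and indep: "indep_vars (\<lambda>_. borel) X I"
    and "prob_space E" and u: "u \<in> borel_measurable E"
    and law: "\<And>i. i \<in> I \<Longrightarrow> distr M borel (X i) = distr E borel u"
    and \<Phi>: "\<Phi> \<in> measurable (PiM I (\<lambda>_. borel)) N"
  shows "distr M N (\<lambda>\<omega>. \<Phi> (\<lambda>i\<in>I. X i \<omega>)) = distr (PiM I (\<lambda>_. E)) N (\<lambda>x. \<Phi> (\<lambda>i\<in>I. u (x i)))"
proof -
  interpret E: prob_space E by fact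
  let ?L = "distr E borel u"
  have sets_L: "sets (PiM I (\<lambda>_. ?L)) = sets (PiM I (\<lambda>_. borel))" by (rule sets_PiM_cong) auto
  have \<Phi>': "\<Phi> \<in> measurable (PiM I (\<lambda>_. ?L)) N"
    using \<Phi> by (simp add: measurable_cong_sets[OF sets_L refl])
  have u': "u \<in> measurable E ?L" using u by simp
  have compose: "compose I u \<in> measurable (PiM I (\<lambda>_. E)) (PiM I (\<lambda>_. ?L))"
    unfolding compose_def
    by (intro measurable_restrict measurable_compose[OF _ u'] measurable_component_singleton)
  have restrict: "(\<lambda>\<omega>. \<lambda>i\<in>I. X i \<omega>) \<in> measurable M (PiM I (\<lambda>_. borel))"
    by (intro measurable_restrict X)
  have "distr M (PiM I (\<lambda>_. borel)) (\<lambda>\<omega>. \<lambda>i\<in>I. X i \<omega>) = PiM I (\<lambda>i. distr M borel (X i))"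
    by (subst indep_vars_iff_distr_eq_PiM'[symmetric]) (use I X indep in auto)
  also have "\<dots> = PiM I (\<lambda>_. ?L)"
    by (rule PiM_cong) (simp_all add: law)
  also have "\<dots> = PiM I (\<lambda>_. distr E ?L u)"
    by (intro PiM_cong distr_cong) simp_all
  also have "\<dots> = distr (PiM I (\<lambda>_. E)) (PiM I (\<lambda>_. ?L)) (compose I u)"
    using u' by (intro distr_PiM_finite_prob_space'[symmetric] I E.prob_space_axioms
        E.prob_space_distr u)
  finally have law: "distr M (PiM I (\<lambda>_. borel)) (\<lambda>\<omega>. \<lambda>i\<in>I. X i \<omega>) = \<dots>" .
  have "distr M N (\<lambda>\<omega>. \<Phi> (\<lambda>i\<in>I. X i \<omega>)) = distr (distr M (PiM I (\<lambda>_. borel)) (\<lambda>\<omega>. \<lambda>i\<in>I. X i \<omega>)) N \<Phi>"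
    using distr_distr[OF \<Phi> restrict] by (simp add: comp_def)
  also have "\<dots> = distr (PiM I (\<lambda>_. E)) N (\<lambda>x. \<Phi> (\<lambda>i\<in>I. u (x i)))"
    unfolding law using distr_distr[OF \<Phi>' compose] by (simp add: comp_def compose_def)
  finally show ?thesis .
qed

theorem (in prob_space) distr_order_stat_sum:
  fixes w :: "real \<Rightarrow> real \<Rightarrow> 'b::{second_countable_topology, topological_comm_monoid_add}"
  assumes X: "\<And>i. X i \<in> borel_measurable M" and indep: "indep_vars (\<lambda>_. borel) X UNIV"
    and law: "\<And>i. distr M borel (X i) = distr expo borel u" and u: "mono u"
    and k: "k < n" and w[measurable]: "case_prod w \<in> borel_measurable (borel \<Otimes>\<^sub>M borel)"
  shows "distr M borel (\<lambda>\<omega>. \<Sum>l<k. w (order_stat X (n - k) n \<omega>) (order_stat X (n - l) n \<omega>)) =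
    distr (order_stat_law n k \<Otimes>\<^sub>M expos {..<k}) borel (\<lambda>(t, x). \<Sum>j<k. w (u t) (u (t + x j)))"
proof -
  define \<Phi> where "\<Phi> x = (\<Sum>l<k. w (upper_stat n k x) (upper_stat n l x))" for x
  have [measurable]: "u \<in> borel_measurable borel" by (rule borel_measurable_mono[OF u])
  have \<Phi>: "\<Phi> \<in> measurable (PiM {..<n} (\<lambda>_. borel)) borel"
    unfolding \<Phi>_def by (rule measurable_upper_stat_sum[OF k _ w]) measurable
  have \<Phi>_restrict: "\<Phi> (\<lambda>i\<in>{..<n}. y i) = \<Phi> y" for y
    by (simp add: \<Phi>_def upper_stat_restrict)
  have "distr M borel (\<lambda>\<omega>. \<Sum>l<k. w (order_stat X (n - k) n \<omega>) (order_stat X (n - l) n \<omega>)) =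
      distr M borel (\<lambda>\<omega>. \<Phi> (\<lambda>i\<in>{..<n}. X i \<omega>))"
    by (simp add: order_stat_eq_upper_stat \<Phi>_restrict) (simp add: \<Phi>_def)
  also have "\<dots> = distr (expos {..<n}) borel (\<lambda>x. \<Phi> (\<lambda>i\<in>{..<n}. u (x i)))"
    using k by (intro distr_iid_eq_distr_PiM X law \<Phi>
        indep_vars_subset[OF indep] expo.prob_space_axioms)
      (auto simp: measurable_expo)
  also have "\<dots> = distr (expos {..<n}) borel
      (\<lambda>x. \<Sum>l<k. w (u (upper_stat n k x)) (u (upper_stat n l x)))"
    unfolding \<Phi>_restrict using k by (intro distr_cong refl) (simp add: \<Phi>_def upper_stat_mono[OF u])
  also have "\<dots> = distr (order_stat_law n k \<Otimes>\<^sub>M expos {..<k}) borel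
      (\<lambda>(t, x). \<Sum>j<k. w (u t) (u (t + x j)))"
    by (rule distr_upper_stat_sum[OF k, where w = "\<lambda>s t. w (u s) (u t)"]) measurable
  finally show ?thesis .
qed

section \<open>A central limit theorem for triangular arrays\<close>

lemma of_nat_mult_exp_minus_one_tendsto:
  fixes \<theta> :: complex and K :: "nat \<Rightarrow> nat"
  assumes K: "filterlim K at_top sequentially"
  shows "(\<lambda>m. of_nat (K m) * (exp (\<theta> / of_nat (K m)) - 1)) \<longlonglongrightarrow> \<theta>"
proof -
  have K_pos: "\<forall>\<^sub>F m in sequentially. K m > 0"
    using K[unfolded filterlim_at_top, rule_format, of 1] by eventually_elim simp
  have "((\<lambda>h. exp (\<theta> * h)) has_field_derivative \<theta>) (at 0)"
    by (auto intro!: derivative_eq_intros)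
  then have "((\<lambda>h. (exp (\<theta> * h) - 1) / h) \<longlongrightarrow> \<theta>) (at 0)"
    by (simp add: has_field_derivative_iff)
  moreover have "filterlim (\<lambda>m. 1 / (of_nat (K m) :: complex)) (at 0) sequentially"
  proof (rule filterlim_atI)
    have "filterlim (\<lambda>m. of_nat (K m) :: complex) at_infinity sequentially"
      by (rule filterlim_compose[OF tendsto_of_nat K])
    then show "(\<lambda>m. 1 / (of_nat (K m) :: complex)) \<longlonglongrightarrow> 0"
      by (rule tendsto_divide_0[OF tendsto_const])
    show "\<forall>\<^sub>F m in sequentially. 1 / (of_nat (K m) :: complex) \<noteq> 0"
      using K_pos by eventually_elim simp
  qed
  ultimately have "(\<lambda>m. (exp (\<theta> * (1 / of_nat (K m))) - 1) / (1 / of_nat (K m))) \<longlonglongrightarrow> \<theta>"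
    by (rule filterlim_compose)
  then show ?thesis
    by (simp add: mult.commute)
qed

lemma power_tendsto_exp:
  fixes \<phi> :: "nat \<Rightarrow> complex" and K :: "nat \<Rightarrow> nat"
  assumes K: "filterlim K at_top sequentially" and \<phi>: "\<And>m. norm (\<phi> m) \<le> 1" and \<theta>: "Re \<theta> \<le> 0"
    and lim: "(\<lambda>m. of_nat (K m) * (\<phi> m - 1)) \<longlonglongrightarrow> \<theta>"
  shows "(\<lambda>m. \<phi> m ^ K m) \<longlonglongrightarrow> exp \<theta>"
proof -
  let ?b = "\<lambda>m. exp (\<theta> / of_nat (K m))"
  have "(\<lambda>m. norm (of_nat (K m) * (\<phi> m - 1) - of_nat (K m) * (?b m - 1))) \<longlonglongrightarrow> norm (\<theta> - \<theta>)"
    by (intro tendsto_intros lim of_nat_mult_exp_minus_one_tendsto K)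
  then have null: "(\<lambda>m. norm (of_nat (K m) * (\<phi> m - 1) - of_nat (K m) * (?b m - 1))) \<longlonglongrightarrow> 0" by simp
  have "(\<lambda>m. \<phi> m ^ K m - ?b m ^ K m) \<longlonglongrightarrow> 0"
  proof (rule Lim_null_comparison[OF _ null], intro always_eventually allI)
    fix m
    have "norm (?b m) \<le> 1"
      using \<theta> by (simp add: divide_nonpos_nonneg Re_divide_of_nat)
    from norm_power_diff[OF \<phi> this]
    have "norm (\<phi> m ^ K m - ?b m ^ K m) \<le> norm (of_nat (K m) * (\<phi> m - ?b m))"
      by (simp add: norm_mult)
    then show "norm (\<phi> m ^ K m - ?b m ^ K m) \<le>
        norm (of_nat (K m) * (\<phi> m - 1) - of_nat (K m) * (?b m - 1))"
      by (simp add: algebra_simps)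
  qed
  moreover have "\<forall>\<^sub>F m in sequentially. \<phi> m ^ K m - ?b m ^ K m = \<phi> m ^ K m - exp \<theta>"
    using K[unfolded filterlim_at_top, rule_format, of 1]
    by eventually_elim (simp flip: exp_of_nat_mult)
  ultimately have "(\<lambda>m. \<phi> m ^ K m - exp \<theta>) \<longlonglongrightarrow> 0"
    by (rule Lim_transform_eventually)
  then show ?thesis by (simp add: LIM_zero_iff)
qed

definition iexp_remainder :: "nat \<Rightarrow> real \<Rightarrow> complex" where
  "iexp_remainder n z = of_nat n *
    (iexp (z / sqrt (real n)) - (1 + \<i> * of_real (z / sqrt (real n))))"

lemma iexp_remainder_measurable[measurable]: "iexp_remainder n \<in> borel_measurable borel"
  unfolding iexp_remainder_def[abs_def] by measurable

lemma norm_iexp_remainder_le: "norm (iexp_remainder n z) \<le> z\<^sup>2 / 2"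
proof (cases "n = 0")
  case False
  let ?y = "z / sqrt (real n)"
  have "norm (iexp ?y - (1 + \<i> * of_real ?y)) \<le> ?y\<^sup>2 / 2"
    using iexp_approx1[of ?y 1] by (simp add: numeral_2_eq_2)
  then have "norm (iexp_remainder n z) \<le> real n * (?y\<^sup>2 / 2)"
    unfolding iexp_remainder_def norm_mult norm_of_nat by (intro mult_left_mono) auto
  also have "\<dots> = z\<^sup>2 / 2"
    using False by (simp add: power_divide)
  finally show ?thesis .
qed (simp add: iexp_remainder_def)

lemma norm_iexp_remainder_add_le:
  "norm (iexp_remainder n z + of_real (z\<^sup>2 / 2)) \<le> \<bar>z\<bar> ^ 3 / 6 / sqrt (real n)" if "0 < n"
proof -
  define s where "s = sqrt (real n)"
  have s: "0 < s" "real n = s\<^sup>2" using that by (simp_all add: s_def)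
  have "of_nat n * complex_of_real ((z / s)\<^sup>2 / 2) = of_real (real n * ((z / s)\<^sup>2 / 2))" by simp
  also have "real n * ((z / s)\<^sup>2 / 2) = z\<^sup>2 / 2" using s by (simp add: power_divide)
  finally have "iexp_remainder n z + of_real (z\<^sup>2 / 2) =
      of_nat n * (iexp (z / s) - (1 + \<i> * of_real (z / s)) + of_real ((z / s)\<^sup>2 / 2))"
    by (simp only: iexp_remainder_def s_def distrib_left)
  also have "norm \<dots> \<le> real n * (\<bar>z / s\<bar> ^ 3 / 6)"
  proof -
    have "norm (iexp (z / s) - (1 + \<i> * of_real (z / s)) + of_real ((z / s)\<^sup>2 / 2)) \<le>
        \<bar>z / s\<bar> ^ 3 / 6"
      using iexp_approx1[of "z / s" 2] by (simp add: eval_nat_numeral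
          power_mult_distrib algebra_simps)
    then show ?thesis unfolding norm_mult norm_of_nat by (intro mult_left_mono) auto
  qed
  also have "\<dots> = \<bar>z\<bar> ^ 3 / 6 / s"
    using s by (simp add: abs_divide power_divide power2_eq_square power3_eq_cube)
  finally show ?thesis by (simp add: s_def)
qed

lemma iexp_remainder_tendsto:
  fixes K :: "nat \<Rightarrow> nat"
  assumes K: "filterlim K at_top sequentially" and \<zeta>: "\<zeta> \<longlonglongrightarrow> z"
  shows "(\<lambda>m. iexp_remainder (K m) (\<zeta> m)) \<longlonglongrightarrow> of_real (- (z\<^sup>2 / 2))"
proof -
  have "(\<lambda>m. iexp_remainder (K m) (\<zeta> m) + of_real ((\<zeta> m)\<^sup>2 / 2)) \<longlonglongrightarrow> 0"
  proof (rule Lim_null_comparison)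
    show "\<forall>\<^sub>F m in sequentially. norm (iexp_remainder (K m) (\<zeta> m) + of_real ((\<zeta> m)\<^sup>2 / 2)) \<le>
        \<bar>\<zeta> m\<bar> ^ 3 / 6 / sqrt (real (K m))"
      using K[unfolded filterlim_at_top, rule_format, of 1]
      by eventually_elim (rule norm_iexp_remainder_add_le, simp)
    have "(\<lambda>m. \<bar>\<zeta> m\<bar> ^ 3 / 6) \<longlonglongrightarrow> \<bar>z\<bar> ^ 3 / 6"
      by (intro tendsto_intros \<zeta>) simp
    moreover have "filterlim (\<lambda>m. sqrt (real (K m))) at_top sequentially"
      by (rule filterlim_compose[OF sqrt_at_top
            filterlim_compose[OF filterlim_real_sequentially K]])
    ultimately show "(\<lambda>m. \<bar>\<zeta> m\<bar> ^ 3 / 6 / sqrt (real (K m))) \<longlonglongrightarrow> 0"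
      by (rule real_tendsto_divide_at_top)
  qed
  moreover have "(\<lambda>m. complex_of_real ((\<zeta> m)\<^sup>2 / 2)) \<longlonglongrightarrow> of_real (z\<^sup>2 / 2)"
    by (intro tendsto_intros \<zeta>) simp
  ultimately have "(\<lambda>m. (iexp_remainder (K m) (\<zeta> m) + of_real ((\<zeta> m)\<^sup>2 / 2)) - of_real ((\<zeta> m)\<^sup>2 / 2))
      \<longlonglongrightarrow> 0 - of_real (z\<^sup>2 / 2)"
    by (rule tendsto_diff)
  then show ?thesis by simp
qed

lemma integral_dominated_convergence_eventually:
  fixes f :: "'a \<Rightarrow> 'b::{banach, second_countable_topology}"
  assumes "f \<in> borel_measurable M" "\<And>i. s i \<in> borel_measurable M" "integrable M w"
    and lim: "AE x in M. (\<lambda>i. s i x) \<longlonglongrightarrow> f x"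
    and bound: "\<forall>\<^sub>F i in sequentially. AE x in M. norm (s i x) \<le> w x"
  shows "(\<lambda>i. integral\<^sup>L M (s i)) \<longlonglongrightarrow> integral\<^sup>L M f"
proof -
  obtain N where N: "\<And>i. N \<le> i \<Longrightarrow> AE x in M. norm (s i x) \<le> w x"
    using bound by (auto simp: eventually_sequentially)
  have "(\<lambda>i. integral\<^sup>L M (s (i + N))) \<longlonglongrightarrow> integral\<^sup>L M f"
  proof (rule integral_dominated_convergence[OF assms(1) assms(2) assms(3) _ N])
    show "AE x in M. (\<lambda>i. s (i + N) x) \<longlonglongrightarrow> f x"
      using lim by eventually_elim (rule LIMSEQ_ignore_initial_segment)
  qed simp
  then show ?thesis by (rule LIMSEQ_offset)
qed

lemma (in prob_space) expectation_iexp_remainder: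
  assumes [measurable]: "\<zeta> \<in> borel_measurable M" and \<zeta>: "integrable M \<zeta>"
  shows "of_nat n * ((\<integral>x. iexp (\<zeta> x / sqrt (real n)) \<partial>M) - 1) =
    (\<integral>x. iexp_remainder n (\<zeta> x) \<partial>M) + \<i> * of_real (sqrt (real n) * expectation \<zeta>)"
proof -
  define s where "s = sqrt (real n)"
  have int_iexp: "integrable M (\<lambda>x. iexp (\<zeta> x / s))"
    by (rule integrable_const_bound[of _ 1]) auto
  have int_lin: "integrable M (\<lambda>x. 1 + \<i> * complex_of_real (\<zeta> x / s))"
    using \<zeta> by simp
  have "(\<integral>x. 1 + \<i> * complex_of_real (\<zeta> x / s) \<partial>M) =
      (\<integral>x. 1 \<partial>M) + (\<integral>x. \<i> * complex_of_real (\<zeta> x / s) \<partial>M)"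
    using \<zeta> by (intro Bochner_Integration.integral_add) auto
  also have "(\<integral>x. \<i> * complex_of_real (\<zeta> x / s) \<partial>M) = \<i> * of_real (expectation \<zeta> / s)"
    by (simp only: integral_mult_right_zero integral_complex_of_real integral_divide_zero)
  finally have "(\<integral>x. iexp (\<zeta> x / s) - (1 + \<i> * of_real (\<zeta> x / s)) \<partial>M) =
      (\<integral>x. iexp (\<zeta> x / s) \<partial>M) - (1 + \<i> * of_real (expectation \<zeta> / s))"
    by (simp only: Bochner_Integration.integral_diff[OF int_iexp int_lin]) (simp add: prob_space)
  then have "(\<integral>x. iexp_remainder n (\<zeta> x) \<partial>M) =
      of_nat n * ((\<integral>x. iexp (\<zeta> x / s) \<partial>M) - (1 + \<i> * of_real (expectation \<zeta> / s)))"
    unfolding iexp_remainder_def s_def[symmetric] by (simp only: integral_mult_right_zero)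
  moreover have "of_nat n * (\<i> * of_real (expectation \<zeta> / s)) = \<i> * of_real (s * expectation \<zeta>)"
  proof -
    have "real n * (expectation \<zeta> / s) = real n / s * expectation \<zeta>" by simp
    also have "real n / s = s" by (simp add: s_def real_div_sqrt)
    finally have "real n * (expectation \<zeta> / s) = s * expectation \<zeta>" .
    then have "of_nat n * complex_of_real (expectation \<zeta> / s) = of_real (s * expectation \<zeta>)"
      by (metis of_real_mult of_real_of_nat_eq)
    then show ?thesis by (simp only: mult.left_commute)
  qed
  ultimately show ?thesis
    unfolding s_def[symmetric] by (simp only: right_diff_distrib distrib_left) simp
qed

lemma (in prob_space) expectation_iexp_remainder_tendsto:
  fixes \<zeta> :: "nat \<Rightarrow> 'a \<Rightarrow> real" and K :: "nat \<Rightarrow> nat"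
  assumes K: "filterlim K at_top sequentially"
    and [measurable]: "\<And>m. \<zeta> m \<in> borel_measurable M" "z \<in> borel_measurable M"
    and lim: "AE x in M. (\<lambda>m. \<zeta> m x) \<longlonglongrightarrow> z x"
    and dom: "\<forall>\<^sub>F m in sequentially. AE x in M. \<bar>\<zeta> m x\<bar> \<le> w x"
    and w2: "integrable M (\<lambda>x. (w x)\<^sup>2)"
  shows "(\<lambda>m. \<integral>x. iexp_remainder (K m) (\<zeta> m x) \<partial>M) \<longlonglongrightarrow> - of_real (expectation (\<lambda>x. (z x)\<^sup>2) / 2)"
proof -
  have "(\<lambda>m. \<integral>x. iexp_remainder (K m) (\<zeta> m x) \<partial>M) \<longlonglongrightarrow> (\<integral>x. complex_of_real (- ((z x)\<^sup>2 / 2)) \<partial>M)"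
  proof (rule integral_dominated_convergence_eventually[where w = "\<lambda>x. (w x)\<^sup>2 / 2"])
    show "AE x in M. (\<lambda>m. iexp_remainder (K m) (\<zeta> m x)) \<longlonglongrightarrow> of_real (- ((z x)\<^sup>2 / 2))"
      using lim by eventually_elim (rule iexp_remainder_tendsto[OF K])
    show "\<forall>\<^sub>F m in sequentially. AE x in M. norm (iexp_remainder (K m) (\<zeta> m x)) \<le> (w x)\<^sup>2 / 2"
      using dom
    proof eventually_elim
      case (elim m)
      then show ?case
      proof eventually_elim
        case (elim x)
        then have "(\<zeta> m x)\<^sup>2 \<le> (w x)\<^sup>2" using power_mono[of "\<bar>\<zeta> m x\<bar>" "w x" 2] by simp
        then show ?case using norm_iexp_remainder_le[of "K m" "\<zeta> m x"] by linarith
      qed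
    qed
  qed (use w2 in auto)
  then show ?thesis unfolding integral_complex_of_real by simp
qed

theorem (in prob_space) triangular_clt:
  fixes \<zeta> :: "nat \<Rightarrow> 'a \<Rightarrow> real" and K :: "nat \<Rightarrow> nat"
  assumes K: "filterlim K at_top sequentially"
    and \<zeta>[measurable]: "\<And>m. \<zeta> m \<in> borel_measurable M" and z: "z \<in> borel_measurable M"
    and w: "w \<in> borel_measurable M" "integrable M (\<lambda>x. (w x)\<^sup>2)"
    and lim: "AE x in M. (\<lambda>m. \<zeta> m x) \<longlonglongrightarrow> z x"
    and dom: "\<forall>\<^sub>F m in sequentially. AE x in M. \<bar>\<zeta> m x\<bar> \<le> w x"
    and mean: "(\<lambda>m. sqrt (real (K m)) * expectation (\<zeta> m)) \<longlonglongrightarrow> \<beta>"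
  shows "(\<lambda>m. (\<integral>x. iexp (\<zeta> m x / sqrt (real (K m))) \<partial>M) ^ K m) \<longlonglongrightarrow>
    exp (\<i> * of_real \<beta> - of_real (expectation (\<lambda>x. (z x)\<^sup>2) / 2))"
proof (rule power_tendsto_exp[OF K])
  let ?\<phi> = "\<lambda>m. \<integral>x. iexp (\<zeta> m x / sqrt (real (K m))) \<partial>M"
    and ?R = "\<lambda>m. \<integral>x. iexp_remainder (K m) (\<zeta> m x) \<partial>M"
  show "norm (?\<phi> m) \<le> 1" for m
    using integral_norm_bound[of M "\<lambda>x. iexp (\<zeta> m x / sqrt (real (K m)))"] by (simp add: prob_space)
  show "Re (\<i> * of_real \<beta> - of_real (expectation (\<lambda>x. (z x)\<^sup>2) / 2)) \<le> 0"
    by (simp add: integral_nonneg_AE)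
  have "(\<lambda>m. ?R m + \<i> * of_real (sqrt (real (K m)) * expectation (\<zeta> m))) \<longlonglongrightarrow>
      - of_real (expectation (\<lambda>x. (z x)\<^sup>2) / 2) + \<i> * of_real \<beta>"
    by (intro tendsto_add tendsto_mult tendsto_const tendsto_of_real mean
        expectation_iexp_remainder_tendsto[OF K \<zeta> z lim dom w(2)])
  then have lim_sum: "(\<lambda>m. ?R m + \<i> * of_real (sqrt (real (K m)) * expectation (\<zeta> m))) \<longlonglongrightarrow>
      \<i> * of_real \<beta> - of_real (expectation (\<lambda>x. (z x)\<^sup>2) / 2)"
    by simp
  have "\<forall>\<^sub>F m in sequentially. ?R m + \<i> * of_real (sqrt (real (K m)) * expectation (\<zeta> m)) =
      of_nat (K m) * (?\<phi> m - 1)"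
    using dom
  proof eventually_elim
    case (elim m)
    have "integrable M w" by (rule square_integrable_imp_integrable[OF w])
    then have "integrable M (\<zeta> m)"
      by (rule Bochner_Integration.integrable_bound) (use elim in \<open>auto elim!: eventually_mono\<close>)
    then show ?case by (intro expectation_iexp_remainder[symmetric]) simp_all
  qed
  then show "(\<lambda>m. of_nat (K m) * (?\<phi> m - 1)) \<longlonglongrightarrow>
      \<i> * of_real \<beta> - of_real (expectation (\<lambda>x. (z x)\<^sup>2) / 2)"
    by (rule Lim_transform_eventually[OF lim_sum])
qed

definition standardize :: "'a::real_vector \<Rightarrow> nat \<Rightarrow> 'a \<Rightarrow> 'a" where
  "standardize c k s = sqrt (real k) *\<^sub>R ((1 / real k) *\<^sub>R s - c)"

lemma standardize_sum: "standardize c k (\<Sum>j<k. y j) = (1 / sqrt (real k)) *\<^sub>R (\<Sum>j<k. y j - c)"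
proof (cases "k = 0")
  case False
  define s where "s = sqrt (real k)"
  have s: "real k = s\<^sup>2" "s \<noteq> 0" using False by (simp_all add: s_def)
  have "standardize c k (\<Sum>j<k. y j) = (s / real k) *\<^sub>R (\<Sum>j<k. y j) - (s\<^sup>2 / s) *\<^sub>R c"
    by (simp add: standardize_def s_def[symmetric] scaleR_diff_right power2_eq_square)
  also have "\<dots> = (1 / s) *\<^sub>R ((\<Sum>j<k. y j) - real k *\<^sub>R c)"
    using s by (simp add: scaleR_diff_right power2_eq_square)
  finally show ?thesis by (simp add: sum_subtractf sum_constant_scaleR s_def)
qed (simp add: standardize_def)

lemma continuous_standardize: "continuous_on S (standardize c k)"
  for c :: "'a::real_normed_vector"
  unfolding standardize_def[abs_def] by (intro continuous_intros)

lemma standardize_measurable[measurable]: "standardize c k \<in> borel_measurable borel"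
  for c :: "'a::real_normed_vector"
  by (rule borel_measurable_continuous_onI[OF continuous_standardize])

lemma (in prob_space) char_vec_standardized_sum:
  fixes G :: "'a \<Rightarrow> 'b::euclidean_space"
  assumes [measurable]: "G \<in> borel_measurable M"
  shows "char_vec (distr (PiM {..<k} (\<lambda>_. M)) borel (\<lambda>x. standardize c k (\<Sum>j<k. G (x j)))) v =
    (\<integral>x. iexp (v \<bullet> (G x - c) / sqrt (real k)) \<partial>M) ^ k"
proof -
  interpret P: product_sigma_finite "\<lambda>_ :: nat. M" by standard
  let ?h = "\<lambda>x. iexp (v \<bullet> (G x - c) / sqrt (real k))"
  have "char_vec (distr (PiM {..<k} (\<lambda>_. M)) borel (\<lambda>x. standardize c k (\<Sum>j<k. G (x j)))) v =
      (\<integral>x. iexp (v \<bullet> standardize c k (\<Sum>j<k. G (x j))) \<partial>PiM {..<k} (\<lambda>_. M))"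
    unfolding char_vec_def by (rule integral_distr) measurable
  also have "\<dots> = (\<integral>x. (\<Prod>j<k. ?h (x j)) \<partial>PiM {..<k} (\<lambda>_. M))"
    by (simp add: standardize_sum inner_sum_right sum_divide_distrib sum_distrib_left exp_sum)
  also have "\<dots> = (\<Prod>j<k. \<integral>x. ?h x \<partial>M)"
    by (rule P.product_integral_prod) (auto intro!: integrable_const_bound[of _ 1])
  finally show ?thesis by simp
qed

section \<open>Tilted moments of the exponential distribution\<close>

definition tilt :: "real \<Rightarrow> real \<Rightarrow> real \<Rightarrow> real \<Rightarrow> real" where
  "tilt r a b y = exp (r * y) * (a + b * y)"

definition envelope :: "real \<Rightarrow> real \<Rightarrow> real \<Rightarrow> real" where
  "envelope \<gamma> r x = (1 + x) * exp (max 0 (\<gamma> * r) * x)"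

definition tilt_bound :: "real \<Rightarrow> real \<Rightarrow> real \<Rightarrow> real \<Rightarrow> real" where
  "tilt_bound \<gamma> r a b = exp \<bar>r\<bar> * (\<bar>a\<bar> + \<bar>b\<bar> * (\<bar>\<gamma>\<bar> + 1))"

lemma tilt_measurable[measurable]: "tilt r a b \<in> borel_measurable borel"
  unfolding tilt_def[abs_def] by measurable

lemma envelope_measurable[measurable]: "envelope \<gamma> r \<in> borel_measurable borel"
  unfolding envelope_def[abs_def] by measurable

lemma tilt_derivative: "(tilt r a b has_real_derivative tilt r (r * a + b) (r * b) y) (at y)"
  unfolding tilt_def by (auto intro!: derivative_eq_intros simp: algebra_simps)

lemma tilt_bound_nonneg: "0 \<le> tilt_bound \<gamma> r a b"
  unfolding tilt_bound_def by simp

lemma one_le_envelope: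
  assumes "0 \<le> x" shows "1 \<le> envelope \<gamma> r x"
  unfolding envelope_def using assms mult_mono[of 1 "1 + x" 1 "exp (max 0 (\<gamma> * r) * x)"] by simp

lemma abs_tilt_le:
  assumes "0 \<le> x" "\<bar>d\<bar> \<le> 1"
  shows "\<bar>tilt r a b (\<gamma> * x + d)\<bar> \<le> tilt_bound \<gamma> r a b * envelope \<gamma> r x"
proof -
  define \<kappa> where "\<kappa> = max 0 (\<gamma> * r)"
  have "\<bar>r * d\<bar> \<le> \<bar>r\<bar>" using assms by (simp add: abs_mult mult_left_le)
  moreover have "\<gamma> * r * x \<le> \<kappa> * x" using assms by (intro mult_right_mono) (simp_all add: \<kappa>_def)
  ultimately have "r * (\<gamma> * x + d) \<le> \<bar>r\<bar> + \<kappa> * x" by (simp add: algebra_simps)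
  then have exp: "exp (r * (\<gamma> * x + d)) \<le> exp \<bar>r\<bar> * exp (\<kappa> * x)" by (simp flip: exp_add)
  have "\<bar>\<gamma> * x + d\<bar> \<le> \<bar>\<gamma>\<bar> * x + 1"
    using abs_triangle_ineq[of "\<gamma> * x" d] assms by (simp add: abs_mult)
  also have "\<dots> \<le> (\<bar>\<gamma>\<bar> + 1) * (1 + x)" using assms by (simp add: algebra_simps)
  finally have "\<bar>b * (\<gamma> * x + d)\<bar> \<le> \<bar>b\<bar> * ((\<bar>\<gamma>\<bar> + 1) * (1 + x))"
    unfolding abs_mult by (intro mult_left_mono) auto
  moreover have "\<bar>a\<bar> \<le> \<bar>a\<bar> * (1 + x)" using assms by (simp add: algebra_simps)
  ultimately have "\<bar>a + b * (\<gamma> * x + d)\<bar> \<le> (\<bar>a\<bar> + \<bar>b\<bar> * (\<bar>\<gamma>\<bar> + 1)) * (1 + x)"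
    using abs_triangle_ineq[of a "b * (\<gamma> * x + d)"] by (simp add: distrib_right mult.assoc)
  then have "\<bar>tilt r a b (\<gamma> * x + d)\<bar> \<le>
      (exp \<bar>r\<bar> * exp (\<kappa> * x)) * ((\<bar>a\<bar> + \<bar>b\<bar> * (\<bar>\<gamma>\<bar> + 1)) * (1 + x))"
    unfolding tilt_def abs_mult abs_exp_cancel by (intro mult_mono exp) auto
  then show ?thesis by (simp add: tilt_bound_def envelope_def \<kappa>_def mult_ac)
qed

lemma abs_tilt_diff_le:
  assumes "0 \<le> x" "\<bar>d\<bar> \<le> 1"
  shows "\<bar>tilt r a b (\<gamma> * x + d) - tilt r a b (\<gamma> * x)\<bar> \<le>
    tilt_bound \<gamma> r (r * a + b) (r * b) * envelope \<gamma> r x * \<bar>d\<bar>"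
proof -
  let ?B = "tilt_bound \<gamma> r (r * a + b) (r * b) * envelope \<gamma> r x"
  have "norm (tilt r a b (\<gamma> * x + d) - tilt r a b (\<gamma> * x)) \<le> ?B * norm (\<gamma> * x + d - \<gamma> * x)"
  proof (rule field_differentiable_bound)
    show "convex {\<gamma> * x - 1..\<gamma> * x + 1}" by (rule convex_real_interval)
    show "(tilt r a b has_real_derivative tilt r (r * a + b) (r * b) z) (at z within S)" for z S
      by (rule DERIV_subset[OF tilt_derivative]) simp
    show "norm (tilt r (r * a + b) (r * b) z) \<le> ?B" if "z \<in> {\<gamma> * x - 1..\<gamma> * x + 1}" for z
    proof -
      have "\<bar>z - \<gamma> * x\<bar> \<le> 1" using that by auto
      from abs_tilt_le[OF assms(1) this, where \<gamma> = \<gamma>] show ?thesis by simp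
    qed
  qed (use assms(2) in auto)
  then show ?thesis by simp
qed

lemma integrable_expo_moment: "l < 1 \<Longrightarrow> integrable expo (\<lambda>x. exp (l * x) * x ^ m)"
  using has_bochner_integral_expo_moment by (auto simp: has_bochner_integral_iff)

lemma integrable_envelope:
  assumes "\<gamma> * r < 1" shows "integrable expo (envelope \<gamma> r)"
proof -
  define \<kappa> where "\<kappa> = max 0 (\<gamma> * r)"
  have "integrable expo (\<lambda>x. exp (\<kappa> * x) * x ^ 0 + exp (\<kappa> * x) * x ^ 1)"
    using assms by (intro Bochner_Integration.integrable_add integrable_expo_moment)
       (simp_all add: \<kappa>_def)
  then show ?thesis by (simp add: envelope_def[abs_def] \<kappa>_def[symmetric] algebra_simps)
qed

lemma integrable_envelope_square:
  assumes "\<gamma> * r < 1 / 2" shows "integrable expo (\<lambda>x. (envelope \<gamma> r x)\<^sup>2)"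
proof -
  define \<kappa> where "\<kappa> = 2 * max 0 (\<gamma> * r)"
  have "\<kappa> < 1" using assms by (simp add: \<kappa>_def)
  then have "integrable expo
      (\<lambda>x. exp (\<kappa> * x) * x ^ 0 + 2 * (exp (\<kappa> * x) * x ^ 1) + exp (\<kappa> * x) * x ^ 2)"
    by (intro Bochner_Integration.integrable_add integrable_mult_right integrable_expo_moment)
  moreover have "exp (\<kappa> * x) * x ^ 0 + 2 * (exp (\<kappa> * x) * x ^ 1) + exp (\<kappa> * x) * x ^ 2 =
      (envelope \<gamma> r x)\<^sup>2" for x
  proof -
    have "exp (\<kappa> * x) = (exp (max 0 (\<gamma> * r) * x))\<^sup>2"
      by (simp add: \<kappa>_def power2_eq_square flip: exp_add)
    then show ?thesis by (simp add: envelope_def power2_eq_square algebra_simps)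
  qed
  ultimately show ?thesis by simp
qed

definition xi_pair :: "real \<Rightarrow> real \<Rightarrow> real \<times> real" where
  "xi_pair \<gamma> r = (xi \<gamma> r 0, xi \<gamma> r 1)"

definition asymp_bias :: "real \<Rightarrow> real \<Rightarrow> real \<Rightarrow> real \<times> real" where
  "asymp_bias \<gamma> \<rho> r = (r / ((1 - \<gamma> * r) * (1 - \<gamma> * r - \<rho>)),
    (1 - \<rho> - \<gamma>\<^sup>2 * r\<^sup>2) / ((1 - \<gamma> * r)\<^sup>2 * (1 - \<gamma> * r - \<rho>)\<^sup>2))"

definition asymp_var1 :: "real \<Rightarrow> real \<Rightarrow> real" where
  "asymp_var1 \<gamma> r = \<gamma>\<^sup>2 * r\<^sup>2 / ((1 - 2 * \<gamma> * r) * (1 - \<gamma> * r)\<^sup>2)"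

definition asymp_var2 :: "real \<Rightarrow> real \<Rightarrow> real" where
  "asymp_var2 \<gamma> r = \<gamma>\<^sup>2 * (1 - 2 * \<gamma> * r + 2 * \<gamma> ^ 4 * r ^ 4) /
    ((1 - 2 * \<gamma> * r) ^ 3 * (1 - \<gamma> * r) ^ 4)"

definition asymp_cov :: "real \<Rightarrow> real \<Rightarrow> real" where
  "asymp_cov \<gamma> r = \<gamma>\<^sup>2 * r * (1 - \<gamma> * r - \<gamma>\<^sup>2 * r\<^sup>2) / ((1 - 2 * \<gamma> * r)\<^sup>2 * (1 - \<gamma> * r) ^ 3)"

abbreviation asymp_quad_form :: "real \<Rightarrow> real \<Rightarrow> real \<times> real \<Rightarrow> real" where
  "asymp_quad_form \<gamma> r \<equiv> quad_form (asymp_var1 \<gamma> r) (asymp_var2 \<gamma> r) (asymp_cov \<gamma> r)"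

lemma xi_pair_eq: "xi_pair \<gamma> r = (1 / (1 - \<gamma> * r), \<gamma> / (1 - \<gamma> * r)\<^sup>2)"
  using Gamma_fact[of 1, where 'a = real] by (simp add: xi_pair_def xi_def power2_eq_square)

lemma has_bochner_integral_expo_linear:
  assumes "l < 1"
  shows "has_bochner_integral expo (\<lambda>x. exp (l * x) * (a + b * x)) (a / (1 - l) + b / (1 - l)\<^sup>2)"
proof -
  have "has_bochner_integral expo (\<lambda>x. a * (exp (l * x) * x ^ 0) + b * (exp (l * x) * x ^ 1))
     (a * (fact 0 / (1 - l) ^ (0 + 1)) + b * (fact 1 / (1 - l) ^ (1 + 1)))"
    by (intro has_bochner_integral_add has_bochner_integral_mult_right
        has_bochner_integral_expo_moment assms)
  then show ?thesis by (simp add: power2_eq_square algebra_simps)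
qed

lemma tilt_mean:
  assumes "\<gamma> * r < 1"
  shows "has_bochner_integral expo (\<lambda>x. tilt r a b (\<gamma> * x)) ((a, b) \<bullet> xi_pair \<gamma> r)"
  using has_bochner_integral_expo_linear[OF assms, of a "b * \<gamma>"]
  by (simp add: tilt_def xi_pair_eq inner_prod_def mult_ac)

lemma inner_asymp_bias_eq:
  fixes \<gamma> r a b :: real
  defines "d \<equiv> 1 - \<gamma> * r" and "A \<equiv> r * a + b" and "B \<equiv> b * (\<gamma> * r)"
  assumes d: "d \<noteq> 0" "d - \<rho> \<noteq> 0" and \<rho>: "\<rho> \<noteq> 0"
  shows "(a, b) \<bullet> asymp_bias \<gamma> \<rho> r =
    (A / (d - \<rho>) + B / (d - \<rho>)\<^sup>2 - (A / d + B / d\<^sup>2)) / \<rho>"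
proof -
  define e where "e = d - \<rho>"
  have de: "d \<noteq> 0" "e \<noteq> 0" using d by (simp_all add: e_def)
  have first: "(1 / e - 1 / d) / \<rho> = 1 / (d * e)"
    using de \<rho> by (simp add: divide_simps) (simp add: e_def)
  have second: "(1 / e\<^sup>2 - 1 / d\<^sup>2) / \<rho> = (d + e) / (d\<^sup>2 * e\<^sup>2)"
    using de \<rho> by (simp add: divide_simps) (simp add: e_def power2_eq_square algebra_simps)
  have "1 - \<rho> - \<gamma>\<^sup>2 * r\<^sup>2 = d * e + \<gamma> * r * (d + e)"
    by (simp add: d_def e_def power2_eq_square algebra_simps)
  moreover have "d * e / (d\<^sup>2 * e\<^sup>2) = 1 / (d * e)"
    using de by (simp add: power2_eq_square)
  ultimately have bias2: "(1 - \<rho> - \<gamma>\<^sup>2 * r\<^sup>2) / (d\<^sup>2 * e\<^sup>2) =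
      1 / (d * e) + \<gamma> * r * ((d + e) / (d\<^sup>2 * e\<^sup>2))"
    by (simp only: add_divide_distrib[of "d * e" "\<gamma> * r * (d + e)"] times_divide_eq_right)
  have "(a, b) \<bullet> asymp_bias \<gamma> \<rho> r =
      a * (r / (d * e)) + b * ((1 - \<rho> - \<gamma>\<^sup>2 * r\<^sup>2) / (d\<^sup>2 * e\<^sup>2))"
    by (simp add: asymp_bias_def inner_prod_def d_def e_def)
  also have "\<dots> = A * ((1 / e - 1 / d) / \<rho>) + B * ((1 / e\<^sup>2 - 1 / d\<^sup>2) / \<rho>)"
    unfolding first second bias2 A_def B_def by (simp add: algebra_simps add_divide_distrib)
  also have "\<dots> = (A / e + B / e\<^sup>2 - (A / d + B / d\<^sup>2)) / \<rho>"
    by (simp add: algebra_simps diff_divide_distrib add_divide_distrib)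
  finally show ?thesis by (simp only: e_def)
qed

lemma tilt_bias:
  assumes "\<gamma> * r < 1" "\<gamma> * r + \<rho> < 1" and \<rho>: "\<rho> \<noteq> 0"
  shows "has_bochner_integral expo (\<lambda>x. (exp (\<rho> * x) - 1) / \<rho> * tilt r (r * a + b) (r * b) (\<gamma> * x))
    ((a, b) \<bullet> asymp_bias \<gamma> \<rho> r)"
proof -
  let ?p = "\<gamma> * r"
  define A where "A = r * a + b"
  define B where "B = b * ?p"
  have "has_bochner_integral expo
     (\<lambda>x. (exp ((?p + \<rho>) * x) * (A + B * x) - exp (?p * x) * (A + B * x)) / \<rho>)
     ((A / (1 - (?p + \<rho>)) + B / (1 - (?p + \<rho>))\<^sup>2 - (A / (1 - ?p) + B / (1 - ?p)\<^sup>2)) / \<rho>)"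
    using assms
    by (intro has_bochner_integral_divide_zero has_bochner_integral_diff
        has_bochner_integral_expo_linear) auto
  moreover have "(\<lambda>x. (exp ((?p + \<rho>) * x) * (A + B * x) - exp (?p * x) * (A + B * x)) / \<rho>) =
      (\<lambda>x. (exp (\<rho> * x) - 1) / \<rho> * tilt r (r * a + b) (r * b) (\<gamma> * x))"
    by (simp add: fun_eq_iff tilt_def A_def B_def algebra_simps diff_divide_distrib
        add_divide_distrib exp_add)
  moreover have "(a, b) \<bullet> asymp_bias \<gamma> \<rho> r =
      (A / (1 - (?p + \<rho>)) + B / (1 - (?p + \<rho>))\<^sup>2 - (A / (1 - ?p) + B / (1 - ?p)\<^sup>2)) / \<rho>"
    using inner_asymp_bias_eq[of \<gamma> r \<rho> a b] assms by (simp add: A_def B_def diff_diff_eq)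
  ultimately show ?thesis by (simp only:)
qed

lemma asymp_cov_eq:
  assumes "\<gamma> * r < 1 / 2"
  defines "X \<equiv> 1 / (1 - 2 * (\<gamma> * r))" and "Y \<equiv> 1 / (1 - \<gamma> * r)"
  shows "asymp_var1 \<gamma> r = X - Y\<^sup>2" "asymp_cov \<gamma> r = \<gamma> * (X\<^sup>2 - Y ^ 3)"
    "asymp_var2 \<gamma> r = \<gamma>\<^sup>2 * (2 * X ^ 3 - Y ^ 4)"
proof -
  define d1 where "d1 = 1 - \<gamma> * r"
  define d2 where "d2 = 1 - 2 * (\<gamma> * r)"
  have pos: "d1 > 0" "d2 > 0" using assms(1) by (simp_all add: d1_def d2_def)
  have d: "1 - \<gamma> * r = d1" "1 - 2 * \<gamma> * r = d2"
      "1 - 2 * (\<gamma> * r) = d2" by (simp_all add: d1_def d2_def)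
  have "\<gamma>\<^sup>2 * r\<^sup>2 = d1\<^sup>2 - d2" unfolding d1_def d2_def by algebra
  then show "asymp_var1 \<gamma> r = X - Y\<^sup>2"
    unfolding asymp_var1_def X_def Y_def d using pos by (simp only:) (simp add: field_simps)
  have "\<gamma>\<^sup>2 * r * (d1 - \<gamma>\<^sup>2 * r\<^sup>2) = \<gamma> * (d1 ^ 3 - d2\<^sup>2)" unfolding d1_def d2_def by algebra
  then show "asymp_cov \<gamma> r = \<gamma> * (X\<^sup>2 - Y ^ 3)"
    unfolding asymp_cov_def X_def Y_def d using pos by (simp only:) (simp add: field_simps)
  have "d2 + 2 * \<gamma> ^ 4 * r ^ 4 = 2 * d1 ^ 4 - d2 ^ 3" unfolding d1_def d2_def by algebra
  then show "asymp_var2 \<gamma> r = \<gamma>\<^sup>2 * (2 * X ^ 3 - Y ^ 4)"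
    unfolding asymp_var2_def X_def Y_def d using pos by (simp only:) (simp add: field_simps)
qed

lemma tilt_second_moment:
  assumes "\<gamma> * r < 1 / 2"
  defines "X \<equiv> 1 / (1 - 2 * (\<gamma> * r))"
  shows "has_bochner_integral expo (\<lambda>t. (tilt r a b (\<gamma> * t))\<^sup>2)
    (a\<^sup>2 * X + 2 * a * b * \<gamma> * X\<^sup>2 + 2 * b\<^sup>2 * \<gamma>\<^sup>2 * X ^ 3)"
proof -
  let ?q = "2 * (\<gamma> * r)"
  have "has_bochner_integral expo
    (\<lambda>t. a\<^sup>2 * (exp (?q * t) * t ^ 0) + 2 * a * b * \<gamma> * (exp (?q * t) * t ^ 1) +
      b\<^sup>2 * \<gamma>\<^sup>2 * (exp (?q * t) * t ^ 2))
    (a\<^sup>2 * (fact 0 / (1 - ?q) ^ (0 + 1)) + 2 * a * b * \<gamma> * (fact 1 / (1 - ?q) ^ (1 + 1)) +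
      b\<^sup>2 * \<gamma>\<^sup>2 * (fact 2 / (1 - ?q) ^ (2 + 1)))"
    using assms by (intro has_bochner_integral_add has_bochner_integral_mult_right
        has_bochner_integral_expo_moment) auto
  moreover have "(\<lambda>t. a\<^sup>2 * (exp (?q * t) * t ^ 0) + 2 * a * b * \<gamma> * (exp (?q * t) * t ^ 1) +
      b\<^sup>2 * \<gamma>\<^sup>2 * (exp (?q * t) * t ^ 2)) = (\<lambda>t. (tilt r a b (\<gamma> * t))\<^sup>2)"
  proof
    fix t :: real
    have "exp (?q * t) = (exp (r * (\<gamma> * t)))\<^sup>2"
      by (simp add: power2_eq_square mult_ac flip: exp_add)
    then show "a\<^sup>2 * (exp (?q * t) * t ^ 0) + 2 * a * b * \<gamma> * (exp (?q * t) * t ^ 1) +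
        b\<^sup>2 * \<gamma>\<^sup>2 * (exp (?q * t) * t ^ 2) = (tilt r a b (\<gamma> * t))\<^sup>2"
      by (simp add: tilt_def power2_eq_square algebra_simps)
  qed
  moreover have "a\<^sup>2 * (fact 0 / (1 - ?q) ^ (0 + 1)) +
      2 * a * b * \<gamma> * (fact 1 / (1 - ?q) ^ (1 + 1)) + b\<^sup>2 * \<gamma>\<^sup>2 * (fact 2 / (1 - ?q) ^ (2 + 1)) =
      a\<^sup>2 * X + 2 * a * b * \<gamma> * X\<^sup>2 + 2 * b\<^sup>2 * \<gamma>\<^sup>2 * X ^ 3"
    by (simp add: X_def power_divide power2_eq_square eval_nat_numeral)
  ultimately show ?thesis by (simp only:)
qed

lemma tilt_variance:
  assumes "\<gamma> * r < 1 / 2"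
  shows "expo.variance (\<lambda>t. tilt r a b (\<gamma> * t)) = asymp_quad_form \<gamma> r (a, b)"
proof -
  note mean = tilt_mean[of \<gamma> r a b] and second = tilt_second_moment[OF assms, of a b]
  have "expo.variance (\<lambda>t. tilt r a b (\<gamma> * t)) =
      expo.expectation (\<lambda>t. (tilt r a b (\<gamma> * t))\<^sup>2) - (expo.expectation (\<lambda>t. tilt r a b (\<gamma> * t)))\<^sup>2"
    by (rule expo.variance_eq) (use mean second assms in \<open>auto simp: has_bochner_integral_iff\<close>)
  then show ?thesis
    using mean second assms
    by (simp add: has_bochner_integral_iff quad_form_def asymp_cov_eq xi_pair_eq inner_prod_def)
       (simp add: power_divide eval_nat_numeral algebra_simps)
qed

lemma asymp_quad_form_nonneg:
  assumes "\<gamma> * r < 1 / 2" shows "0 \<le> asymp_quad_form \<gamma> r z"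
  using expo.variance_positive[of "\<lambda>t. tilt r (fst z) (snd z) (\<gamma> * t)"]
    tilt_variance[OF assms] by simp

section \<open>The limit theorem\<close>

lemma (in prob_space) expectation_order_stat_sum:
  fixes w :: "real \<Rightarrow> real \<Rightarrow> 'b::{second_countable_topology, topological_comm_monoid_add}"
    and f :: "'b \<Rightarrow> real"
  assumes X: "\<And>i. X i \<in> borel_measurable M" and indep: "indep_vars (\<lambda>_. borel) X UNIV"
    and law: "\<And>i. distr M borel (X i) = distr expo borel u" and u: "mono u"
    and k: "k < n" and w[measurable]: "case_prod w \<in> borel_measurable (borel \<Otimes>\<^sub>M borel)"
    and [measurable]: "f \<in> borel_measurable borel" and f: "\<And>z. \<bar>f z\<bar> \<le> B"
  shows "expectation (\<lambda>\<omega>. f (\<Sum>l<k. w (order_stat X (n - k) n \<omega>) (order_stat X (n - l) n \<omega>))) =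
    (\<integral>t. (\<integral>x. f (\<Sum>j<k. w (u t) (u (t + x j))) \<partial>expos {..<k}) \<partial>order_stat_law n k)"
proof -
  interpret T: prob_space "order_stat_law n k" by (rule prob_space_order_stat_law[OF k])
  interpret K: prob_space "expos {..<k}" by (rule prob_space_expos)
  interpret TK: pair_prob_space "order_stat_law n k" "expos {..<k}" ..
  let ?S = "\<lambda>\<omega>. \<Sum>l<k. w (order_stat X (n - k) n \<omega>) (order_stat X (n - l) n \<omega>)"
  let ?T = "\<lambda>(t, x). \<Sum>j<k. w (u t) (u (t + x j))"
  have [measurable]: "u \<in> borel_measurable borel" by (rule borel_measurable_mono[OF u])
  have [measurable]: "?S \<in> borel_measurable M"
    unfolding order_stat_eq_upper_stat by (rule measurable_upper_stat_sum[OF k X w])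
  have [measurable]: "?T \<in> borel_measurable (order_stat_law n k \<Otimes>\<^sub>M expos {..<k})"
    unfolding split_beta' by measurable
  have "expectation (\<lambda>\<omega>. f (?S \<omega>)) = integral\<^sup>L (distr M borel ?S) f"
    by (simp add: integral_distr)
  also have "\<dots> = (\<integral>p. f (?T p) \<partial>(order_stat_law n k \<Otimes>\<^sub>M expos {..<k}))"
    unfolding distr_order_stat_sum[OF X indep law u k w] by (rule integral_distr) measurable
  also have "\<dots> = (\<integral>t. (\<integral>x. f (?T (t, x)) \<partial>expos {..<k}) \<partial>order_stat_law n k)"
    by (rule TK.integral_fst'[symmetric], rule TK.integrable_const_bound[of _ B]) (use f in auto)
  finally show ?thesis by simp
qed

definition asymp_char :: "real \<Rightarrow> real \<Rightarrow> real \<Rightarrow> real \<Rightarrow> real \<times> real \<Rightarrow> complex" where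
  "asymp_char \<gamma> \<rho> r \<mu> =
    gauss_char (\<mu> *\<^sub>R asymp_bias \<gamma> \<rho> r) (asymp_var1 \<gamma> r) (asymp_var2 \<gamma> r) (asymp_cov \<gamma> r)"

definition g_pair :: "real \<Rightarrow> real \<Rightarrow> real \<times> real" where
  "g_pair r x = (g_fun r 0 x, g_fun r 1 x)"

lemma g_pair_measurable[measurable]: "g_pair r \<in> borel_measurable borel"
  unfolding g_pair_def[abs_def] g_fun_def by measurable

lemma diff_ln_tendsto_0:
  fixes t c :: "'a \<Rightarrow> real"
  assumes c: "\<forall>\<^sub>F m in F. 0 < c m" and lim: "((\<lambda>m. exp (- t m) * c m) \<longlongrightarrow> 1) F"
  shows "((\<lambda>m. t m - ln (c m)) \<longlongrightarrow> 0) F"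
proof -
  have "((\<lambda>m. - ln (exp (- t m) * c m)) \<longlongrightarrow> - ln 1) F"
    by (intro tendsto_intros lim) simp
  moreover have "\<forall>\<^sub>F m in F. - ln (exp (- t m) * c m) = t m - ln (c m)"
    using c by eventually_elim (simp add: ln_mult_pos)
  ultimately show ?thesis
    using Lim_transform_eventually by fastforce
qed

context second_order_regular
begin

definition tilt_dev :: "real \<Rightarrow> real \<Rightarrow> real \<Rightarrow> real \<Rightarrow> real \<Rightarrow> real" where
  "tilt_dev r a0 b0 t x = tilt r a0 b0 (\<gamma> * x + dev t x)"

lemma tilt_dev_measurable[measurable]: "tilt_dev r a0 b0 t \<in> borel_measurable borel"
  unfolding tilt_dev_def[abs_def] by measurable

lemma inner_g_pair_ratio:
  assumes "0 < u t" "0 \<le> x"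
  shows "(a0, b0) \<bullet> g_pair r (u (t + x) / u t) = tilt_dev r a0 b0 t x"
proof -
  have "0 < u (t + x)" using assms monoD[OF mono_u, of t "t + x"] by simp
  then have "ln (u (t + x) / u t) = \<gamma> * x + dev t x" "u (t + x) / u t \<noteq> 0"
    using assms by (simp_all add: ln_div dev_def)
  then show ?thesis
    unfolding g_pair_def g_fun_def tilt_dev_def tilt_def powr_def inner_prod_def
    by (simp only: if_False fst_conv snd_conv) (simp add: algebra_simps)
qed

lemma expectation_\<psi>_tilt:
  assumes "\<gamma> * r < 1"
  shows "expo.expectation (\<lambda>x. \<psi> x * tilt r (r * a0 + b0) (r * b0) (\<gamma> * x)) =
    (a0, b0) \<bullet> asymp_bias \<gamma> \<rho> r"
proof -
  from assms \<rho>_neg have "\<gamma> * r + \<rho> < 1" "\<rho> \<noteq> 0" by auto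
  from tilt_bias[OF assms this, of a0 b0] show ?thesis
    unfolding \<psi>_def has_bochner_integral_iff by blast
qed

lemma eventually_dev_small:
  assumes t: "filterlim t at_top F"
  obtains C where "0 \<le> C"
    "\<forall>\<^sub>F m in F. C * \<bar>a (t m)\<bar> \<le> 1 \<and> (\<forall>x\<ge>0. \<bar>dev (t m) x\<bar> \<le> C * \<bar>a (t m)\<bar>)"
proof -
  obtain C t0 where C: "0 \<le> C" "\<And>t s. t \<ge> t0 \<Longrightarrow> s \<ge> 0 \<Longrightarrow> \<bar>dev t s\<bar> \<le> C * \<bar>a t\<bar>"
    using dev_bounded by blast
  have "((\<lambda>m. C * \<bar>a (t m)\<bar>) \<longlongrightarrow> C * \<bar>0\<bar>) F"
    by (intro tendsto_intros filterlim_compose[OF a_tendsto t])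
  then have "\<forall>\<^sub>F m in F. C * \<bar>a (t m)\<bar> < 1" by (rule order_tendstoD) simp
  moreover have "\<forall>\<^sub>F m in F. t0 \<le> t m" using t by (simp add: filterlim_at_top)
  ultimately have "\<forall>\<^sub>F m in F. C * \<bar>a (t m)\<bar> \<le> 1 \<and> (\<forall>x\<ge>0. \<bar>dev (t m) x\<bar> \<le> C * \<bar>a (t m)\<bar>)"
    by eventually_elim (simp add: C(2))
  with C(1) show thesis by (rule that)
qed

context
  fixes t :: "nat \<Rightarrow> real"
  assumes t_top: "filterlim t at_top sequentially"
begin

lemma dev_ratio_tendsto: "(\<lambda>m. dev (t m) x / a (t m)) \<longlonglongrightarrow> \<psi> x"
  by (rule filterlim_compose[OF dev_tendsto t_top])

lemma shifted_argument_tendsto: "(\<lambda>m. \<gamma> * x + dev (t m) x) \<longlonglongrightarrow> \<gamma> * x"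
proof -
  have lim: "(\<lambda>m. \<gamma> * x + dev (t m) x / a (t m) * a (t m)) \<longlonglongrightarrow> \<gamma> * x + \<psi> x * 0"
    by (intro tendsto_intros dev_ratio_tendsto filterlim_compose[OF a_tendsto t_top])
  have "\<forall>\<^sub>F m in sequentially. \<gamma> * x + dev (t m) x / a (t m) * a (t m) = \<gamma> * x + dev (t m) x"
    using eventually_compose_filterlim[OF a_nonzero t_top] by eventually_elim simp
  then show ?thesis
    using Lim_transform_eventually[OF lim] by simp
qed

lemma tilt_dev_tendsto: "(\<lambda>m. tilt_dev r a0 b0 (t m) x) \<longlonglongrightarrow> tilt r a0 b0 (\<gamma> * x)"
  unfolding tilt_dev_def
  by (rule isCont_tendsto_compose[OF DERIV_isCont[OF tilt_derivative] shifted_argument_tendsto])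

lemma eventually_abs_tilt_dev_le:
  "\<forall>\<^sub>F m in sequentially. \<forall>x\<ge>0. \<bar>tilt_dev r a0 b0 (t m) x\<bar> \<le> tilt_bound \<gamma> r a0 b0 * envelope \<gamma> r x"
proof -
  obtain C where
    "\<forall>\<^sub>F m in sequentially. C * \<bar>a (t m)\<bar> \<le> 1 \<and> (\<forall>x\<ge>0. \<bar>dev (t m) x\<bar> \<le> C * \<bar>a (t m)\<bar>)"
    using eventually_dev_small[OF t_top] by blast
  then show ?thesis
  proof eventually_elim
    case (elim m)
    then show ?case unfolding tilt_dev_def by (auto intro!: abs_tilt_le)
  qed
qed

end

context
  fixes s t :: "nat \<Rightarrow> real" and \<mu> :: real
  assumes t_top: "filterlim t at_top sequentially"
    and s_nonneg: "\<And>m. 0 \<le> s m" and s_lim: "(\<lambda>m. s m * a (t m)) \<longlonglongrightarrow> \<mu>"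
begin

lemma scaled_tilt_dev_diff_tendsto:
  "(\<lambda>m. s m * (tilt_dev r a0 b0 (t m) x - tilt r a0 b0 (\<gamma> * x))) \<longlonglongrightarrow>
    \<mu> * (\<psi> x * tilt r (r * a0 + b0) (r * b0) (\<gamma> * x))"
proof -
  obtain h where h: "\<And>z. tilt r a0 b0 z - tilt r a0 b0 (\<gamma> * x) = h z * (z - \<gamma> * x)"
      "isCont h (\<gamma> * x)" "h (\<gamma> * x) = tilt r (r * a0 + b0) (r * b0) (\<gamma> * x)"
    using tilt_derivative[of r a0 b0 "\<gamma> * x"] unfolding CARAT_DERIV by blast
  from isCont_tendsto_compose[OF h(2) shifted_argument_tendsto[OF t_top]]
  have lim: "(\<lambda>m. s m * a (t m) * (dev (t m) x / a (t m) * h (\<gamma> * x + dev (t m) x))) \<longlonglongrightarrow>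
      \<mu> * (\<psi> x * tilt r (r * a0 + b0) (r * b0) (\<gamma> * x))"
    unfolding h(3) by (intro tendsto_mult s_lim dev_ratio_tendsto[OF t_top])
  have "\<forall>\<^sub>F m in sequentially. s m * a (t m) * (dev (t m) x / a (t m) * h (\<gamma> * x + dev (t m) x)) =
      s m * (tilt_dev r a0 b0 (t m) x - tilt r a0 b0 (\<gamma> * x))"
    using eventually_compose_filterlim[OF a_nonzero t_top]
    by eventually_elim (simp add: tilt_dev_def h(1))
  then show ?thesis by (rule Lim_transform_eventually[OF lim])
qed

lemma eventually_scaled_tilt_dev_diff_le:
  "\<exists>C. \<forall>\<^sub>F m in sequentially. \<forall>x\<ge>0.
    \<bar>s m * (tilt_dev r a0 b0 (t m) x - tilt r a0 b0 (\<gamma> * x))\<bar> \<le> C * envelope \<gamma> r x"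
proof -
  obtain C where C: "0 \<le> C"
    "\<forall>\<^sub>F m in sequentially. C * \<bar>a (t m)\<bar> \<le> 1 \<and> (\<forall>x\<ge>0. \<bar>dev (t m) x\<bar> \<le> C * \<bar>a (t m)\<bar>)"
    using eventually_dev_small[OF t_top] by blast
  define D where "D = tilt_bound \<gamma> r (r * a0 + b0) (r * b0)"
  have "\<forall>\<^sub>F m in sequentially. \<bar>s m * a (t m)\<bar> < \<bar>\<mu>\<bar> + 1"
    using tendsto_rabs[OF s_lim] by (rule order_tendstoD) simp
  with C(2) have "\<forall>\<^sub>F m in sequentially. \<forall>x\<ge>0.
      \<bar>s m * (tilt_dev r a0 b0 (t m) x - tilt r a0 b0 (\<gamma> * x))\<bar> \<le>
      (\<bar>\<mu>\<bar> + 1) * (C * D) * envelope \<gamma> r x"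
  proof (eventually_elim, intro allI impI)
    fix m and x :: real
    assume small: "C * \<bar>a (t m)\<bar> \<le> 1 \<and> (\<forall>x\<ge>0. \<bar>dev (t m) x\<bar> \<le> C * \<bar>a (t m)\<bar>)"
      and scaled: "\<bar>s m * a (t m)\<bar> < \<bar>\<mu>\<bar> + 1" and x: "0 \<le> x"
    have env: "0 \<le> D * envelope \<gamma> r x"
      unfolding D_def using one_le_envelope[OF x, of \<gamma> r]
      by (intro mult_nonneg_nonneg tilt_bound_nonneg) simp
    have dev: "\<bar>dev (t m) x\<bar> \<le> C * \<bar>a (t m)\<bar>" "C * \<bar>a (t m)\<bar> \<le> 1" using small x by auto
    have "\<bar>tilt_dev r a0 b0 (t m) x - tilt r a0 b0 (\<gamma> * x)\<bar> \<le> D * envelope \<gamma> r x * \<bar>dev (t m) x\<bar>"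
      unfolding tilt_dev_def D_def using dev by (intro abs_tilt_diff_le x) linarith
    also have "\<dots> \<le> D * envelope \<gamma> r x * (C * \<bar>a (t m)\<bar>)"
      by (intro mult_left_mono dev(1) env)
    finally have "\<bar>s m * (tilt_dev r a0 b0 (t m) x - tilt r a0 b0 (\<gamma> * x))\<bar> \<le>
        s m * (D * envelope \<gamma> r x * (C * \<bar>a (t m)\<bar>))"
      unfolding abs_mult using s_nonneg[of m] by (intro mult_mono) auto
    also have "\<dots> = \<bar>s m * a (t m)\<bar> * (C * (D * envelope \<gamma> r x))"
      using s_nonneg[of m] by (simp add: abs_mult mult_ac)
    also have "\<dots> \<le> (\<bar>\<mu>\<bar> + 1) * (C * (D * envelope \<gamma> r x))"
      using scaled by (intro mult_right_mono mult_nonneg_nonneg C(1) env) simp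
    finally show "\<bar>s m * (tilt_dev r a0 b0 (t m) x - tilt r a0 b0 (\<gamma> * x))\<bar> \<le>
        (\<bar>\<mu>\<bar> + 1) * (C * D) * envelope \<gamma> r x"
      by (simp add: mult.assoc)
  qed
  then show ?thesis by blast
qed

lemma tilt_dev_mean_tendsto:
  assumes r: "\<gamma> * r < 1"
  shows "(\<lambda>m. s m * expo.expectation (\<lambda>x. tilt_dev r a0 b0 (t m) x - (a0, b0) \<bullet> xi_pair \<gamma> r)) \<longlonglongrightarrow>
    \<mu> * ((a0, b0) \<bullet> asymp_bias \<gamma> \<rho> r)"
proof -
  let ?D = "\<lambda>m x. s m * (tilt_dev r a0 b0 (t m) x - tilt r a0 b0 (\<gamma> * x))"
    and ?c = "(a0, b0) \<bullet> xi_pair \<gamma> r"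
  obtain C where C: "\<forall>\<^sub>F m in sequentially. \<forall>x\<ge>0. \<bar>?D m x\<bar> \<le> C * envelope \<gamma> r x"
    using eventually_scaled_tilt_dev_diff_le by blast
  have int_env: "integrable expo (\<lambda>x. C * envelope \<gamma> r x)"
    using integrable_envelope[OF r] by simp
  have bound: "\<forall>\<^sub>F m in sequentially. AE x in expo. norm (?D m x) \<le> C * envelope \<gamma> r x"
    using C by eventually_elim (use AE_expo_nonneg in \<open>auto elim!: eventually_mono\<close>)
  have "(\<lambda>m. expo.expectation (?D m)) \<longlonglongrightarrow>
      expo.expectation (\<lambda>x. \<mu> * (\<psi> x * tilt r (r * a0 + b0) (r * b0) (\<gamma> * x)))"
    by (rule integral_dominated_convergence_eventually[OF _ _ int_env _ bound])
       (auto simp: scaled_tilt_dev_diff_tendsto)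
  then have lim: "(\<lambda>m. expo.expectation (?D m)) \<longlonglongrightarrow> \<mu> * ((a0, b0) \<bullet> asymp_bias \<gamma> \<rho> r)"
    by (simp only: integral_mult_right_zero expectation_\<psi>_tilt[OF r])
  have mean: "integrable expo (\<lambda>x. tilt r a0 b0 (\<gamma> * x))"
      "expo.expectation (\<lambda>x. tilt r a0 b0 (\<gamma> * x)) = ?c"
    using tilt_mean[OF r, of a0 b0] by (auto simp: has_bochner_integral_iff)
  have "\<forall>\<^sub>F m in sequentially. expo.expectation (?D m) =
      s m * expo.expectation (\<lambda>x. tilt_dev r a0 b0 (t m) x - ?c)"
    using bound
  proof eventually_elim
    case (elim m)
    have "integrable expo (?D m)"
      by (rule Bochner_Integration.integrable_bound[OF int_env])
         (use elim in \<open>auto elim!: eventually_mono\<close>)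
    then have "expo.expectation (\<lambda>x. ?D m x + s m * (tilt r a0 b0 (\<gamma> * x) - ?c)) =
        expo.expectation (?D m)"
      using mean by (subst Bochner_Integration.integral_add) auto
    then show ?case
      by (simp add: algebra_simps flip: integral_mult_right_zero)
  qed
  then show ?thesis by (rule Lim_transform_eventually[OF lim])
qed

end

context
  fixes K :: "nat \<Rightarrow> nat" and t :: "nat \<Rightarrow> real" and \<mu> r :: real
  assumes K_top: "filterlim K at_top sequentially" and t_top: "filterlim t at_top sequentially"
    and scaled_a: "(\<lambda>m. sqrt (real (K m)) * a (t m)) \<longlonglongrightarrow> \<mu>" and r: "\<gamma> * r < 1 / 2"
begin

lemma char_tilt_dev_tendsto:
  defines "c \<equiv> \<lambda>v. v \<bullet> xi_pair \<gamma> r"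
  shows "(\<lambda>m. (\<integral>x. iexp ((tilt_dev r a0 b0 (t m) x - c (a0, b0)) / sqrt (real (K m))) \<partial>expo) ^ K m)
    \<longlonglongrightarrow> asymp_char \<gamma> \<rho> r \<mu> (a0, b0)"
proof -
  let ?c = "c (a0, b0)" and ?B = "tilt_bound \<gamma> r a0 b0"
  have r1: "\<gamma> * r < 1" using r by simp
  have "(\<lambda>m. (\<integral>x. iexp ((tilt_dev r a0 b0 (t m) x - ?c) / sqrt (real (K m))) \<partial>expo) ^ K m) \<longlonglongrightarrow>
      exp (\<i> * of_real (\<mu> * ((a0, b0) \<bullet> asymp_bias \<gamma> \<rho> r)) -
        of_real (expo.expectation (\<lambda>x. (tilt r a0 b0 (\<gamma> * x) - ?c)\<^sup>2) / 2))"
  proof (rule expo.triangular_clt[OF K_top, where w = "\<lambda>x. (?B + \<bar>?c\<bar>) * envelope \<gamma> r x"])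
    show "AE x in expo. (\<lambda>m. tilt_dev r a0 b0 (t m) x - ?c) \<longlonglongrightarrow> tilt r a0 b0 (\<gamma> * x) - ?c"
      by (intro AE_I2 tendsto_intros tilt_dev_tendsto t_top)
    show "\<forall>\<^sub>F m in sequentially. AE x in expo.
        \<bar>tilt_dev r a0 b0 (t m) x - ?c\<bar> \<le> (?B + \<bar>?c\<bar>) * envelope \<gamma> r x"
      using eventually_abs_tilt_dev_le[OF t_top, of r a0 b0]
    proof eventually_elim
      case (elim m)
      show ?case using AE_expo_nonneg
      proof eventually_elim
        case x: (elim x)
        then have "\<bar>tilt_dev r a0 b0 (t m) x\<bar> \<le> ?B * envelope \<gamma> r x" using elim by blast
        moreover have "\<bar>?c\<bar> * 1 \<le> \<bar>?c\<bar> * envelope \<gamma> r x"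
          by (intro mult_left_mono one_le_envelope x) simp
        ultimately show ?case unfolding distrib_right by linarith
      qed
    qed
    show "integrable expo (\<lambda>x. ((?B + \<bar>?c\<bar>) * envelope \<gamma> r x)\<^sup>2)"
      unfolding power_mult_distrib using integrable_envelope_square[OF r] by simp
    show "(\<lambda>m. sqrt (real (K m)) * expo.expectation (\<lambda>x. tilt_dev r a0 b0 (t m) x - ?c)) \<longlonglongrightarrow>
        \<mu> * ((a0, b0) \<bullet> asymp_bias \<gamma> \<rho> r)"
      unfolding c_def by (rule tilt_dev_mean_tendsto[OF t_top _ scaled_a r1]) simp
  qed (simp_all add: measurable_expo)
  moreover have "expo.expectation (\<lambda>x. (tilt r a0 b0 (\<gamma> * x) - ?c)\<^sup>2) = asymp_quad_form \<gamma> r (a0, b0)"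
    using tilt_variance[OF r, of a0 b0] tilt_mean[OF r1, of a0 b0]
    by (simp add: has_bochner_integral_iff c_def)
  ultimately show ?thesis
    by (simp add: asymp_char_def gauss_char_def)
qed

lemma asymp_char_tendsto:
  "(\<lambda>m. (\<integral>x. iexp (v \<bullet> (g_pair r (u (t m + x) / u (t m)) - xi_pair \<gamma> r) / sqrt (real (K m)))
      \<partial>expo) ^ K m) \<longlonglongrightarrow> asymp_char \<gamma> \<rho> r \<mu> v"
proof -
  obtain a0 b0 where v: "v = (a0, b0)" by fastforce
  have "\<forall>\<^sub>F m in sequentially.
      (\<integral>x. iexp ((tilt_dev r a0 b0 (t m) x - v \<bullet> xi_pair \<gamma> r) / sqrt (real (K m))) \<partial>expo) ^ K m =
      (\<integral>x. iexp (v \<bullet> (g_pair r (u (t m + x) / u (t m)) - xi_pair \<gamma> r) / sqrt (real (K m)))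
        \<partial>expo) ^ K m"
    using eventually_compose_filterlim[OF u_pos t_top]
  proof eventually_elim
    case (elim m)
    have "AE x in expo. v \<bullet> (g_pair r (u (t m + x) / u (t m)) - xi_pair \<gamma> r) =
        tilt_dev r a0 b0 (t m) x - v \<bullet> xi_pair \<gamma> r"
      using AE_expo_nonneg
      by eventually_elim (simp add: inner_diff_right inner_g_pair_ratio[OF elim] v)
    then show ?case
      by (intro arg_cong[where f = "\<lambda>z. z ^ K m"] integral_cong_AE) (auto elim!: eventually_mono)
  qed
  then show ?thesis
    using Lim_transform_eventually[OF char_tilt_dev_tendsto] by (simp add: v)
qed

end

definition conditional_mean :: "real \<Rightarrow> (real \<times> real \<Rightarrow> real) \<Rightarrow> nat \<Rightarrow> real \<Rightarrow> real" where
  "conditional_mean r f k t =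
    (\<integral>x. f (standardize (xi_pair \<gamma> r) k (\<Sum>j<k. g_pair r (u (t + x j) / u t))) \<partial>expos {..<k})"

lemma conditional_mean_measurable:
  assumes [measurable]: "f \<in> borel_measurable borel"
  shows "conditional_mean r f k \<in> borel_measurable borel"
proof -
  interpret K: prob_space "expos {..<k}" by (rule prob_space_expos)
  show ?thesis unfolding conditional_mean_def[abs_def] by measurable
qed

lemma abs_conditional_mean_le:
  assumes [measurable]: "f \<in> borel_measurable borel" and f: "\<And>z. \<bar>f z\<bar> \<le> B"
  shows "\<bar>conditional_mean r f k t\<bar> \<le> B"
proof -
  interpret K: prob_space "expos {..<k}" by (rule prob_space_expos)
  let ?Z = "\<lambda>x. standardize (xi_pair \<gamma> r) k (\<Sum>j<k. g_pair r (u (t + x j) / u t))"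
  have "\<bar>conditional_mean r f k t\<bar> \<le> (\<integral>x. \<bar>f (?Z x)\<bar> \<partial>expos {..<k})"
    unfolding conditional_mean_def by (rule integral_abs_bound)
  also have "\<dots> \<le> B"
    by (rule K.integral_le_const) (auto intro!: K.integrable_const_bound[of _ B] simp: f)
  finally show ?thesis .
qed

lemma expectation_eq_conditional_mean:
  assumes "prob_space M" and X: "\<And>i. X i \<in> borel_measurable M"
    and indep: "prob_space.indep_vars M (\<lambda>_. borel) X UNIV"
    and law: "\<And>i. distr M borel (X i) = distr expo borel u"
    and k: "k < n" and [measurable]: "f \<in> borel_measurable borel" and f: "\<And>z. \<bar>f z\<bar> \<le> B"
  shows "(\<integral>\<omega>. f (standardize (xi_pair \<gamma> r) k
      (\<Sum>l<k. g_pair r (order_stat X (n - l) n \<omega> / order_stat X (n - k) n \<omega>))) \<partial>M) =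
    integral\<^sup>L (order_stat_law n k) (conditional_mean r f k)"
  unfolding conditional_mean_def[abs_def]
  by (rule prob_space.expectation_order_stat_sum[OF assms(1) X indep law mono_u k,
        where w = "\<lambda>s t. g_pair r (t / s)"
          and f = "\<lambda>z. f (standardize (xi_pair \<gamma> r) k z)" and B = B])
     (simp_all add: split_beta' f)

lemma conditional_mean_tendsto:
  assumes K: "filterlim K at_top sequentially" and t: "filterlim t at_top sequentially"
    and \<mu>: "(\<lambda>m. sqrt (real (K m)) * a (t m)) \<longlonglongrightarrow> \<mu>" and r: "\<gamma> * r < 1 / 2"
    and N: "euclidean_distribution N" "\<And>v. char_vec N v = asymp_char \<gamma> \<rho> r \<mu> v"
    and f: "continuous_on UNIV f" "\<And>z. \<bar>f z\<bar> \<le> B"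
  shows "(\<lambda>m. conditional_mean r f (K m) (t m)) \<longlonglongrightarrow> integral\<^sup>L N f"
proof -
  define V where "V m x = standardize (xi_pair \<gamma> r) (K m)
      (\<Sum>j<K m. g_pair r (u (t m + x j) / u (t m)))" for m x
  have V[measurable]: "V m \<in> borel_measurable (expos {..<K m})" for m
    unfolding V_def by measurable
  interpret P: prob_space "expos {..<K m}" for m by (rule prob_space_expos)
  interpret char_vec_convergence "\<lambda>m. distr (expos {..<K m}) borel (V m)" N
  proof (rule char_vec_convergence.intro)
    show "euclidean_distribution (distr (expos {..<K m}) borel (V m))" for m
      by (intro euclidean_distribution.intro P.prob_space_distr V) (unfold_locales; simp)
    show "euclidean_distribution N" by (rule N)
    fix v
    have "char_vec (distr (expos {..<K m}) borel (V m)) v =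
        (\<integral>x. iexp (v \<bullet> (g_pair r (u (t m + x) / u (t m)) - xi_pair \<gamma> r) / sqrt (real (K m)))
        \<partial>expo) ^ K m"
      for m
      unfolding V_def
      by (rule expo.char_vec_standardized_sum
          [where G = "\<lambda>x. g_pair r (u (t m + x) / u (t m))"]) measurable
    then show "(\<lambda>m. char_vec (distr (expos {..<K m}) borel (V m)) v) \<longlonglongrightarrow> char_vec N v"
      using asymp_char_tendsto[OF K t \<mu> r, of v] by (simp only: N(2))
  qed
  have "(\<lambda>m. integral\<^sup>L (distr (expos {..<K m}) borel (V m)) f) \<longlonglongrightarrow> integral\<^sup>L N f"
    by (rule bounded_continuous_tendsto[OF f])
  moreover have "integral\<^sup>L (distr (expos {..<K m}) borel (V m)) f =
      conditional_mean r f (K m) (t m)" for m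
    unfolding conditional_mean_def V_def[symmetric]
    by (rule integral_distr[OF V borel_measurable_continuous_onI[OF f(1)]])
  ultimately show ?thesis by simp
qed

lemma scaled_a_tendsto_of_near:
  fixes \<tau> t :: "nat \<Rightarrow> real"
  assumes \<tau>: "filterlim \<tau> at_top sequentially" and near: "(\<lambda>m. t m - \<tau> m) \<longlonglongrightarrow> 0"
    and \<mu>: "(\<lambda>m. s m * a (\<tau> m)) \<longlonglongrightarrow> \<mu>"
  shows "(\<lambda>m. s m * a (t m)) \<longlonglongrightarrow> \<mu>"
proof -
  have "(\<lambda>m. s m * a (\<tau> m) * (a (t m) / a (\<tau> m))) \<longlonglongrightarrow> \<mu> * 1"
    by (intro tendsto_mult \<mu> a_ratio_tendsto_of_near[OF \<tau> near])
  moreover have "\<forall>\<^sub>F m in sequentially. s m * a (\<tau> m) * (a (t m) / a (\<tau> m)) = s m * a (t m)"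
    using eventually_compose_filterlim[OF a_nonzero \<tau>] by eventually_elim simp
  ultimately have "(\<lambda>m. s m * a (t m)) \<longlonglongrightarrow> \<mu> * 1"
    by (rule Lim_transform_eventually)
  then show ?thesis by simp
qed

lemma conditional_mean_tendsto_of_ratio:
  assumes K: "filterlim K at_top sequentially" and c: "filterlim c at_top sequentially"
    and ratio: "(\<lambda>m. exp (- t m) * c m) \<longlonglongrightarrow> 1"
    and \<mu>: "(\<lambda>m. sqrt (real (K m)) * a (ln (c m))) \<longlonglongrightarrow> \<mu>" and r: "\<gamma> * r < 1 / 2"
    and N: "euclidean_distribution N" "\<And>v. char_vec N v = asymp_char \<gamma> \<rho> r \<mu> v"
    and f: "continuous_on UNIV f" "\<And>z. \<bar>f z\<bar> \<le> B"
  shows "(\<lambda>m. conditional_mean r f (K m) (t m)) \<longlonglongrightarrow> integral\<^sup>L N f"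
proof -
  have ln_c: "filterlim (\<lambda>m. ln (c m)) at_top sequentially"
    by (rule filterlim_compose[OF ln_at_top c])
  have "\<forall>\<^sub>F m in sequentially. 0 < c m"
    using c by (simp add: filterlim_at_top_dense)
  then have near: "(\<lambda>m. t m - ln (c m)) \<longlonglongrightarrow> 0"
    using ratio by (rule diff_ln_tendsto_0)
  have "filterlim t at_top sequentially"
    using filterlim_tendsto_add_at_top[OF near ln_c] by simp
  then show ?thesis
    by (rule conditional_mean_tendsto[OF K _ scaled_a_tendsto_of_near[OF ln_c near \<mu>] r N f])
qed

theorem order_stat_tendsto:
  fixes f :: "real \<times> real \<Rightarrow> real" and M :: "'b measure" and X :: "nat \<Rightarrow> 'b \<Rightarrow> real"
    and k :: "nat \<Rightarrow> nat"
  assumes "prob_space M" and X: "\<And>i. X i \<in> borel_measurable M"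
    and indep: "prob_space.indep_vars M (\<lambda>_. borel) X UNIV"
    and law: "\<And>i. distr M borel (X i) = distr expo borel u"
    and k: "\<forall>\<^sub>F n in sequentially. 1 \<le> k n \<and> k n < n" and k_top: "filterlim k at_top sequentially"
    and nk: "filterlim (\<lambda>n. real n / real (k n)) at_top sequentially"
    and \<mu>: "(\<lambda>n. sqrt (real (k n)) * a (ln (real n / real (k n)))) \<longlonglongrightarrow> \<mu>" and r: "\<gamma> * r < 1 / 2"
    and N: "euclidean_distribution N" "\<And>v. char_vec N v = asymp_char \<gamma> \<rho> r \<mu> v"
    and f: "continuous_on UNIV f" "\<And>z. \<bar>f z\<bar> \<le> B"
  shows "(\<lambda>n. \<integral>\<omega>. f (standardize (xi_pair \<gamma> r) (k n)
      (\<Sum>l<k n. g_pair r (order_stat X (n - l) n \<omega> / order_stat X (n - k n) n \<omega>))) \<partial>M)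
    \<longlonglongrightarrow> integral\<^sup>L N f"
proof -
  have f_meas: "f \<in> borel_measurable borel" by (rule borel_measurable_continuous_onI[OF f(1)])
  have "(\<lambda>n. integral\<^sup>L (order_stat_law n (k n)) (conditional_mean r f (k n))) \<longlonglongrightarrow> integral\<^sup>L N f"
  proof (rule expectation_tendsto_if_concentrated
        [where Y = "\<lambda>n t. exp (- t) * (real n / real (k n))" and c = 1])
    show "\<forall>\<^sub>F n in sequentially. prob_space (order_stat_law n (k n))"
      using k by eventually_elim (simp add: prob_space_order_stat_law)
    show "conditional_mean r f (k n) \<in> borel_measurable (order_stat_law n (k n))" for n
      using conditional_mean_measurable[OF f_meas] by measurable
    show "\<bar>conditional_mean r f (k n) t\<bar> \<le> B" for n t
      by (rule abs_conditional_mean_le[OF f_meas f(2)])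
    show "(\<lambda>n. measure (order_stat_law n (k n)) {t \<in> space (order_stat_law n (k n)).
        \<delta> \<le> \<bar>exp (- t) * (real n / real (k n)) - 1\<bar>}) \<longlonglongrightarrow> 0" if "0 < \<delta>" for \<delta>
      using order_stat_law_concentration[OF k k_top that] by simp
  next
    fix L :: "nat \<Rightarrow> nat" and t :: "nat \<Rightarrow> real"
    assume L: "filterlim L at_top sequentially"
      and t: "(\<lambda>m. exp (- t m) * (real (L m) / real (k (L m)))) \<longlonglongrightarrow> 1"
    show "(\<lambda>m. conditional_mean r f (k (L m)) (t m)) \<longlonglongrightarrow> integral\<^sup>L N f"
      by (rule conditional_mean_tendsto_of_ratio[OF filterlim_compose[OF k_top L]
            filterlim_compose[OF nk L] t filterlim_compose[OF \<mu> L] r N f])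
  qed measurable
  moreover have "\<forall>\<^sub>F n in sequentially. integral\<^sup>L (order_stat_law n (k n))
      (conditional_mean r f (k n)) =
      (\<integral>\<omega>. f (standardize (xi_pair \<gamma> r) (k n)
        (\<Sum>l<k n. g_pair r (order_stat X (n - l) n \<omega> / order_stat X (n - k n) n \<omega>))) \<partial>M)"
    using k
    by eventually_elim
       (simp add: expectation_eq_conditional_mean[OF assms(1) X indep law _ f_meas f(2)])
  ultimately show ?thesis by (rule Lim_transform_eventually)
qed

end

lemma exists_asymp_gaussian:
  assumes "\<gamma> * r < 1 / 2"
  obtains N where "euclidean_distribution N" "\<And>v. char_vec N v = asymp_char \<gamma> \<rho> r \<mu> v"
    "gaussian2 N (\<mu> *\<^sub>R asymp_bias \<gamma> \<rho> r) (asymp_var1 \<gamma> r) (asymp_var2 \<gamma> r) (asymp_cov \<gamma> r)"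
proof -
  note psd = asymp_quad_form_nonneg[OF assms]
  obtain N where N: "euclidean_distribution N" "\<And>v. char_vec N v = asymp_char \<gamma> \<rho> r \<mu> v"
    using exists_gauss_char[OF psd] unfolding asymp_char_def by blast
  then show thesis
    using that gaussian2_if_char_vec[OF N(1) _ psd] by (simp add: asymp_char_def)
qed

lemma standardize_g_pair_sum:
  "standardize (xi_pair \<gamma> r) k
      (\<Sum>l<k. g_pair r (order_stat X (n - l) n \<omega> / order_stat X (n - k) n \<omega>)) =
    (sqrt (real k) * (G_n X n k r 0 \<omega> - xi \<gamma> r 0), sqrt (real k) * (G_n X n k r 1 \<omega> - xi \<gamma> r 1))"
  by (simp add: standardize_def xi_pair_def g_pair_def G_n_def prod_eq_iff fst_sum snd_sum)

theorem (in second_order_regular) order_stat_conv_distr2: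
  fixes M :: "'b measure" and X :: "nat \<Rightarrow> 'b \<Rightarrow> real" and k :: "nat \<Rightarrow> nat"
  assumes "prob_space M" "\<And>i. X i \<in> borel_measurable M" "prob_space.indep_vars M (\<lambda>_. borel) X UNIV"
    and "\<And>i. distr M borel (X i) = distr expo borel u"
    and "\<forall>\<^sub>F n in sequentially. 1 \<le> k n \<and> k n < n" "filterlim k at_top sequentially"
    and "filterlim (\<lambda>n. real n / real (k n)) at_top sequentially"
    and "(\<lambda>n. sqrt (real (k n)) * a (ln (real n / real (k n)))) \<longlonglongrightarrow> \<mu>" and "\<gamma> * r < 1 / 2"
  shows "\<exists>N. gaussian2 N (\<mu> *\<^sub>R asymp_bias \<gamma> \<rho> r) (asymp_var1 \<gamma> r) (asymp_var2 \<gamma> r) (asymp_cov \<gamma> r) \<and>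
    conv_distr2 M (\<lambda>n \<omega>. (sqrt (real (k n)) * (G_n X n (k n) r 0 \<omega> - xi \<gamma> r 0),
                          sqrt (real (k n)) * (G_n X n (k n) r 1 \<omega> - xi \<gamma> r 1))) N"
proof -
  obtain N where N: "euclidean_distribution N" "\<And>v. char_vec N v = asymp_char \<gamma> \<rho> r \<mu> v"
    "gaussian2 N (\<mu> *\<^sub>R asymp_bias \<gamma> \<rho> r) (asymp_var1 \<gamma> r) (asymp_var2 \<gamma> r) (asymp_cov \<gamma> r)"
    using exists_asymp_gaussian[OF assms(9)] by blast
  have "conv_distr2 M (\<lambda>n \<omega>. standardize (xi_pair \<gamma> r) (k n)
      (\<Sum>l<k n. g_pair r (order_stat X (n - l) n \<omega> / order_stat X (n - k n) n \<omega>))) N"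
    unfolding conv_distr2_def bounded_iff
    by (auto intro!: order_stat_tendsto[OF assms N(1,2)])
  then show ?thesis
    using N(3) unfolding standardize_g_pair_sum by blast
qed

lemma (in prob_space) nonneg_distribution_distr:
  assumes X: "X \<in> borel_measurable M" and nonneg: "\<And>\<omega>. \<omega> \<in> space M \<Longrightarrow> 0 \<le> X \<omega>"
  shows "nonneg_distribution (distr M borel X)"
proof (intro nonneg_distribution.intro nonneg_distribution_axioms.intro)
  show "real_distribution (distr M borel X)" by (rule real_distribution_distr[OF X])
  fix x :: real assume "x < 0"
  then have "X -` {..x} \<inter> space M = {}" using nonneg by force
  then show "cdf (distr M borel X) x = 0"
    using X by (simp add: cdf_def measure_distr)
qed

lemma cdf_distr_eq:
  assumes "X \<in> borel_measurable M"
  shows "cdf (distr M borel X) x = measure M {\<omega> \<in> space M. X \<omega> \<le> x}"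
  using assms by (auto simp: cdf_def measure_distr intro!: arg_cong[where f = "measure M"])

lemma (in nonneg_distribution) second_order_regular_exp_quantile:
  assumes U: "\<And>t. U t = gen_inv (cdf M) (1 - 1 / t)" and \<rho>: "\<rho> < 0"
    and A: "A \<in> borel_measurable borel" "(\<forall>\<^sub>F t in at_top. A t > 0) \<or> (\<forall>\<^sub>F t in at_top. A t < 0)"
      "(A \<longlongrightarrow> 0) at_top"
    and second_order: "\<And>x. x > 0 \<Longrightarrow>
      ((\<lambda>t. (U (t * x) / U t - x powr \<gamma>) / A t) \<longlongrightarrow> x powr \<gamma> * (x powr \<rho> - 1) / \<rho>) at_top"
  shows "second_order_regular (exp_quantile (cdf M)) (\<lambda>t. A (exp t)) \<gamma> \<rho>"
proof (rule second_order_regular.intro)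
  let ?u = "exp_quantile (cdf M)"
  show "mono ?u" by (rule exp_quantile_mono)
  show "0 \<le> ?u t" for t by (rule exp_quantile_nonneg)
  show "(\<lambda>t. A (exp t)) \<in> borel_measurable borel" using A(1) by measurable
  show "(\<forall>\<^sub>F t in at_top. 0 < A (exp t)) \<or> (\<forall>\<^sub>F t in at_top. A (exp t) < 0)"
    using A(2) eventually_compose_filterlim[OF _ exp_at_top] by blast
  show "((\<lambda>t. A (exp t)) \<longlongrightarrow> 0) at_top" by (rule filterlim_compose[OF A(3) exp_at_top])
  show "\<rho> < 0" by (rule \<rho>)
  fix s :: real
  have lim: "((\<lambda>t. (U (exp t * exp s) / U (exp t) - exp (\<gamma> * s)) / A (exp t)) \<longlongrightarrow>
      exp (\<gamma> * s) * (exp (\<rho> * s) - 1) / \<rho>) at_top"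
    using filterlim_compose[OF second_order[of "exp s"] exp_at_top] by (simp add: powr_def)
  have "\<forall>\<^sub>F t in at_top. (U (exp t * exp s) / U (exp t) - exp (\<gamma> * s)) / A (exp t) =
      (?u (t + s) / ?u t - exp (\<gamma> * s)) / A (exp t)"
    using eventually_ge_at_top[of "\<bar>s\<bar>"]
    by eventually_elim (auto simp: U exp_quantile_def max_def exp_add)
  then show "((\<lambda>t. (?u (t + s) / ?u t - exp (\<gamma> * s)) / A (exp t)) \<longlongrightarrow>
      exp (\<gamma> * s) * (exp (\<rho> * s) - 1) / \<rho>) at_top"
    by (rule Lim_transform_eventually[OF lim])
qed

theorem theorem2:
  fixes M :: "'a measure" and X :: "nat \<Rightarrow> 'a \<Rightarrow> real"
    and F U A :: "real \<Rightarrow> real" and \<gamma> \<rho> r \<mu> :: real and k :: "nat \<Rightarrow> nat"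
  assumes "prob_space M"
    and "\<And>i. X i \<in> borel_measurable M"
    and "prob_space.indep_vars M (\<lambda>_. borel) X UNIV"
    and "\<And>i. distr M borel (X i) = distr M borel (X 0)"
    and "\<And>i \<omega>. \<omega> \<in> space M \<Longrightarrow> X i \<omega> \<ge> 0"
    and "\<And>x. F x = measure M {\<omega> \<in> space M. X 0 \<omega> \<le> x}"
    and "\<And>t. U t = gen_inv F (1 - 1 / t)"
    and "\<gamma> > 0" and "\<rho> < 0"
    and "A \<in> borel_measurable borel"
    and "(\<forall>\<^sub>F t in at_top. A t > 0) \<or> (\<forall>\<^sub>F t in at_top. A t < 0)"
    and "(A \<longlongrightarrow> 0) at_top"
    and "\<And>x. x > 0 \<Longrightarrow>
           ((\<lambda>t. (U (t * x) / U t - x powr \<gamma>) / A t) \<longlongrightarrow> x powr \<gamma> * (x powr \<rho> - 1) / \<rho>) at_top"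
    and "\<gamma> * r < 1 / 2"
    and "\<And>n. n \<ge> 2 \<Longrightarrow> 1 \<le> k n \<and> k n < n"
    and "filterlim k at_top sequentially"
    and "filterlim (\<lambda>n. real n / real (k n)) at_top sequentially"
    and "(\<lambda>n. sqrt (real (k n)) * A (real n / real (k n))) \<longlonglongrightarrow> \<mu>"
  shows "let d = (\<lambda>m::real. 1 - m * \<gamma> * r);
             \<nu>1 = r / (d 1 * (d 1 - \<rho>));
             \<nu>2 = (1 - \<rho> - \<gamma>\<^sup>2 * r\<^sup>2) / ((d 1)\<^sup>2 * (d 1 - \<rho>)\<^sup>2);
             s1 = \<gamma>\<^sup>2 * r\<^sup>2 / (d 2 * (d 1)\<^sup>2);
             s2 = \<gamma>\<^sup>2 * (d 2 + 2 * \<gamma> ^ 4 * r ^ 4) / ((d 2) ^ 3 * (d 1) ^ 4);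
             s12 = \<gamma>\<^sup>2 * r * (d 1 - \<gamma>\<^sup>2 * r\<^sup>2) / ((d 2)\<^sup>2 * (d 1) ^ 3);
             Z = (\<lambda>n \<omega>. (sqrt (real (k n)) * (G_n X n (k n) r 0 \<omega> - xi \<gamma> r 0),
                          sqrt (real (k n)) * (G_n X n (k n) r 1 \<omega> - xi \<gamma> r 1)))
         in \<exists>N. gaussian2 N (\<mu> * \<nu>1, \<mu> * \<nu>2) s1 s2 s12 \<and> conv_distr2 M Z N"
proof -
  interpret prob_space M by fact
  define D where "D = distr M borel (X 0)"
  interpret D: nonneg_distribution D
    unfolding D_def using assms(2,5) by (rule nonneg_distribution_distr)
  have F: "F = cdf D"
    using assms(2,6) by (simp add: fun_eq_iff D_def cdf_distr_eq)
  interpret second_order_regular "exp_quantile (cdf D)" "\<lambda>t. A (exp t)" \<gamma> \<rho>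
    using D.second_order_regular_exp_quantile[OF assms(7)[unfolded F] assms(9-13)] .
  have "distr M borel (X i) = distr expo borel (exp_quantile (cdf D))" for i
    using assms(4)[of i] by (simp only: D.distr_exp_quantile) (simp only: D_def)
  moreover have k: "\<forall>\<^sub>F n in sequentially. 1 \<le> k n \<and> k n < n"
    using eventually_ge_at_top[of 2] by eventually_elim (rule assms(15))
  moreover have "(\<lambda>n. sqrt (real (k n)) * A (exp (ln (real n / real (k n))))) \<longlonglongrightarrow> \<mu>"
  proof (rule Lim_transform_eventually[OF assms(18)])
    show "\<forall>\<^sub>F n in sequentially. sqrt (real (k n)) * A (real n / real (k n)) =
        sqrt (real (k n)) * A (exp (ln (real n / real (k n))))"
      using k by eventually_elim simp
  qed
  ultimately show ?thesis
    using order_stat_conv_distr2[OF assms(1-3) _ _ assms(16,17) _ assms(14)]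
    by (simp add: Let_def asymp_bias_def asymp_var1_def asymp_var2_def asymp_cov_def)
qed

end
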